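(* Let $\mathfrak{M}=(\mathcal{Q},\mathcal{W},\mathcal{R})$ be an hereditary abelian model structure on an abelian category $\mathcal{A}$. For each $n\in\mathbb{Z}$, $\ell\mathrm{Ext}^n_{\mathfrak{M}}(A,B)$ is a covariant additive functor in the variable $B\in\mathcal{A}$ and a contravariant additive functor in the variable $A\in\mathcal{A}$. It satisfies the following properties: (1) If $A$ is cofibrant, then each fibration $g:B\to B'$ induces a long exact cohomology sequence $$\cdots\to \ell\mathrm{Ext}^{n-1}_{\mathfrak{M}}(A,B')\to \ell\mathrm{Ext}^{n}_{\mathfrak{M}}(A,\ker g)\to \ell\mathrm{Ext}^{n}_{\mathfrak{M}}(A,B)\to \ell\mathrm{Ext}^{n}_{\mathfrak{M}}(A,B')\to \ell\mathrm{Ext}^{n+1}_{\mathfrak{M}}(A,\ker g)\to\cdots$$ Moreover, each functor $\ell\mathrm{Ext}^n_{\mathfrak{M}}(A,-)$ identifies left homotopic maps whenever $A$ is cofibrant; in particular it factors through $\gamma_\omega:\mathcal{A}\to \mathrm{St}_\omega(\mathcal{A})$. (2) If $B$ is fibrant, then each cofibration $f:A\to A'$ induces a long exact cohomology sequence $$\cdots\to \ell\mathrm{Ext}^{n-1}_{\mathfrak{M}}(A,B)\to \ell\mathrm{Ext}^{n}_{\mathfrak{M}}(\mathrm{cok} f,B)\to \ell\mathrm{Ext}^{n}_{\mathfrak{M}}(A',B)\to \ell\mathrm{Ext}^{n}_{\mathfrak{M}}(A,B)\to \ell\mathrm{Ext}^{n+1}_{\mathfrak{M}}(\mathrm{cok}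 f,B)\to\cdots$$ Moreover, for any $B$, $\ell\mathrm{Ext}^n_{\mathfrak{M}}(-,B)$ factors through $\gamma_\omega:\mathcal{A}\to \mathrm{St}_\omega(\mathcal{A})$.
   Context: $\mathrm{Ext}^n_{\mathcal{A}}$ denotes the Yoneda Ext groups of the abelian category $\mathcal{A}$ (no enough projectives or injectives assumed). For a class $\mathcal{C}$ of objects, $\mathcal{C}^\perp=\{X:\mathrm{Ext}^1_{\mathcal{A}}(C,X)=0\ \forall C\in\mathcal{C}\}$, and ${}^\perp\mathcal{C}$ is defined dually. A cotorsion pair is a pair of classes $(\mathcal{X},\mathcal{Y})$ with $\mathcal{Y}=\mathcal{X}^\perp$ and $\mathcal{X}={}^\perp\mathcal{Y}$. It is complete if every object $A$ admits short exact sequences $0\to Y\to X\to A\to0$ ("enough projectives") and $0\to A\to Y'\to X'\to 0$ ("enough injectives") with $X,X'\in\mathcal{X}$, $Y,Y'\in\mathcal{Y}$; it is hereditary if $\mathrm{Ext}^i_{\mathcal{A}}(X,Y)=0$ for all $X\in\mathcal{X}$, $Y\in\mathcal{Y}$, $i\ge1$. An hereditary abelian model structure is a triple $\mathfrak{M}=(\mathcal{Q},\mathcal{W},\mathcal{R})$ of classes of objects such that $\mathcal{W}$ is thick (2 out of 3 property on short exact sequences) and, with $\mathcal{Q}_{\mathcal{W}}=\mathcal{Q}\cap\mathcal{W}$ and $\mathcal{R}_{\mathcal{W}}=\mathcal{W}\cap\mathcal{R}$, both $(\mathcal{Q},\mathcal{R}_{\mathcal{W}})$ and $(\mathcal{Q}_{\mathcal{W}},\mathcal{R})$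 are complete hereditary cotorsion pairs. Objects of $\mathcal{Q},\mathcal{R},\mathcal{Q}_{\mathcal{W}},\mathcal{R}_{\mathcal{W}}$ are called cofibrant, fibrant, trivially cofibrant, trivially fibrant, respectively. A cofibration is a monomorphism with cofibrant cokernel; a fibration is an epimorphism with fibrant kernel. The core is $\omega=\mathcal{Q}\cap\mathcal{W}\cap\mathcal{R}$. Two parallel morphisms $f,g$ are left homotopic if $g-f$ factors through an object of $\mathcal{R}_{\mathcal{W}}$, and homotopic ($f\sim^\omega g$) if $g-f$ factors through an object of $\omega$. $\mathrm{St}_\omega(\mathcal{A})$ is the additive category with the objects of $\mathcal{A}$ and morphism groups $\mathrm{Hom}_{\mathcal{A}}(A,B)/\sim^\omega$; $\gamma_\omega$ is the canonical functor. An $\mathfrak{M}$-resolution of $A$ is an exact chain complex $W_A\equiv\cdots\to Q_1\xrightarrow{d_1}Q_0\xrightarrow{d_0}R_{-1}\xrightarrow{d_{-1}}R_{-2}\to\cdots$ (subscripts are degrees) with $d_0=\eta_A\epsilon_A$, where $\cdots\to Q_1\to Q_0\xrightarrow{\epsilon_A}A\to0$ is exact with each $Q_i\in\mathcal{Q}_{\mathcal{W}}$ and $\ker\epsilon_A$, $\ker d_i$ ($i\ge1$) in $\mathcal{R}$, and $0\to A\xrightarrow{\eta_A}R_{-1}\to R_{-2}\to\cdots$ is exact with each $R_i\in\mathcal{R}_{\mathcal{W}}$ and $\mathrm{cok}\,\eta_A$, $\mathrm{cok}\, d_i$ ($i\le-1$) in $\mathcal{Q}$. One defines $\ell\mathrm{Ext}^n_{\mathfrak{M}}(A,B):=H^n[\mathrm{Hom}_{\mathcal{A}}(W_A,B)]$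 for any $\mathfrak{M}$-resolution $W_A$ of $A$; a different choice of $W_A$ gives a canonically isomorphic group. A morphism $f:A\to A'$ acts through a chain map $W_A\to W_{A'}$ extending $f$ (compatible with the maps $\epsilon$ and $\eta$), which exists and is unique up to chain homotopy. *)

theory Defs
  imports "HOL-Algebra.Coset"
begin

section \<open>Abelian categories\<close>

text \<open>
  Every morphism carries its domain and codomain, so distinct hom-sets are disjoint and a single
  binary operation can serve as composition, another one as addition. \<open>g \<cdot> f\<close> is
  \<open>g\<close> after \<open>f\<close>. Outside \<open>Obj\<close>, \<open>Arr\<close> and composable or parallel pairs the fields
  are unspecified.
\<close>

record ('o, 'm) lincat =
  Obj :: "'o set"
  Arr :: "'m set"
  Dom :: "'m \<Rightarrow> 'o"
  Cod :: "'m \<Rightarrow> 'o"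
  Ide :: "'o \<Rightarrow> 'm"
  Cmp :: "'m \<Rightarrow> 'm \<Rightarrow> 'm"  (infixr "\<cdot>\<index>" 75)
  Add :: "'m \<Rightarrow> 'm \<Rightarrow> 'm"
  Zer :: "'o \<Rightarrow> 'o \<Rightarrow> 'm"

definition Hom :: "('o, 'm) lincat \<Rightarrow> 'o \<Rightarrow> 'o \<Rightarrow> 'm set" where
  "Hom C A B = {f \<in> Arr C. Dom C f = A \<and> Cod C f = B}"

text \<open>The additive group of morphisms, as a (multiplicatively written) HOL-Algebra group.\<close>

definition hom_group :: "('o, 'm) lincat \<Rightarrow> 'o \<Rightarrow> 'o \<Rightarrow> 'm monoid" where
  "hom_group C A B = \<lparr>carrier = Hom C A B, mult = Add C, one = Zer C A B\<rparr>"

locale preadditive_category =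
  fixes C :: "('o, 'm) lincat" (structure)
  assumes Dom_Obj: "f \<in> Arr C \<Longrightarrow> Dom C f \<in> Obj C"
    and Cod_Obj: "f \<in> Arr C \<Longrightarrow> Cod C f \<in> Obj C"
    and Ide_Hom: "A \<in> Obj C \<Longrightarrow> Ide C A \<in> Hom C A A"
    and Cmp_Hom: "f \<in> Hom C A B \<Longrightarrow> g \<in> Hom C B D \<Longrightarrow> g \<cdot> f \<in> Hom C A D"
    and Cmp_assoc: "f \<in> Hom C A B \<Longrightarrow> g \<in> Hom C B D \<Longrightarrow> h \<in> Hom C D E \<Longrightarrow>
          h \<cdot> (g \<cdot> f) = (h \<cdot> g) \<cdot> f"
    and Cmp_Ide: "f \<in> Hom C A B \<Longrightarrow> f \<cdot> Ide C A = f"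
    and Ide_Cmp: "f \<in> Hom C A B \<Longrightarrow> Ide C B \<cdot> f = f"
    and hom_comm_group: "A \<in> Obj C \<Longrightarrow> B \<in> Obj C \<Longrightarrow> comm_group (hom_group C A B)"
    and Cmp_Add: "f \<in> Hom C A B \<Longrightarrow> f' \<in> Hom C A B \<Longrightarrow> g \<in> Hom C B D \<Longrightarrow>
          g \<cdot> Add C f f' = Add C (g \<cdot> f) (g \<cdot> f')"
    and Add_Cmp: "f \<in> Hom C A B \<Longrightarrow> g \<in> Hom C B D \<Longrightarrow> g' \<in> Hom C B D \<Longrightarrow>
          Add C g g' \<cdot> f = Add C (g \<cdot> f) (g' \<cdot> f)"

definition zero_object :: "('o, 'm) lincat \<Rightarrow> 'o \<Rightarrow> bool" where
  "zero_object C Z \<longleftrightarrow> Z \<in> Obj C \<and>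
    (\<forall>A\<in>Obj C. (\<exists>!f. f \<in> Hom C A Z) \<and> (\<exists>!f. f \<in> Hom C Z A))"

definition biproduct ::
  "('o, 'm) lincat \<Rightarrow> 'o \<Rightarrow> 'o \<Rightarrow> 'o \<Rightarrow> 'm \<Rightarrow> 'm \<Rightarrow> 'm \<Rightarrow> 'm \<Rightarrow> bool" where
  "biproduct C A B P i j p q \<longleftrightarrow> P \<in> Obj C \<and>
    i \<in> Hom C A P \<and> j \<in> Hom C B P \<and> p \<in> Hom C P A \<and> q \<in> Hom C P B \<and>
    p \<cdot>\<^bsub>C\<^esub> i = Ide C A \<and> q \<cdot>\<^bsub>C\<^esub> j = Ide C B \<and>
    Add C (i \<cdot>\<^bsub>C\<^esub> p) (j \<cdot>\<^bsub>C\<^esub> q) = Ide C P"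

definition monic :: "('o, 'm) lincat \<Rightarrow> 'm \<Rightarrow> bool" where
  "monic C f \<longleftrightarrow> f \<in> Arr C \<and>
    (\<forall>A\<in>Obj C. \<forall>u\<in>Hom C A (Dom C f). \<forall>v\<in>Hom C A (Dom C f). f \<cdot>\<^bsub>C\<^esub> u = f \<cdot>\<^bsub>C\<^esub> v \<longrightarrow> u = v)"

definition epic :: "('o, 'm) lincat \<Rightarrow> 'm \<Rightarrow> bool" where
  "epic C f \<longleftrightarrow> f \<in> Arr C \<and>
    (\<forall>A\<in>Obj C. \<forall>u\<in>Hom C (Cod C f) A. \<forall>v\<in>Hom C (Cod C f) A. u \<cdot>\<^bsub>C\<^esub> f = v \<cdot>\<^bsub>C\<^esub> f \<longrightarrow> u = v)"

definition is_kernel :: "('o, 'm) lincat \<Rightarrow> 'm \<Rightarrow> 'm \<Rightarrow> bool" where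
  "is_kernel C k f \<longleftrightarrow> f \<in> Arr C \<and> k \<in> Arr C \<and> Cod C k = Dom C f \<and>
    f \<cdot>\<^bsub>C\<^esub> k = Zer C (Dom C k) (Cod C f) \<and>
    (\<forall>A\<in>Obj C. \<forall>u\<in>Hom C A (Dom C f). f \<cdot>\<^bsub>C\<^esub> u = Zer C A (Cod C f) \<longrightarrow>
       (\<exists>!v. v \<in> Hom C A (Dom C k) \<and> k \<cdot>\<^bsub>C\<^esub> v = u))"

definition is_cokernel :: "('o, 'm) lincat \<Rightarrow> 'm \<Rightarrow> 'm \<Rightarrow> bool" where
  "is_cokernel C c f \<longleftrightarrow> f \<in> Arr C \<and> c \<in> Arr C \<and> Dom C c = Cod C f \<and>
    c \<cdot>\<^bsub>C\<^esub> f = Zer C (Dom C f) (Cod C c) \<and>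
    (\<forall>A\<in>Obj C. \<forall>u\<in>Hom C (Cod C f) A. u \<cdot>\<^bsub>C\<^esub> f = Zer C (Dom C f) A \<longrightarrow>
       (\<exists>!v. v \<in> Hom C (Cod C c) A \<and> v \<cdot>\<^bsub>C\<^esub> c = u))"

locale abelian_category = preadditive_category +
  assumes ex_zero_object: "\<exists>Z. zero_object C Z"
    and ex_biproduct: "A \<in> Obj C \<Longrightarrow> B \<in> Obj C \<Longrightarrow> \<exists>P i j p q. biproduct C A B P i j p q"
    and ex_kernel: "f \<in> Arr C \<Longrightarrow> \<exists>k. is_kernel C k f"
    and ex_cokernel: "f \<in> Arr C \<Longrightarrow> \<exists>c. is_cokernel C c f"
    and monic_normal: "monic C f \<Longrightarrow> \<exists>g. is_kernel C f g"
    and epic_normal: "epic C f \<Longrightarrow> \<exists>g. is_cokernel C f g"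

definition is_image :: "('o, 'm) lincat \<Rightarrow> 'm \<Rightarrow> 'm \<Rightarrow> bool" where
  "is_image C m f \<longleftrightarrow> (\<exists>c. is_cokernel C c f \<and> is_kernel C m c)"

text \<open>Exactness of \<open>\<bullet> \<rightarrow> \<bullet> \<rightarrow> \<bullet>\<close> at the middle object, the first map being \<open>f\<close>
  and the second \<open>g\<close>: the image of \<open>f\<close> is the kernel of \<open>g\<close>, as subobjects.\<close>

definition exact :: "('o, 'm) lincat \<Rightarrow> 'm \<Rightarrow> 'm \<Rightarrow> bool" where
  "exact C f g \<longleftrightarrow> f \<in> Arr C \<and> g \<in> Arr C \<and> Cod C f = Dom C g \<and>
    (\<exists>m. is_image C m f \<and> is_kernel C m g)"

definition short_exact :: "('o, 'm) lincat \<Rightarrow> 'm \<Rightarrow> 'm \<Rightarrow> bool" where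
  "short_exact C f g \<longleftrightarrow> monic C f \<and> exact C f g \<and> epic C g"


section \<open>Yoneda Ext\<close>

text \<open>
  For \<open>n \<ge> 1\<close>, an \<open>n\<close>-fold extension \<open>0 \<rightarrow> Y \<rightarrow> E\<^sub>n \<rightarrow> \<dots> \<rightarrow> E\<^sub>1 \<rightarrow> X \<rightarrow> 0\<close> of
  \<open>X\<close> by \<open>Y\<close> is encoded by the list of its \<open>n + 1\<close> nontrivial maps, from left to right.
\<close>

definition extension :: "('o, 'm) lincat \<Rightarrow> nat \<Rightarrow> 'o \<Rightarrow> 'o \<Rightarrow> 'm list \<Rightarrow> bool" where
  "extension C n X Y fs \<longleftrightarrow> length fs = Suc n \<and>
    monic C (fs ! 0) \<and> Dom C (fs ! 0) = Y \<and>
    (\<forall>i<n. exact C (fs ! i) (fs ! Suc i)) \<and>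
    epic C (fs ! n) \<and> Cod C (fs ! n) = X"

text \<open>There is a morphism of extensions which is the identity on \<open>Y\<close> and on \<open>X\<close>.\<close>

definition extension_map ::
  "('o, 'm) lincat \<Rightarrow> nat \<Rightarrow> 'o \<Rightarrow> 'o \<Rightarrow> 'm list \<Rightarrow> 'm list \<Rightarrow> bool" where
  "extension_map C n X Y fs gs \<longleftrightarrow> extension C n X Y fs \<and> extension C n X Y gs \<and>
    (\<exists>h :: nat \<Rightarrow> 'm. h 0 = Ide C Y \<and> h (Suc n) = Ide C X \<and>
      (\<forall>i\<le>n. h i \<in> Hom C (Dom C (fs ! i)) (Dom C (gs ! i)) \<and>
             h (Suc i) \<cdot>\<^bsub>C\<^esub> (fs ! i) = (gs ! i) \<cdot>\<^bsub>C\<^esub> h i))"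

text \<open>The Yoneda equivalence is the equivalence relation generated by morphisms of extensions.\<close>

definition extension_equiv ::
  "('o, 'm) lincat \<Rightarrow> nat \<Rightarrow> 'o \<Rightarrow> 'o \<Rightarrow> ('m list \<times> 'm list) set" where
  "extension_equiv C n X Y =
    {(fs, gs). extension C n X Y fs \<and> extension C n X Y gs \<and>
       (fs, gs) \<in> ({(fs, gs). extension_map C n X Y fs gs} \<union>
                   {(fs, gs). extension_map C n X Y gs fs})\<^sup>*}"

definition Yoneda_Ext :: "('o, 'm) lincat \<Rightarrow> nat \<Rightarrow> 'o \<Rightarrow> 'o \<Rightarrow> 'm list set set" where
  "Yoneda_Ext C n X Y = {fs. extension C n X Y fs} // extension_equiv C n X Y"

text \<open>Only the vanishing of Yoneda Ext groups is needed. As a group is zero iff its underlying set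
  is a singleton, this does not involve the Baer sum.\<close>

definition Ext_zero :: "('o, 'm) lincat \<Rightarrow> nat \<Rightarrow> 'o \<Rightarrow> 'o \<Rightarrow> bool" where
  "Ext_zero C n X Y \<longleftrightarrow> is_singleton (Yoneda_Ext C n X Y)"


section \<open>Cotorsion pairs and hereditary abelian model structures\<close>

definition right_perp :: "('o, 'm) lincat \<Rightarrow> 'o set \<Rightarrow> 'o set" where
  "right_perp C \<C> = {X \<in> Obj C. \<forall>A\<in>\<C>. Ext_zero C 1 A X}"

definition left_perp :: "('o, 'm) lincat \<Rightarrow> 'o set \<Rightarrow> 'o set" where
  "left_perp C \<C> = {X \<in> Obj C. \<forall>A\<in>\<C>. Ext_zero C 1 X A}"

definition cotorsion_pair :: "('o, 'm) lincat \<Rightarrow> 'o set \<Rightarrow> 'o set \<Rightarrow> bool" where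
  "cotorsion_pair C \<X> \<Y> \<longleftrightarrow> \<Y> = right_perp C \<X> \<and> \<X> = left_perp C \<Y>"

definition complete_pair :: "('o, 'm) lincat \<Rightarrow> 'o set \<Rightarrow> 'o set \<Rightarrow> bool" where
  "complete_pair C \<X> \<Y> \<longleftrightarrow> (\<forall>A\<in>Obj C.
    (\<exists>f g. short_exact C f g \<and> Dom C f \<in> \<Y> \<and> Cod C f \<in> \<X> \<and> Cod C g = A) \<and>
    (\<exists>f g. short_exact C f g \<and> Dom C f = A \<and> Cod C f \<in> \<Y> \<and> Cod C g \<in> \<X>))"

definition hereditary_pair :: "('o, 'm) lincat \<Rightarrow> 'o set \<Rightarrow> 'o set \<Rightarrow> bool" where
  "hereditary_pair C \<X> \<Y> \<longleftrightarrow> (\<forall>X\<in>\<X>. \<forall>Y\<in>\<Y>. \<forall>i\<ge>1. Ext_zero C i X Y)"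

definition thick :: "('o, 'm) lincat \<Rightarrow> 'o set \<Rightarrow> bool" where
  "thick C \<W> \<longleftrightarrow> \<W> \<subseteq> Obj C \<and> (\<forall>f g. short_exact C f g \<longrightarrow>
    (Dom C f \<in> \<W> \<and> Cod C f \<in> \<W> \<longrightarrow> Cod C g \<in> \<W>) \<and>
    (Dom C f \<in> \<W> \<and> Cod C g \<in> \<W> \<longrightarrow> Cod C f \<in> \<W>) \<and>
    (Cod C f \<in> \<W> \<and> Cod C g \<in> \<W> \<longrightarrow> Dom C f \<in> \<W>))"

definition hereditary_abelian_model ::
  "('o, 'm) lincat \<Rightarrow> 'o set \<Rightarrow> 'o set \<Rightarrow> 'o set \<Rightarrow> bool" where
  "hereditary_abelian_model C \<Q> \<W> \<R> \<longleftrightarrow> thick C \<W> \<and>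
    cotorsion_pair C \<Q> (\<W> \<inter> \<R>) \<and> complete_pair C \<Q> (\<W> \<inter> \<R>) \<and> hereditary_pair C \<Q> (\<W> \<inter> \<R>) \<and>
    cotorsion_pair C (\<Q> \<inter> \<W>) \<R> \<and> complete_pair C (\<Q> \<inter> \<W>) \<R> \<and> hereditary_pair C (\<Q> \<inter> \<W>) \<R>"

definition fibration :: "('o, 'm) lincat \<Rightarrow> 'o set \<Rightarrow> 'm \<Rightarrow> bool" where
  "fibration C \<R> g \<longleftrightarrow> epic C g \<and> (\<exists>k. is_kernel C k g \<and> Dom C k \<in> \<R>)"

definition cofibration :: "('o, 'm) lincat \<Rightarrow> 'o set \<Rightarrow> 'm \<Rightarrow> bool" where
  "cofibration C \<Q> f \<longleftrightarrow> monic C f \<and> (\<exists>c. is_cokernel C c f \<and> Cod C c \<in> \<Q>)"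


section \<open>Stable category\<close>

definition factors_through :: "('o, 'm) lincat \<Rightarrow> 'o set \<Rightarrow> 'm \<Rightarrow> bool" where
  "factors_through C \<Z> h \<longleftrightarrow>
    (\<exists>Z\<in>\<Z>. \<exists>u\<in>Hom C (Dom C h) Z. \<exists>v\<in>Hom C Z (Cod C h). h = v \<cdot>\<^bsub>C\<^esub> u)"

definition Sub :: "('o, 'm) lincat \<Rightarrow> 'm \<Rightarrow> 'm \<Rightarrow> 'm" where
  "Sub C g f = Add C g (inv\<^bsub>hom_group C (Dom C f) (Cod C f)\<^esub> f)"

text \<open>Left homotopy is the case \<open>\<Z> = \<W> \<inter> \<R>\<close>, and homotopy the case where \<open>\<Z>\<close> is
  the core \<open>\<Q> \<inter> \<W> \<inter> \<R>\<close>.\<close>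

definition homotopic :: "('o, 'm) lincat \<Rightarrow> 'o set \<Rightarrow> 'm \<Rightarrow> 'm \<Rightarrow> bool" where
  "homotopic C \<Z> f g \<longleftrightarrow> f \<in> Arr C \<and> g \<in> Arr C \<and> Dom C f = Dom C g \<and> Cod C f = Cod C g \<and>
    factors_through C \<Z> (Sub C g f)"

definition stable_class :: "('o, 'm) lincat \<Rightarrow> 'o set \<Rightarrow> 'm \<Rightarrow> 'm set" where
  "stable_class C \<Z> f = {g. homotopic C \<Z> f g}"

text \<open>The canonical functor to \<open>stable_category C \<Z>\<close> is the identity on objects and
  \<open>stable_class C \<Z>\<close> on morphisms; operations are computed on representatives.\<close>

definition stable_category :: "('o, 'm) lincat \<Rightarrow> 'o set \<Rightarrow> ('o, 'm set) lincat" where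
  "stable_category C \<Z> = \<lparr>
     Obj = Obj C,
     Arr = stable_class C \<Z> ` Arr C,
     Dom = (\<lambda>S. Dom C (SOME f. f \<in> S)),
     Cod = (\<lambda>S. Cod C (SOME f. f \<in> S)),
     Ide = (\<lambda>A. stable_class C \<Z> (Ide C A)),
     Cmp = (\<lambda>T S. stable_class C \<Z> ((SOME g. g \<in> T) \<cdot>\<^bsub>C\<^esub> (SOME f. f \<in> S))),
     Add = (\<lambda>S T. stable_class C \<Z> (Add C (SOME f. f \<in> S) (SOME g. g \<in> T))),
     Zer = (\<lambda>A B. stable_class C \<Z> (Zer C A B)) \<rparr>"


section \<open>Additive functors to abelian groups\<close>

definition cov_functor ::
  "('o, 'm) lincat \<Rightarrow> ('o \<Rightarrow> 'g monoid) \<Rightarrow> ('m \<Rightarrow> 'g \<Rightarrow> 'g) \<Rightarrow> bool" where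
  "cov_functor C F \<Phi> \<longleftrightarrow>
    (\<forall>A\<in>Obj C. comm_group (F A) \<and> (\<forall>x\<in>carrier (F A). \<Phi> (Ide C A) x = x)) \<and>
    (\<forall>A\<in>Obj C. \<forall>B\<in>Obj C. \<forall>f\<in>Hom C A B. \<Phi> f \<in> hom (F A) (F B)) \<and>
    (\<forall>A\<in>Obj C. \<forall>B\<in>Obj C. \<forall>D\<in>Obj C. \<forall>f\<in>Hom C A B. \<forall>g\<in>Hom C B D. \<forall>x\<in>carrier (F A).
       \<Phi> (g \<cdot>\<^bsub>C\<^esub> f) x = \<Phi> g (\<Phi> f x)) \<and>
    (\<forall>A\<in>Obj C. \<forall>B\<in>Obj C. \<forall>f\<in>Hom C A B. \<forall>g\<in>Hom C A B. \<forall>x\<in>carrier (F A).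
       \<Phi> (Add C f g) x = \<Phi> f x \<otimes>\<^bsub>F B\<^esub> \<Phi> g x)"

definition con_functor ::
  "('o, 'm) lincat \<Rightarrow> ('o \<Rightarrow> 'g monoid) \<Rightarrow> ('m \<Rightarrow> 'g \<Rightarrow> 'g) \<Rightarrow> bool" where
  "con_functor C F \<Phi> \<longleftrightarrow>
    (\<forall>A\<in>Obj C. comm_group (F A) \<and> (\<forall>x\<in>carrier (F A). \<Phi> (Ide C A) x = x)) \<and>
    (\<forall>A\<in>Obj C. \<forall>B\<in>Obj C. \<forall>f\<in>Hom C A B. \<Phi> f \<in> hom (F B) (F A)) \<and>
    (\<forall>A\<in>Obj C. \<forall>B\<in>Obj C. \<forall>D\<in>Obj C. \<forall>f\<in>Hom C A B. \<forall>g\<in>Hom C B D. \<forall>x\<in>carrier (F D).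
       \<Phi> (g \<cdot>\<^bsub>C\<^esub> f) x = \<Phi> f (\<Phi> g x)) \<and>
    (\<forall>A\<in>Obj C. \<forall>B\<in>Obj C. \<forall>f\<in>Hom C A B. \<forall>g\<in>Hom C A B. \<forall>x\<in>carrier (F B).
       \<Phi> (Add C f g) x = \<Phi> f x \<otimes>\<^bsub>F A\<^esub> \<Phi> g x)"

definition cov_factors_stable ::
  "('o, 'm) lincat \<Rightarrow> 'o set \<Rightarrow> ('o \<Rightarrow> 'g monoid) \<Rightarrow> ('m \<Rightarrow> 'g \<Rightarrow> 'g) \<Rightarrow> bool" where
  "cov_factors_stable C \<Z> F \<Phi> \<longleftrightarrow>
    (\<exists>\<Psi>. cov_functor (stable_category C \<Z>) F \<Psi> \<and>
       (\<forall>f\<in>Arr C. \<forall>x\<in>carrier (F (Dom C f)). \<Psi> (stable_class C \<Z> f) x = \<Phi> f x))"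

definition con_factors_stable ::
  "('o, 'm) lincat \<Rightarrow> 'o set \<Rightarrow> ('o \<Rightarrow> 'g monoid) \<Rightarrow> ('m \<Rightarrow> 'g \<Rightarrow> 'g) \<Rightarrow> bool" where
  "con_factors_stable C \<Z> F \<Phi> \<longleftrightarrow>
    (\<exists>\<Psi>. con_functor (stable_category C \<Z>) F \<Psi> \<and>
       (\<forall>f\<in>Arr C. \<forall>x\<in>carrier (F (Cod C f)). \<Psi> (stable_class C \<Z> f) x = \<Phi> f x))"


section \<open>Cohomology of cochain complexes of abelian groups\<close>

record 'g cochain =
  grp :: "int \<Rightarrow> 'g monoid"
  cobd :: "int \<Rightarrow> 'g \<Rightarrow> 'g"  \<comment> \<open>from degree \<open>n\<close> to degree \<open>n + 1\<close>\<close>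

definition cocycles :: "'g cochain \<Rightarrow> int \<Rightarrow> 'g monoid" where
  "cocycles K n = (grp K n)\<lparr>carrier := kernel (grp K n) (grp K (n + 1)) (cobd K n)\<rparr>"

definition coboundaries :: "'g cochain \<Rightarrow> int \<Rightarrow> 'g set" where
  "coboundaries K n = cobd K (n - 1) ` carrier (grp K (n - 1))"

definition cohomology :: "'g cochain \<Rightarrow> int \<Rightarrow> 'g set monoid" where
  "cohomology K n = cocycles K n Mod coboundaries K n"

definition cohomology_class :: "'g cochain \<Rightarrow> int \<Rightarrow> 'g \<Rightarrow> 'g set" where
  "cohomology_class K n c = coboundaries K n #>\<^bsub>cocycles K n\<^esub> c"

text \<open>The map \<open>[c] \<mapsto> [\<theta> c]\<close> from \<open>H\<^sup>n(K)\<close> to \<open>H\<^sup>n(L)\<close>, where \<open>\<theta>\<close> is the degree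
  \<open>n\<close> component of a cochain map \<open>K \<rightarrow> L\<close>; all members of the union are equal.\<close>

definition cohomology_map :: "'g cochain \<Rightarrow> int \<Rightarrow> ('g \<Rightarrow> 'g) \<Rightarrow> 'g set \<Rightarrow> 'g set" where
  "cohomology_map L n \<theta> S = (\<Union>c\<in>S. cohomology_class L n (\<theta> c))"

definition long_exact ::
  "(int \<Rightarrow> 'g monoid) \<Rightarrow> (int \<Rightarrow> 'g monoid) \<Rightarrow> (int \<Rightarrow> 'g monoid) \<Rightarrow>
   (int \<Rightarrow> 'g \<Rightarrow> 'g) \<Rightarrow> (int \<Rightarrow> 'g \<Rightarrow> 'g) \<Rightarrow> (int \<Rightarrow> 'g \<Rightarrow> 'g) \<Rightarrow> bool" where
  "long_exact X Y Z i p \<delta> \<longleftrightarrow> (\<forall>n.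
    i n \<in> hom (X n) (Y n) \<and> p n \<in> hom (Y n) (Z n) \<and> \<delta> n \<in> hom (Z n) (X (n + 1)) \<and>
    i n ` carrier (X n) = kernel (Y n) (Z n) (p n) \<and>
    p n ` carrier (Y n) = kernel (Z n) (X (n + 1)) (\<delta> n) \<and>
    \<delta> n ` carrier (Z n) = kernel (X (n + 1)) (Y (n + 1)) (i (n + 1)))"

text \<open>\<open>\<delta>\<close> is the connecting map of a short exact sequence \<open>K \<rightarrow> L \<rightarrow> M\<close> of cochain complexes
  with maps \<open>i\<close> and \<open>p\<close>, by the usual diagram chase.\<close>

definition connecting ::
  "'g cochain \<Rightarrow> 'g cochain \<Rightarrow> 'g cochain \<Rightarrow>
   (int \<Rightarrow> 'g \<Rightarrow> 'g) \<Rightarrow> (int \<Rightarrow> 'g \<Rightarrow> 'g) \<Rightarrow> (int \<Rightarrow> 'g set \<Rightarrow> 'g set) \<Rightarrow> bool" where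
  "connecting K L M i p \<delta> \<longleftrightarrow> (\<forall>n. \<forall>c\<in>carrier (cocycles M n).
    \<exists>b\<in>carrier (grp L n). \<exists>a\<in>carrier (cocycles K (n + 1)).
      p n b = c \<and> cobd L n b = i (n + 1) a \<and>
      \<delta> n (cohomology_class M n c) = cohomology_class K (n + 1) a)"


section \<open>Resolutions and \<open>\<ell>Ext\<close>\<close>

text \<open>Indexing is by homological degree: \<open>dif X i\<close> goes from \<open>ob X i\<close> to \<open>ob X (i - 1)\<close>.
  \<open>aug\<close> is \<open>\<epsilon>\<^sub>A\<close> and \<open>coaug\<close> is \<open>\<eta>\<^sub>A\<close>.\<close>

record ('o, 'm) resolution =
  ob :: "int \<Rightarrow> 'o"
  dif :: "int \<Rightarrow> 'm"
  aug :: "'m"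
  coaug :: "'m"

text \<open>Exactness of \<open>\<cdots> \<rightarrow> Q\<^sub>1 \<rightarrow> Q\<^sub>0 \<rightarrow> A \<rightarrow> 0\<close> away from \<open>Q\<^sub>0\<close> and \<open>A\<close>, and of
  \<open>0 \<rightarrow> A \<rightarrow> R\<^sub>-\<^sub>1 \<rightarrow> R\<^sub>-\<^sub>2 \<rightarrow> \<cdots>\<close> away from \<open>A\<close> and \<open>R\<^sub>-\<^sub>1\<close>, is part
  of the exactness of the whole complex.\<close>

definition M_resolution ::
  "('o, 'm) lincat \<Rightarrow> 'o set \<Rightarrow> 'o set \<Rightarrow> 'o set \<Rightarrow> 'o \<Rightarrow> ('o, 'm) resolution \<Rightarrow> bool" where
  "M_resolution C \<Q> \<W> \<R> A X \<longleftrightarrow>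
    (\<forall>i. dif X i \<in> Hom C (ob X i) (ob X (i - 1))) \<and>
    (\<forall>i. exact C (dif X (i + 1)) (dif X i)) \<and>
    aug X \<in> Hom C (ob X 0) A \<and> coaug X \<in> Hom C A (ob X (-1)) \<and>
    dif X 0 = coaug X \<cdot>\<^bsub>C\<^esub> aug X \<and>
    exact C (dif X 1) (aug X) \<and> epic C (aug X) \<and>
    (\<forall>i\<ge>0. ob X i \<in> \<Q> \<inter> \<W>) \<and>
    (\<exists>k. is_kernel C k (aug X) \<and> Dom C k \<in> \<R>) \<and>
    (\<forall>i\<ge>1. \<exists>k. is_kernel C k (dif X i) \<and> Dom C k \<in> \<R>) \<and>
    monic C (coaug X) \<and> exact C (coaug X) (dif X (-1)) \<and>
    (\<forall>i\<le>-1. ob X i \<in> \<W> \<inter> \<R>) \<and>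
    (\<exists>c. is_cokernel C c (coaug X) \<and> Cod C c \<in> \<Q>) \<and>
    (\<forall>i\<le>-1. \<exists>c. is_cokernel C c (dif X i) \<and> Cod C c \<in> \<Q>)"

definition chain_lift ::
  "('o, 'm) lincat \<Rightarrow> ('o, 'm) resolution \<Rightarrow> ('o, 'm) resolution \<Rightarrow> 'm \<Rightarrow> (int \<Rightarrow> 'm) \<Rightarrow> bool" where
  "chain_lift C X Y f \<phi> \<longleftrightarrow>
    (\<forall>i. \<phi> i \<in> Hom C (ob X i) (ob Y i)) \<and>
    (\<forall>i. dif Y i \<cdot>\<^bsub>C\<^esub> \<phi> i = \<phi> (i - 1) \<cdot>\<^bsub>C\<^esub> dif X i) \<and>
    aug Y \<cdot>\<^bsub>C\<^esub> \<phi> 0 = f \<cdot>\<^bsub>C\<^esub> aug X \<and>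
    \<phi> (-1) \<cdot>\<^bsub>C\<^esub> coaug X = coaug Y \<cdot>\<^bsub>C\<^esub> f"

definition hom_complex :: "('o, 'm) lincat \<Rightarrow> ('o, 'm) resolution \<Rightarrow> 'o \<Rightarrow> 'm cochain" where
  "hom_complex C X B =
    \<lparr>grp = (\<lambda>n. hom_group C (ob X n) B), cobd = (\<lambda>n c. c \<cdot>\<^bsub>C\<^esub> dif X (n + 1))\<rparr>"

text \<open>\<open>Res\<close> is a choice of a resolution of every object.\<close>

definition resolution_choice ::
  "('o, 'm) lincat \<Rightarrow> 'o set \<Rightarrow> 'o set \<Rightarrow> 'o set \<Rightarrow> ('o \<Rightarrow> ('o, 'm) resolution) \<Rightarrow> bool" where
  "resolution_choice C \<Q> \<W> \<R> Res \<longleftrightarrow> (\<forall>A\<in>Obj C. M_resolution C \<Q> \<W> \<R> A (Res A))"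

definition lExt ::
  "('o, 'm) lincat \<Rightarrow> ('o \<Rightarrow> ('o, 'm) resolution) \<Rightarrow> int \<Rightarrow> 'o \<Rightarrow> 'o \<Rightarrow> 'm set monoid" where
  "lExt C Res n A B = cohomology (hom_complex C (Res A) B) n"

text \<open>The action of \<open>g : B \<rightarrow> B'\<close> from \<open>lExt C Res n A B\<close> to \<open>lExt C Res n A B'\<close>.\<close>

definition lExt_cov ::
  "('o, 'm) lincat \<Rightarrow> ('o \<Rightarrow> ('o, 'm) resolution) \<Rightarrow> int \<Rightarrow> 'o \<Rightarrow> 'm \<Rightarrow> 'm set \<Rightarrow> 'm set" where
  "lExt_cov C Res n A g =
    cohomology_map (hom_complex C (Res A) (Cod C g)) n (\<lambda>c. g \<cdot>\<^bsub>C\<^esub> c)"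

text \<open>The action of \<open>f : A \<rightarrow> A'\<close> from \<open>lExt C Res n A' B\<close> to \<open>lExt C Res n A B\<close>;
  the lift is unique up to homotopy, so that the choice does not matter.\<close>

definition lExt_con ::
  "('o, 'm) lincat \<Rightarrow> ('o \<Rightarrow> ('o, 'm) resolution) \<Rightarrow> int \<Rightarrow> 'm \<Rightarrow> 'o \<Rightarrow> 'm set \<Rightarrow> 'm set" where
  "lExt_con C Res n f B =
    cohomology_map (hom_complex C (Res (Dom C f)) B) n
      (\<lambda>c. c \<cdot>\<^bsub>C\<^esub> (SOME \<phi>. chain_lift C (Res (Dom C f)) (Res (Cod C f)) f \<phi>) n)"

end

theory Submission
  imports Defs
begin

text \<open>
  Everything rests on one consequence of the vanishing of \<open>Ext\<^sup>2(X, Y)\<close> that makes no use of the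
  group structure of Ext: a two-fold extension \<open>0 \<rightarrow> Y \<rightarrow> E\<^sub>2 \<rightarrow> E\<^sub>1 \<rightarrow> X \<rightarrow> 0\<close>, with \<open>K\<close> the image of
  its middle map, comes from a filtered object \<open>M\<close> with \<open>E\<^sub>2 \<rightarrow> M \<rightarrow> E\<^sub>1\<close>, where \<open>M / E\<^sub>2 = X\<close> and
  \<open>M / Y = E\<^sub>1\<close>. This property is invariant under morphisms of extensions, in both directions (pull
  \<open>M\<close> back, or push it out), and the trivial extension has it. It yields both closure of the left
  class of a hereditary cotorsion pair under kernels of epimorphisms and a horseshoe lemma in which
  the lift of \<open>Q'' \<rightarrow> A''\<close> to the middle object need not exist.

  An \<open>\<MM>\<close>-resolution is a projective-type half glued to an injective-type half, and the second is
  the first in the opposite category, so lifting, homotopy and horseshoe arguments are made once.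
  If \<open>A\<close> is cofibrant, then all cokernels of differentials of \<open>W\<^sub>A\<close> are cofibrant, hence all terms
  are trivially cofibrant; so \<open>Hom(W\<^sub>A, -)\<close> is exact on fibrations and \<open>Hom(W\<^sub>A, Z)\<close> is acyclic for
  trivially fibrant \<open>Z\<close>. If \<open>A\<close> is in the core, then \<open>W\<^sub>A\<close> is contractible.
\<close>


section \<open>Preadditive categories and duality\<close>

text \<open>The Ext groups enter only through vanishing, and vanishing only says that the set of
  Yoneda classes is a singleton: no Baer sum and no long exact sequence of Ext is at hand, so each
  dimension shift is replaced by a construction with objects. The case that shapes the proof is the
  horseshoe for A -> A1 -> A2. Let q: Q -> A have kernel K in the right class, and let q2: Q2 -> A2
  start in the left class. The pullback of A1 along q2 is an extension of Q2 by A whose class in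
  Ext^1(Q2, A) need not vanish, as A is arbitrary. Its image in Ext^2(Q2, K) does vanish, so the
  class comes from Ext^1(Q2, Q), and an extension representing a preimage is the middle term. The
  filtered object of the overview is this extension, obtained without the exact sequence.
  Resolutions are arbitrary choices, object by object. The one that the horseshoe builds for the
  middle object need not be the chosen one, so the long exact sequence of a cofibration has to be
  transported along a comparison of the two.\<close>

context preadditive_category
begin

abbreviation plus_arr (infixl "\<oplus>" 65) where "f \<oplus> g \<equiv> Add C f g"
abbreviation minus_arr (infixl "\<ominus>" 65) where "f \<ominus> g \<equiv> Sub C f g"

text \<open>Typing conditions are reduced to equations on \<open>Dom\<close> and \<open>Cod\<close>,
  which simplification can discharge. The axioms phrased with \<open>Hom\<close> leave the
  intermediate objects to be guessed; hence the restatements below.\<close>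

lemma Hom_iff [simp]: "f \<in> Hom C A B \<longleftrightarrow> f \<in> Arr C \<and> Dom C f = A \<and> Cod C f = B"
  by (auto simp: Hom_def)

lemma Hom_Obj: "f \<in> Hom C A B \<Longrightarrow> A \<in> Obj C \<and> B \<in> Obj C"
  using Dom_Obj Cod_Obj by auto

declare Dom_Obj [simp] Cod_Obj [simp]

lemma Cmp_simps [simp]:
  assumes "f \<in> Arr C" "g \<in> Arr C" "Cod C f = Dom C g"
  shows "g \<cdot> f \<in> Arr C" "Dom C (g \<cdot> f) = Dom C f" "Cod C (g \<cdot> f) = Cod C g"
  using Cmp_Hom[of f "Dom C f" "Cod C f" g "Cod C g"] assms by auto

lemma Ide_simps [simp]:
  assumes "A \<in> Obj C"
  shows "Ide C A \<in> Arr C" "Dom C (Ide C A) = A" "Cod C (Ide C A) = A"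
  using Ide_Hom[OF assms] by auto

lemma Cmp_assoc' [simp]:
  assumes "f \<in> Arr C" "g \<in> Arr C" "h \<in> Arr C" "Cod C f = Dom C g" "Cod C g = Dom C h"
  shows "(h \<cdot> g) \<cdot> f = h \<cdot> (g \<cdot> f)"
  using Cmp_assoc[of f "Dom C f" "Cod C f" g "Cod C g" h "Cod C h"] assms by auto

lemma Cmp_Ide' [simp]: "f \<in> Arr C \<Longrightarrow> Dom C f = A \<Longrightarrow> f \<cdot> Ide C A = f"
  using Cmp_Ide[of f A "Cod C f"] by auto

lemma Ide_Cmp' [simp]: "f \<in> Arr C \<Longrightarrow> Cod C f = A \<Longrightarrow> Ide C A \<cdot> f = f"
  using Ide_Cmp[of f "Dom C f" A] by auto

lemma hom_group_simps [simp]: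
  "carrier (hom_group C A B) = Hom C A B" "mult (hom_group C A B) = Add C"
  "one (hom_group C A B) = Zer C A B"
  by (simp_all add: hom_group_def)

lemma Zer_simps [simp]:
  assumes "A \<in> Obj C" "B \<in> Obj C"
  shows "Zer C A B \<in> Arr C" "Dom C (Zer C A B) = A" "Cod C (Zer C A B) = B"
  using monoid.one_closed[OF comm_group.axioms(1)[THEN comm_monoid.axioms(1), OF hom_comm_group[OF assms]]]
  by simp_all

lemma Add_simps [simp]:
  assumes "f \<in> Arr C" "g \<in> Arr C" "Dom C f = Dom C g" "Cod C f = Cod C g"
  shows "f \<oplus> g \<in> Arr C" "Dom C (f \<oplus> g) = Dom C g" "Cod C (f \<oplus> g) = Cod C g"
proof -
  interpret H: comm_group "hom_group C (Dom C g) (Cod C g)" using assms by (simp add: hom_comm_group)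
  show "f \<oplus> g \<in> Arr C" "Dom C (f \<oplus> g) = Dom C g" "Cod C (f \<oplus> g) = Cod C g"
    using H.m_closed[of f g] assms by auto
qed

lemma Add_commute:
  assumes "f \<in> Arr C" "g \<in> Arr C" "Dom C f = Dom C g" "Cod C f = Cod C g"
  shows "f \<oplus> g = g \<oplus> f"
proof -
  interpret H: comm_group "hom_group C (Dom C g) (Cod C g)" using assms by (simp add: hom_comm_group)
  show ?thesis using H.m_comm[of f g] assms by auto
qed

lemma Add_Zer [simp]:
  assumes "f \<in> Arr C" "Dom C f = A" "Cod C f = B"
  shows "f \<oplus> Zer C A B = f" "Zer C A B \<oplus> f = f"
proof -
  interpret H: comm_group "hom_group C A B" using assms by (auto simp: hom_comm_group)
  show "f \<oplus> Zer C A B = f" "Zer C A B \<oplus> f = f" using H.r_one[of f] H.l_one[of f] assms by auto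
qed

lemma Sub_simps [simp]:
  assumes "f \<in> Arr C" "g \<in> Arr C" "Dom C f = Dom C g" "Cod C f = Cod C g"
  shows "f \<ominus> g \<in> Arr C" "Dom C (f \<ominus> g) = Dom C g" "Cod C (f \<ominus> g) = Cod C g"
proof -
  interpret H: comm_group "hom_group C (Dom C g) (Cod C g)" using assms by (simp add: hom_comm_group)
  have "f \<ominus> g \<in> Hom C (Dom C g) (Cod C g)"
    using H.m_closed[of f "inv\<^bsub>hom_group C (Dom C g) (Cod C g)\<^esub> g"] H.inv_closed[of g] assms
    by (auto simp: Sub_def)
  then show "f \<ominus> g \<in> Arr C" "Dom C (f \<ominus> g) = Dom C g" "Cod C (f \<ominus> g) = Cod C g" by auto
qed

lemma Sub_Add [simp]:
  assumes "f \<in> Arr C" "g \<in> Arr C" "Dom C f = Dom C g" "Cod C f = Cod C g"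
  shows "(f \<ominus> g) \<oplus> g = f" "(f \<oplus> g) \<ominus> g = f"
proof -
  interpret H: comm_group "hom_group C (Dom C g) (Cod C g)" using assms by (simp add: hom_comm_group)
  have H: "f \<in> carrier (hom_group C (Dom C g) (Cod C g))" "g \<in> carrier (hom_group C (Dom C g) (Cod C g))"
    using assms by simp_all
  have "f \<otimes>\<^bsub>hom_group C (Dom C g) (Cod C g)\<^esub> inv\<^bsub>hom_group C (Dom C g) (Cod C g)\<^esub> g
      \<otimes>\<^bsub>hom_group C (Dom C g) (Cod C g)\<^esub> g = f"
    "f \<otimes>\<^bsub>hom_group C (Dom C g) (Cod C g)\<^esub> g
      \<otimes>\<^bsub>hom_group C (Dom C g) (Cod C g)\<^esub> inv\<^bsub>hom_group C (Dom C g) (Cod C g)\<^esub> g = f"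
    using H by (simp_all only: H.m_assoc H.inv_closed H.l_inv H.r_inv H.r_one)
  then show "(f \<ominus> g) \<oplus> g = f" "(f \<oplus> g) \<ominus> g = f" by (simp_all add: Sub_def)
qed

lemma Add_right_cancel:
  assumes "f \<in> Arr C" "g \<in> Arr C" "h \<in> Arr C" "Dom C f = Dom C h" "Cod C f = Cod C h"
    "Dom C g = Dom C h" "Cod C g = Cod C h" "f \<oplus> h = g \<oplus> h"
  shows "f = g"
proof -
  have "(f \<oplus> h) \<ominus> h = f" "(g \<oplus> h) \<ominus> h = g" using assms(1-7) by simp_all
  then show ?thesis using assms(8) by metis
qed

lemma Sub_eqI:
  assumes "f \<in> Arr C" "g \<in> Arr C" "h \<in> Arr C" "Dom C f = Dom C g" "Cod C f = Cod C g"
    "Dom C h = Dom C g" "Cod C h = Cod C g" "f = h \<oplus> g"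
  shows "f \<ominus> g = h"
  using assms Sub_Add(2)[of h g] by simp

lemma Sub_self [simp]: "f \<in> Arr C \<Longrightarrow> f \<ominus> f = Zer C (Dom C f) (Cod C f)"
  by (rule Sub_eqI) auto

lemma Sub_eq_Zer_iff:
  assumes "f \<in> Arr C" "g \<in> Arr C" "Dom C f = Dom C g" "Cod C f = Cod C g"
  shows "f \<ominus> g = Zer C (Dom C g) (Cod C g) \<longleftrightarrow> f = g"
proof
  assume "f \<ominus> g = Zer C (Dom C g) (Cod C g)"
  then have "f = Zer C (Dom C g) (Cod C g) \<oplus> g" using Sub_Add(1)[OF assms] by metis
  then show "f = g" using assms by simp
qed (use assms in simp)

lemma Cmp_Add' [simp]:
  assumes "f \<in> Arr C" "f' \<in> Arr C" "g \<in> Arr C" "Dom C f = Dom C f'" "Cod C f = Cod C f'" "Dom C g = Cod C f'"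
  shows "g \<cdot> (f \<oplus> f') = g \<cdot> f \<oplus> g \<cdot> f'"
  using Cmp_Add[of f "Dom C f" "Cod C f" f' g "Cod C g"] assms by auto

lemma Add_Cmp' [simp]:
  assumes "g \<in> Arr C" "g' \<in> Arr C" "f \<in> Arr C" "Dom C g = Dom C g'" "Cod C g = Cod C g'" "Dom C g' = Cod C f"
  shows "(g \<oplus> g') \<cdot> f = g \<cdot> f \<oplus> g' \<cdot> f"
  using Add_Cmp[of f "Dom C f" "Cod C f" g "Cod C g" g'] assms by auto

lemma Cmp_Sub [simp]:
  assumes "f \<in> Arr C" "f' \<in> Arr C" "g \<in> Arr C" "Dom C f = Dom C f'" "Cod C f = Cod C f'" "Dom C g = Cod C f'"
  shows "g \<cdot> (f \<ominus> f') = g \<cdot> f \<ominus> g \<cdot> f'"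
  using assms Cmp_Add'[of "f \<ominus> f'" f' g] by (intro Sub_eqI[symmetric]) (simp_all del: Cmp_Add')

lemma Sub_Cmp [simp]:
  assumes "g \<in> Arr C" "g' \<in> Arr C" "f \<in> Arr C" "Dom C g = Dom C g'" "Cod C g = Cod C g'" "Dom C g' = Cod C f"
  shows "(g \<ominus> g') \<cdot> f = g \<cdot> f \<ominus> g' \<cdot> f"
  using assms Add_Cmp'[of "g \<ominus> g'" g' f] by (intro Sub_eqI[symmetric]) (simp_all del: Add_Cmp')

text \<open>Preservation of zero is derived: a zero morphism is a difference of a morphism with
  itself, and composition distributes over differences.\<close>

lemma Cmp_Zer [simp]:
  assumes "g \<in> Arr C" "Dom C g = B" "A \<in> Obj C"
  shows "g \<cdot> Zer C A B = Zer C A (Cod C g)"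
  using Cmp_Sub[of "Zer C A B" "Zer C A B" g] assms by auto

lemma Zer_Cmp [simp]:
  assumes "f \<in> Arr C" "Cod C f = A" "B \<in> Obj C"
  shows "Zer C A B \<cdot> f = Zer C (Dom C f) B"
  using Sub_Cmp[of "Zer C A B" "Zer C A B" f] assms by auto

text \<open>Composites are normalized to right-nested form by \<open>Cmp_assoc'\<close>, and there
  the left-hand side \<open>g \<cdot> f\<close> of an equation no longer occurs inside
  \<open>g \<cdot> (f \<cdot> x)\<close>. This is the equation after precomposition with
  \<open>x\<close>, ready for normalized terms.\<close>

lemma Cmp_rewr:
  assumes "g \<cdot> f = h" "f \<in> Arr C" "g \<in> Arr C" "Cod C f = Dom C g" "x \<in> Arr C" "Cod C x = Dom C f"
  shows "g \<cdot> (f \<cdot> x) = h \<cdot> x"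
  using assms Cmp_assoc'[of x f g] by (simp del: Cmp_assoc')

end

section \<open>The opposite category\<close>

definition opposite :: "('o, 'm) lincat \<Rightarrow> ('o, 'm) lincat" where
  "opposite C = \<lparr>Obj = Obj C, Arr = Arr C, Dom = Cod C, Cod = Dom C, Ide = Ide C,
     Cmp = (\<lambda>g f. Cmp C f g), Add = Add C, Zer = (\<lambda>A B. Zer C B A)\<rparr>"

lemma opposite_simps [simp]:
  "Obj (opposite C) = Obj C" "Arr (opposite C) = Arr C" "Dom (opposite C) = Cod C"
  "Cod (opposite C) = Dom C" "Ide (opposite C) = Ide C" "Cmp (opposite C) g f = Cmp C f g"
  "Add (opposite C) = Add C" "Zer (opposite C) A B = Zer C B A"
  by (simp_all add: opposite_def)

lemma Hom_opposite [simp]: "Hom (opposite C) A B = Hom C B A"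
  by (auto simp: Hom_def)

text \<open>Morphisms are kept and only \<open>Dom\<close> and \<open>Cod\<close> are exchanged, so
  double dualization is an equality, not merely an isomorphism. Each duality rule proved as an
  implication therefore upgrades to an equality by applying it twice.\<close>

lemma opposite_opposite [simp]: "opposite (opposite C) = C"
  by (simp add: opposite_def)

lemma hom_group_opposite [simp]: "hom_group (opposite C) A B = hom_group C B A"
  by (simp add: hom_group_def)

lemma Sub_opposite [simp]: "Sub (opposite C) f g = Sub C f g"
  by (simp add: Sub_def)

lemma monic_opposite [simp]: "monic (opposite C) f = epic C f"
  by (simp add: monic_def epic_def)

lemma epic_opposite [simp]: "epic (opposite C) f = monic C f"
  by (simp add: monic_def epic_def)

lemma is_kernel_opposite [simp]: "is_kernel (opposite C) k f = is_cokernel C k f"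
  by (simp add: is_kernel_def is_cokernel_def)

lemma is_cokernel_opposite [simp]: "is_cokernel (opposite C) k f = is_kernel C k f"
  by (simp add: is_kernel_def is_cokernel_def)

lemma zero_object_opposite [simp]: "zero_object (opposite C) Z = zero_object C Z"
  by (auto simp: zero_object_def)

lemma biproduct_opposite [simp]: "biproduct (opposite C) A B P p q i j = biproduct C A B P i j p q"
  by (auto simp: biproduct_def)

lemma (in preadditive_category) preadditive_opposite: "preadditive_category (opposite C)"
  by (rule preadditive_category.intro) (auto simp: hom_comm_group)

context abelian_category
begin

text \<open>The axioms come in dual pairs. Every dual statement below is obtained by instantiating
  the locale at \<open>opposite C\<close> through this lemma and simplifying.\<close>

lemma abelian_opposite: "abelian_category (opposite C)"
proof -
  interpret O: preadditive_category "opposite C" by (rule preadditive_opposite)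
  show ?thesis
  proof
    show "\<exists>Z. zero_object (opposite C) Z" using ex_zero_object by simp
    show "\<exists>P i j p q. biproduct (opposite C) A B P i j p q"
      if "A \<in> Obj (opposite C)" "B \<in> Obj (opposite C)" for A B
      using ex_biproduct[of A B] that biproduct_opposite by (metis opposite_simps(1))
  qed (use ex_kernel ex_cokernel monic_normal epic_normal in auto)
qed

section \<open>Monomorphisms, kernels and exactness, tested by vanishing\<close>

lemma monicD:
  assumes "monic C f" "u \<in> Arr C" "Cod C u = Dom C f" "f \<cdot> u = Zer C (Dom C u) (Cod C f)"
  shows "u = Zer C (Dom C u) (Dom C f)"
  using assms unfolding monic_def
  by (metis Hom_iff Dom_Obj Cmp_Zer Zer_simps)

text \<open>Subtraction turns cancellation of a pair into vanishing of one morphism.\<close>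

lemma monicI:
  assumes "f \<in> Arr C"
    and "\<And>u. u \<in> Arr C \<Longrightarrow> Cod C u = Dom C f \<Longrightarrow> f \<cdot> u = Zer C (Dom C u) (Cod C f) \<Longrightarrow> u = Zer C (Dom C u) (Dom C f)"
  shows "monic C f"
  unfolding monic_def
proof (intro conjI ballI impI)
  fix A u v assume *: "A \<in> Obj C" "u \<in> Hom C A (Dom C f)" "v \<in> Hom C A (Dom C f)" "f \<cdot> u = f \<cdot> v"
  then have "u \<ominus> v = Zer C (Dom C (u \<ominus> v)) (Dom C f)" using assms(1) by (intro assms(2)) auto
  with * show "u = v" using Sub_eq_Zer_iff[of u v] by auto
qed (fact assms(1))

lemma epicD:
  assumes "epic C f" "u \<in> Arr C" "Dom C u = Cod C f" "u \<cdot> f = Zer C (Dom C f) (Cod C u)"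
  shows "u = Zer C (Cod C f) (Cod C u)"
  using abelian_category.monicD[OF abelian_opposite, of f u] assms by simp

lemma epicI:
  assumes "f \<in> Arr C"
    and "\<And>u. u \<in> Arr C \<Longrightarrow> Dom C u = Cod C f \<Longrightarrow> u \<cdot> f = Zer C (Dom C f) (Cod C u) \<Longrightarrow> u = Zer C (Cod C f) (Cod C u)"
  shows "epic C f"
  using abelian_category.monicI[OF abelian_opposite, of f] assms by simp

lemma monic_cancel:
  assumes "monic C f" "u \<in> Arr C" "v \<in> Arr C" "Cod C u = Dom C f" "Cod C v = Dom C f" "Dom C u = Dom C v" "f \<cdot> u = f \<cdot> v"
  shows "u = v"
  using assms unfolding monic_def by (metis Hom_iff Dom_Obj)

lemma epic_cancel:
  assumes "epic C f" "u \<in> Arr C" "v \<in> Arr C" "Dom C u = Cod C f" "Dom C v = Cod C f" "Cod C u = Cod C v" "u \<cdot> f = v \<cdot> f"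
  shows "u = v"
  using assms unfolding epic_def by (metis Hom_iff Cod_Obj)

lemma monic_Arr [simp]: "monic C f \<Longrightarrow> f \<in> Arr C" by (simp add: monic_def)
lemma epic_Arr [simp]: "epic C f \<Longrightarrow> f \<in> Arr C" by (simp add: epic_def)

lemma monic_Cmp: "monic C f \<Longrightarrow> monic C g \<Longrightarrow> Cod C f = Dom C g \<Longrightarrow> monic C (g \<cdot> f)"
proof (rule monicI)
  fix u assume *: "monic C f" "monic C g" "Cod C f = Dom C g"
    "u \<in> Arr C" "Cod C u = Dom C (g \<cdot> f)" "(g \<cdot> f) \<cdot> u = Zer C (Dom C u) (Cod C (g \<cdot> f))"
  then have "f \<cdot> u = Zer C (Dom C u) (Cod C f)" using monicD[of g "f \<cdot> u"] by simp
  then show "u = Zer C (Dom C u) (Dom C (g \<cdot> f))" using * monicD[of f u] by simp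
qed simp

lemma epic_Cmp: "epic C f \<Longrightarrow> epic C g \<Longrightarrow> Cod C f = Dom C g \<Longrightarrow> epic C (g \<cdot> f)"
  using abelian_category.monic_Cmp[OF abelian_opposite, of g f] by simp

lemma is_kernelD:
  assumes "is_kernel C k f"
  shows "f \<in> Arr C" "k \<in> Arr C" "Cod C k = Dom C f" "f \<cdot> k = Zer C (Dom C k) (Cod C f)"
  using assms by (auto simp: is_kernel_def)

lemma is_kernel_factor:
  assumes "is_kernel C k f" "u \<in> Arr C" "Cod C u = Dom C f" "f \<cdot> u = Zer C (Dom C u) (Cod C f)"
  obtains v where "v \<in> Hom C (Dom C u) (Dom C k)" "k \<cdot> v = u"
proof -
  have "\<exists>!v. v \<in> Hom C (Dom C u) (Dom C k) \<and> k \<cdot> v = u"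
    using assms unfolding is_kernel_def by simp
  then show thesis using that by auto
qed

lemma is_kernel_monic: assumes "is_kernel C k f" shows "monic C k"
proof (rule monicI)
  note k = is_kernelD[OF assms]
  fix u assume u: "u \<in> Arr C" "Cod C u = Dom C k" "k \<cdot> u = Zer C (Dom C u) (Cod C k)"
  have "\<exists>!v. v \<in> Hom C (Dom C u) (Dom C k) \<and> k \<cdot> v = Zer C (Dom C u) (Dom C f)"
    using assms u k unfolding is_kernel_def by simp
  moreover have "u \<in> Hom C (Dom C u) (Dom C k) \<and> k \<cdot> u = Zer C (Dom C u) (Dom C f)" using u k by simp
  moreover have "Zer C (Dom C u) (Dom C k) \<in> Hom C (Dom C u) (Dom C k) \<and> k \<cdot> Zer C (Dom C u) (Dom C k) = Zer C (Dom C u) (Dom C f)"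
    using u k by simp
  ultimately show "u = Zer C (Dom C u) (Dom C k)" by blast
qed (use is_kernelD[OF assms] in simp)

text \<open>With \<open>k\<close> monic the factorization is automatically unique, so only its
  existence has to be supplied.\<close>

lemma is_kernelI:
  assumes "f \<in> Arr C" "monic C k" "Cod C k = Dom C f" "f \<cdot> k = Zer C (Dom C k) (Cod C f)"
    and "\<And>u. u \<in> Arr C \<Longrightarrow> Cod C u = Dom C f \<Longrightarrow> f \<cdot> u = Zer C (Dom C u) (Cod C f) \<Longrightarrow>
      \<exists>v. v \<in> Hom C (Dom C u) (Dom C k) \<and> k \<cdot> v = u"
  shows "is_kernel C k f"
  unfolding is_kernel_def
proof (intro conjI ballI impI)
  fix A u assume *: "A \<in> Obj C" "u \<in> Hom C A (Dom C f)" "f \<cdot> u = Zer C A (Cod C f)"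
  then obtain v where "v \<in> Hom C A (Dom C k) \<and> k \<cdot> v = u" using assms(5)[of u] by auto
  then show "\<exists>!v. v \<in> Hom C A (Dom C k) \<and> k \<cdot> v = u"
    using monic_cancel[OF assms(2)] by (intro ex1I[of _ v]) auto
qed (use assms in simp_all)

lemma is_cokernelD:
  assumes "is_cokernel C c f"
  shows "f \<in> Arr C" "c \<in> Arr C" "Dom C c = Cod C f" "c \<cdot> f = Zer C (Dom C f) (Cod C c)"
  using assms by (auto simp: is_cokernel_def)

lemma is_cokernel_factor:
  assumes "is_cokernel C c f" "u \<in> Arr C" "Dom C u = Cod C f" "u \<cdot> f = Zer C (Dom C f) (Cod C u)"
  obtains v where "v \<in> Hom C (Cod C c) (Cod C u)" "v \<cdot> c = u"
  using abelian_category.is_kernel_factor[OF abelian_opposite, of c f u] assms by auto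

lemma is_cokernel_epic: assumes "is_cokernel C c f" shows "epic C c"
  using abelian_category.is_kernel_monic[OF abelian_opposite, of c f] assms by simp

lemma is_cokernelI:
  assumes "f \<in> Arr C" "epic C c" "Dom C c = Cod C f" "c \<cdot> f = Zer C (Dom C f) (Cod C c)"
    and "\<And>u. u \<in> Arr C \<Longrightarrow> Dom C u = Cod C f \<Longrightarrow> u \<cdot> f = Zer C (Dom C f) (Cod C u) \<Longrightarrow>
      \<exists>v. v \<in> Hom C (Cod C c) (Cod C u) \<and> v \<cdot> c = u"
  shows "is_cokernel C c f"
  using abelian_category.is_kernelI[OF abelian_opposite, of f c] assms by simp

text \<open>For \<open>u\<close> the kernel of \<open>g\<close> and \<open>v\<close> the cokernel of
  \<open>f\<close>, the last clause says that the kernel of \<open>g\<close> lies in the image of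
  \<open>f\<close>. Allowing arbitrary test morphisms removes images from the statement and makes it
  visibly self-dual.\<close>

lemma exact_iff:
  "exact C f g \<longleftrightarrow> f \<in> Arr C \<and> g \<in> Arr C \<and> Cod C f = Dom C g \<and> g \<cdot> f = Zer C (Dom C f) (Cod C g) \<and>
    (\<forall>u v. u \<in> Arr C \<longrightarrow> v \<in> Arr C \<longrightarrow> Cod C u = Dom C g \<longrightarrow> Dom C v = Dom C g \<longrightarrow>
       g \<cdot> u = Zer C (Dom C u) (Cod C g) \<longrightarrow> v \<cdot> f = Zer C (Dom C f) (Cod C v) \<longrightarrow> v \<cdot> u = Zer C (Dom C u) (Cod C v))"
    (is "?L \<longleftrightarrow> ?R")
proof
  assume ?L
  then obtain m c where fg: "f \<in> Arr C" "g \<in> Arr C" "Cod C f = Dom C g"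
    and c: "is_cokernel C c f" and mc: "is_kernel C m c" and mg: "is_kernel C m g"
    by (auto simp: exact_def is_image_def)
  note cs = is_cokernelD[OF c] and ms = is_kernelD[OF mc] and gs = is_kernelD[OF mg]
  obtain f' where f': "f' \<in> Hom C (Dom C f) (Dom C m)" "m \<cdot> f' = f"
    using is_kernel_factor[OF mc, of f] cs by auto
  have "g \<cdot> f = Zer C (Dom C f) (Cod C g)" using Cmp_rewr[OF gs(4), of f'] f' gs by simp
  moreover {
    fix u v assume *: "u \<in> Arr C" "v \<in> Arr C" "Cod C u = Dom C g" "Dom C v = Dom C g"
      "g \<cdot> u = Zer C (Dom C u) (Cod C g)" "v \<cdot> f = Zer C (Dom C f) (Cod C v)"
    obtain u' where u': "u' \<in> Hom C (Dom C u) (Dom C m)" "m \<cdot> u' = u"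
      using is_kernel_factor[OF mg, of u] * by auto
    obtain v' where v': "v' \<in> Hom C (Cod C c) (Cod C v)" "v' \<cdot> c = v"
      using is_cokernel_factor[OF c, of v] * fg by auto
    have "c \<cdot> u = Zer C (Dom C u) (Cod C c)" using Cmp_rewr[OF ms(4), of u'] u' ms by simp
    then have "v \<cdot> u = Zer C (Dom C u) (Cod C v)" using Cmp_rewr[OF v'(2), of u] v' * cs fg by simp }
  ultimately show ?R using fg by blast
next
  assume R: ?R
  then have fg: "f \<in> Arr C" "g \<in> Arr C" "Cod C f = Dom C g" "g \<cdot> f = Zer C (Dom C f) (Cod C g)"
    by blast+
  obtain m where m: "is_kernel C m g" using ex_kernel fg by blast
  obtain c where c: "is_cokernel C c f" using ex_cokernel fg by blast
  note ms = is_kernelD[OF m] and cs = is_cokernelD[OF c]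
  obtain g' where g': "g' \<in> Hom C (Cod C c) (Cod C g)" "g' \<cdot> c = g"
    using is_cokernel_factor[OF c, of g] fg by auto
  \<comment> \<open>The kernel of \<open>g\<close> is itself the candidate image. The vanishing
    clause at \<open>m\<close> and \<open>c\<close> puts it inside the kernel of \<open>c\<close>;
    conversely \<open>g\<close> factors through \<open>c\<close>, so whatever \<open>c\<close> kills
    is killed by \<open>g\<close>.\<close>
  have "is_kernel C m c"
  proof (rule is_kernelI)
    show "c \<cdot> m = Zer C (Dom C m) (Cod C c)" using R ms cs fg(3) by metis
    fix u assume u: "u \<in> Arr C" "Cod C u = Dom C c" "c \<cdot> u = Zer C (Dom C u) (Cod C c)"
    then have "g \<cdot> u = Zer C (Dom C u) (Cod C g)" using Cmp_rewr[OF g'(2), of u] g' cs fg by simp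
    then show "\<exists>v. v \<in> Hom C (Dom C u) (Dom C m) \<and> m \<cdot> v = u"
      using is_kernel_factor[OF m, of u] u fg cs by metis
  qed (use is_kernel_monic[OF m] ms cs fg in simp_all)
  then show ?L using fg m c by (auto simp: exact_def is_image_def)
qed

lemma exact_opposite [simp]: "exact (opposite C) f g = exact C g f"
  unfolding exact_iff abelian_category.exact_iff[OF abelian_opposite]
  by (auto simp: eq_commute)

lemma short_exact_opposite [simp]: "short_exact (opposite C) f g = short_exact C g f"
  by (auto simp: short_exact_def)

lemma exactD:
  assumes "exact C f g"
  shows "f \<in> Arr C" "g \<in> Arr C" "Cod C f = Dom C g" "g \<cdot> f = Zer C (Dom C f) (Cod C g)"
  using assms by (auto simp: exact_iff)

lemma exact_vanish:
  assumes "exact C f g" "u \<in> Arr C" "v \<in> Arr C" "Cod C u = Dom C g" "Dom C v = Dom C g"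
    "g \<cdot> u = Zer C (Dom C u) (Cod C g)" "v \<cdot> f = Zer C (Dom C f) (Cod C v)"
  shows "v \<cdot> u = Zer C (Dom C u) (Cod C v)"
  using assms by (auto simp: exact_iff)

text \<open>A monomorphism is the kernel of some \<open>h\<close>. Since \<open>h\<close> kills
  \<open>f\<close>, exactness makes it kill everything that \<open>g\<close> kills, and such
  morphisms then factor through \<open>f\<close>.\<close>

lemma exact_monic_kernel:
  assumes "exact C f g" "monic C f" shows "is_kernel C f g"
proof (rule is_kernelI)
  note fg = exactD[OF assms(1)]
  fix u assume u: "u \<in> Arr C" "Cod C u = Dom C g" "g \<cdot> u = Zer C (Dom C u) (Cod C g)"
  obtain h where h: "is_kernel C f h" using monic_normal assms by auto
  have "h \<cdot> u = Zer C (Dom C u) (Cod C h)"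
    using exact_vanish[OF assms(1), of u h] u is_kernelD[OF h] fg by simp
  then show "\<exists>v. v \<in> Hom C (Dom C u) (Dom C f) \<and> f \<cdot> v = u"
    using is_kernel_factor[OF h, of u] u is_kernelD[OF h] fg by metis
qed (use assms exactD[OF assms(1)] in simp_all)

lemma exact_epic_cokernel: "exact C f g \<Longrightarrow> epic C g \<Longrightarrow> is_cokernel C g f"
  using abelian_category.exact_monic_kernel[OF abelian_opposite, of g f] by simp

lemma kernel_exact: assumes "is_kernel C k f" shows "exact C k f"
  unfolding exact_iff
proof (intro conjI allI impI)
  note k = is_kernelD[OF assms]
  fix u v assume *: "u \<in> Arr C" "v \<in> Arr C" "Cod C u = Dom C f" "Dom C v = Dom C f"
      "f \<cdot> u = Zer C (Dom C u) (Cod C f)" "v \<cdot> k = Zer C (Dom C k) (Cod C v)"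
  obtain u' where u': "u' \<in> Hom C (Dom C u) (Dom C k)" "k \<cdot> u' = u"
    using is_kernel_factor[OF assms, of u] * by auto
  have "v \<cdot> u = (v \<cdot> k) \<cdot> u'" using u' *(1-4) k by simp
  then show "v \<cdot> u = Zer C (Dom C u) (Cod C v)" using u' * k by (simp del: Cmp_assoc')
qed (use is_kernelD[OF assms] in simp_all)

lemma cokernel_exact: "is_cokernel C c f \<Longrightarrow> exact C f c"
  using abelian_category.kernel_exact[OF abelian_opposite, of c f] by simp

lemma short_exactD:
  assumes "short_exact C f g"
  shows "f \<in> Arr C" "g \<in> Arr C" "Cod C f = Dom C g" "g \<cdot> f = Zer C (Dom C f) (Cod C g)"
    "monic C f" "epic C g" "is_kernel C f g" "is_cokernel C g f"
  using assms exact_monic_kernel exact_epic_cokernel by (auto simp: short_exact_def exact_iff)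

lemma short_exact_kernelI: "is_kernel C f g \<Longrightarrow> epic C g \<Longrightarrow> short_exact C f g"
  using kernel_exact is_kernel_monic by (auto simp: short_exact_def)

lemma short_exact_cokernelI: "is_cokernel C g f \<Longrightarrow> monic C f \<Longrightarrow> short_exact C f g"
  using cokernel_exact is_cokernel_epic by (auto simp: short_exact_def)

end

section \<open>Pullbacks and short exact sequences\<close>

definition pullback :: "('o, 'm) lincat \<Rightarrow> 'm \<Rightarrow> 'm \<Rightarrow> 'm \<Rightarrow> 'm \<Rightarrow> bool" where
  "pullback C f g p q \<longleftrightarrow> f \<in> Arr C \<and> g \<in> Arr C \<and> p \<in> Arr C \<and> q \<in> Arr C \<and> Cod C f = Cod C g \<and>
    Dom C p = Dom C q \<and> Cod C p = Dom C f \<and> Cod C q = Dom C g \<and> f \<cdot>\<^bsub>C\<^esub> p = g \<cdot>\<^bsub>C\<^esub> q \<and>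
    (\<forall>u v. u \<in> Arr C \<longrightarrow> v \<in> Arr C \<longrightarrow> Cod C u = Dom C f \<longrightarrow> Cod C v = Dom C g \<longrightarrow> Dom C u = Dom C v \<longrightarrow>
       f \<cdot>\<^bsub>C\<^esub> u = g \<cdot>\<^bsub>C\<^esub> v \<longrightarrow>
       (\<exists>!w. w \<in> Hom C (Dom C v) (Dom C p) \<and> p \<cdot>\<^bsub>C\<^esub> w = u \<and> q \<cdot>\<^bsub>C\<^esub> w = v))"

context abelian_category
begin

text \<open>The mixed composites vanish by computation: multiplying
  \<open>i \<cdot> p \<oplus> j \<cdot> q = Ide C S\<close> by \<open>p\<close> on the left gives
  \<open>p \<cdot> (j \<cdot> q) = 0\<close>, and composing with \<open>j\<close> isolates
  \<open>p \<cdot> j\<close>. Multiplication by \<open>i\<close> on the right gives the other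
  one.\<close>

lemma biproductD:
  assumes "biproduct C A B S i j p q"
  shows "S \<in> Obj C" "i \<in> Arr C" "j \<in> Arr C" "p \<in> Arr C" "q \<in> Arr C"
    "Dom C i = A" "Dom C j = B" "Cod C p = A" "Cod C q = B"
    "Cod C i = S" "Cod C j = S" "Dom C p = S" "Dom C q = S"
    "p \<cdot> i = Ide C A" "q \<cdot> j = Ide C B" "i \<cdot> p \<oplus> j \<cdot> q = Ide C S"
    "p \<cdot> j = Zer C B A" "q \<cdot> i = Zer C A B"
proof -
  show t: "S \<in> Obj C" "i \<in> Arr C" "j \<in> Arr C" "p \<in> Arr C" "q \<in> Arr C"
    "Dom C i = A" "Dom C j = B" "Cod C p = A" "Cod C q = B"
    "Cod C i = S" "Cod C j = S" "Dom C p = S" "Dom C q = S"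
    and e: "p \<cdot> i = Ide C A" "q \<cdot> j = Ide C B" "i \<cdot> p \<oplus> j \<cdot> q = Ide C S"
    using assms by (simp_all add: biproduct_def)
  have o: "A \<in> Obj C" "B \<in> Obj C" using t Dom_Obj by blast+
  have "p \<oplus> p \<cdot> (j \<cdot> q) = p \<cdot> (i \<cdot> p \<oplus> j \<cdot> q)"
    using t Cmp_rewr[OF e(1), of p] by simp
  also have "\<dots> = p" using e t by simp
  finally have "p \<cdot> (j \<cdot> q) \<oplus> p = Zer C S A \<oplus> p" using t o Add_commute[of p "p \<cdot> (j \<cdot> q)"] by simp
  from Add_right_cancel[OF _ _ _ _ _ _ _ this] have pj: "p \<cdot> (j \<cdot> q) = Zer C S A" using t o by simp
  have "p \<cdot> j = p \<cdot> (j \<cdot> q) \<cdot> j" using t e by simp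
  also have "\<dots> = (p \<cdot> (j \<cdot> q)) \<cdot> j" using t by simp
  also have "\<dots> = Zer C B A" using t o unfolding pj by simp
  finally show "p \<cdot> j = Zer C B A" .
  have "i \<cdot> p \<cdot> i \<oplus> j \<cdot> q \<cdot> i = (i \<cdot> p \<oplus> j \<cdot> q) \<cdot> i"
    using t by simp
  also have "\<dots> = i" using e t by simp
  finally have "j \<cdot> q \<cdot> i \<oplus> i = Zer C A S \<oplus> i" using t o e Add_commute[of i "j \<cdot> q \<cdot> i"] by simp
  from Add_right_cancel[OF _ _ _ _ _ _ _ this] have ji: "j \<cdot> q \<cdot> i = Zer C A S" using t o by simp
  have "q \<cdot> i = q \<cdot> (j \<cdot> q \<cdot> i)" using t e(2) Cmp_rewr[OF e(2), of "q \<cdot> i"] o by simp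
  also have "\<dots> = Zer C A B" using t o unfolding ji by simp
  finally show "q \<cdot> i = Zer C A B" .
qed

text \<open>The pullback is the kernel of \<open>t\<close>, the difference of the two maps on the
  biproduct. Stability of epimorphisms: if \<open>f\<close> is epic then so is \<open>t\<close>,
  because \<open>t \<cdot> i = f\<close>, and \<open>t\<close> is then the cokernel of its kernel. A
  morphism \<open>w\<close> killing the projection \<open>pB \<cdot> k\<close> satisfies
  \<open>w \<cdot> pB = z \<cdot> t\<close>; restriction along \<open>i\<close> yields
  \<open>z \<cdot> f = 0\<close>, so \<open>z\<close> and then \<open>w\<close> vanish.\<close>

lemma ex_pullback:
  assumes f: "f \<in> Arr C" and g: "g \<in> Arr C" and c: "Cod C f = Cod C g"
  obtains p q where "pullback C f g p q" "epic C f \<Longrightarrow> epic C q" "epic C g \<Longrightarrow> epic C p"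
proof -
  obtain S i j pA pB where "biproduct C (Dom C f) (Dom C g) S i j pA pB"
    using ex_biproduct f g by (metis Dom_Obj)
  note b = biproductD[OF this]
  define t where "t = f \<cdot> pA \<ominus> g \<cdot> pB"
  have t: "t \<in> Arr C" "Dom C t = S" "Cod C t = Cod C g" using b f g c by (simp_all add: t_def)
  obtain k where k: "is_kernel C k t" using ex_kernel t by blast
  note ks = is_kernelD[OF k]
  have tk: "f \<cdot> pA \<cdot> k \<ominus> g \<cdot> pB \<cdot> k = Zer C (Dom C k) (Cod C g)"
    using ks t b f g c unfolding t_def by simp
  have eq: "f \<cdot> pA \<cdot> k = g \<cdot> pB \<cdot> k"
    using Sub_eq_Zer_iff[of "f \<cdot> pA \<cdot> k" "g \<cdot> pB \<cdot> k"] tk ks t b f g c by simp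
  have tw: "t \<cdot> x = f \<cdot> pA \<cdot> x \<ominus> g \<cdot> pB \<cdot> x" if "x \<in> Arr C" "Cod C x = S" for x
    using that b f g c unfolding t_def by simp
  have dec: "x = i \<cdot> pA \<cdot> x \<oplus> j \<cdot> pB \<cdot> x" if "x \<in> Arr C" "Cod C x = S" for x
  proof -
    have "x = (i \<cdot> pA \<oplus> j \<cdot> pB) \<cdot> x" using that b by simp
    then show ?thesis using that b(1-13) by simp
  qed
  have ti: "t \<cdot> i = f" using tw[of i] b f g c by (simp add: Sub_eqI)
  have tj: "t \<cdot> j = Zer C (Dom C g) (Cod C g) \<ominus> g" using tw[of j] b f g c by simp
  have "pullback C f g (pA \<cdot> k) (pB \<cdot> k)"
    unfolding pullback_def
  proof (intro conjI allI impI)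
    fix u v assume uv: "u \<in> Arr C" "v \<in> Arr C" "Cod C u = Dom C f" "Cod C v = Dom C g" "Dom C u = Dom C v"
      "f \<cdot> u = g \<cdot> v"
    let ?w = "i \<cdot> u \<oplus> j \<cdot> v"
    have w: "?w \<in> Arr C" "Cod C ?w = S" "Dom C ?w = Dom C v" using uv b by simp_all
    have o: "Dom C v \<in> Obj C" using uv by simp
    have pw: "pA \<cdot> ?w = u"
      using uv(1-5) o b(1-13) Cmp_rewr[OF b(14), of u] Cmp_rewr[OF b(17), of v] f g by simp
    have qw: "pB \<cdot> ?w = v"
      using uv(1-5) o b(1-13) Cmp_rewr[OF b(15), of v] Cmp_rewr[OF b(18), of u] f g by simp
    note pw = pw qw
    have "t \<cdot> ?w = Zer C (Dom C ?w) (Cod C t)" using tw[OF w(1,2)] pw uv t w f g c by simp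
    then obtain z where z: "z \<in> Hom C (Dom C v) (Dom C k)" "k \<cdot> z = ?w"
      using is_kernel_factor[OF k w(1)] w t by metis
    show "\<exists>!w. w \<in> Hom C (Dom C v) (Dom C (pA \<cdot> k)) \<and> (pA \<cdot> k) \<cdot> w = u \<and> (pB \<cdot> k) \<cdot> w = v"
    proof (rule ex1I[of _ z])
      show "z \<in> Hom C (Dom C v) (Dom C (pA \<cdot> k)) \<and> (pA \<cdot> k) \<cdot> z = u \<and> (pB \<cdot> k) \<cdot> z = v"
        using z pw ks t b(1-13) by simp
      fix y assume y: "y \<in> Hom C (Dom C v) (Dom C (pA \<cdot> k)) \<and> (pA \<cdot> k) \<cdot> y = u \<and> (pB \<cdot> k) \<cdot> y = v"
      then have y1: "y \<in> Arr C" "Cod C y = Dom C k" "(pA \<cdot> k) \<cdot> y = u" "(pB \<cdot> k) \<cdot> y = v"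
        using ks t b(1-13) by auto
      then have "pA \<cdot> k \<cdot> y = u" "pB \<cdot> k \<cdot> y = v" using ks t b(1-13) by simp_all
      then have "k \<cdot> y = ?w" using dec[of "k \<cdot> y"] y1 ks t b(1-13) by simp
      then show "y = z" using monic_cancel[OF is_kernel_monic[OF k], of y z] y z ks t b(1-13) by simp
    qed
  qed (use f g c ks t b(1-13) eq in simp_all)
  moreover have "epic C (pB \<cdot> k)" if "epic C f"
  proof (rule epicI)
    fix w assume w: "w \<in> Arr C" "Dom C w = Cod C (pB \<cdot> k)" "w \<cdot> pB \<cdot> k = Zer C (Dom C (pB \<cdot> k)) (Cod C w)"
    have "epic C t"
    proof (rule epicI)
      fix z assume z: "z \<in> Arr C" "Dom C z = Cod C t" "z \<cdot> t = Zer C (Dom C t) (Cod C z)"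
      then have "z \<cdot> f = Zer C (Dom C f) (Cod C z)" using Cmp_rewr[OF z(3), of i] ti t b(1-13) by simp
      then show "z = Zer C (Cod C t) (Cod C z)" using epicD[OF that, of z] z t c by simp
    qed (fact t)
    then have "is_cokernel C t k" using kernel_exact[OF k] exact_epic_cokernel by blast
    then obtain z where z: "z \<in> Hom C (Cod C t) (Cod C w)" "z \<cdot> t = w \<cdot> pB"
      using is_cokernel_factor[of t k "w \<cdot> pB"] w ks t b(1-13) by auto
    have "z \<cdot> f = Zer C (Dom C f) (Cod C z)"
      using Cmp_rewr[OF z(2), of i] ti t z w ks b(1-13) b(18) f g by simp
    then have "z = Zer C (Cod C t) (Cod C z)" using epicD[OF that, of z] z t c by simp
    then have "w \<cdot> pB = Zer C S (Cod C w)" using z t Zer_Cmp[of t] by (metis Hom_iff Cod_Obj)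
    then show "w = Zer C (Cod C (pB \<cdot> k)) (Cod C w)"
      using Cmp_rewr[of w pB "Zer C S (Cod C w)" j] b w ks t by simp
  qed (use ks t b in simp)
  moreover have "epic C (pA \<cdot> k)" if "epic C g"
  proof (rule epicI)
    fix w assume w: "w \<in> Arr C" "Dom C w = Cod C (pA \<cdot> k)" "w \<cdot> pA \<cdot> k = Zer C (Dom C (pA \<cdot> k)) (Cod C w)"
    \<comment> \<open>On the second summand \<open>t\<close> restricts to the negative of
      \<open>g\<close>, so the vanishing of \<open>z \<cdot> g\<close> has to be read off from a
      difference.\<close>
    have zj: "z = Zer C (Cod C t) (Cod C z)"
      if z: "z \<in> Arr C" "Dom C z = Cod C t" "z \<cdot> t \<cdot> j = Zer C (Dom C g) (Cod C z)" for z
    proof -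
      have "Zer C (Dom C g) (Cod C z) \<ominus> z \<cdot> g = Zer C (Dom C g) (Cod C z)" using z t tj g by simp
      then have "z \<cdot> g = Zer C (Dom C g) (Cod C z)"
        using Sub_eq_Zer_iff[of "Zer C (Dom C g) (Cod C z)" "z \<cdot> g"] z t g by simp
      then show ?thesis using epicD[OF \<open>epic C g\<close>, of z] z t by simp
    qed
    have "epic C t"
    proof (rule epicI)
      fix z assume z: "z \<in> Arr C" "Dom C z = Cod C t" "z \<cdot> t = Zer C (Dom C t) (Cod C z)"
      then have "z \<cdot> t \<cdot> j = Zer C (Dom C g) (Cod C z)" using Cmp_rewr[OF z(3), of j] t b(1-13) by simp
      then show "z = Zer C (Cod C t) (Cod C z)" using z by (intro zj) simp_all
    qed (fact t)
    then have "is_cokernel C t k" using kernel_exact[OF k] exact_epic_cokernel by blast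
    then obtain z where z: "z \<in> Hom C (Cod C t) (Cod C w)" "z \<cdot> t = w \<cdot> pA"
      using is_cokernel_factor[of t k "w \<cdot> pA"] w ks t b(1-13) by auto
    have "z \<cdot> t \<cdot> j = Zer C (Dom C g) (Cod C z)"
      using Cmp_rewr[OF z(2), of j] t z(1) w(1,2) ks b(1-13) b(17) f g by simp
    then have "z = Zer C (Cod C t) (Cod C z)" using z by (intro zj) simp_all
    then have "w \<cdot> pA = Zer C S (Cod C w)" using z t Zer_Cmp[of t] by (metis Hom_iff Cod_Obj)
    then show "w = Zer C (Cod C (pA \<cdot> k)) (Cod C w)"
      using Cmp_rewr[of w pA "Zer C S (Cod C w)" i] b w ks t by simp
  qed (use ks t b in simp)
  ultimately show thesis using that by blast
qed

lemma pullbackD: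
  assumes "pullback C f g p q"
  shows "f \<in> Arr C" "g \<in> Arr C" "p \<in> Arr C" "q \<in> Arr C" "Cod C f = Cod C g"
    "Dom C p = Dom C q" "Cod C p = Dom C f" "Cod C q = Dom C g" "f \<cdot> p = g \<cdot> q"
  using assms by (simp_all add: pullback_def)

lemma pullback_factor:
  assumes "pullback C f g p q" "u \<in> Arr C" "v \<in> Arr C" "Cod C u = Dom C f" "Cod C v = Dom C g"
    "Dom C u = Dom C v" "f \<cdot> u = g \<cdot> v"
  obtains w where "w \<in> Hom C (Dom C v) (Dom C p)" "p \<cdot> w = u" "q \<cdot> w = v"
  using assms unfolding pullback_def by metis

lemma pullback_ex1:
  assumes "pullback C f g p q" "u \<in> Arr C" "v \<in> Arr C" "Cod C u = Dom C f" "Cod C v = Dom C g"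
    "Dom C u = Dom C v" "f \<cdot> u = g \<cdot> v"
  shows "\<exists>!w. w \<in> Hom C (Dom C v) (Dom C p) \<and> p \<cdot> w = u \<and> q \<cdot> w = v"
  using assms unfolding pullback_def by blast

lemma pullback_cancel:
  assumes "pullback C f g p q" "w \<in> Arr C" "w' \<in> Arr C" "Cod C w = Dom C p" "Cod C w' = Dom C p"
    "Dom C w = Dom C w'" "p \<cdot> w = p \<cdot> w'" "q \<cdot> w = q \<cdot> w'"
  shows "w = w'"
proof -
  note p = pullbackD[OF assms(1)]
  have "f \<cdot> p \<cdot> w = g \<cdot> q \<cdot> w" using Cmp_rewr[OF p(9), of w] p(1-8) assms(2-6) by simp
  then have "\<exists>!z. z \<in> Hom C (Dom C (q \<cdot> w)) (Dom C p) \<and> p \<cdot> z = p \<cdot> w \<and> q \<cdot> z = q \<cdot> w"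
    using p(1-8) assms(2-6) by (intro pullback_ex1[OF assms(1)]) simp_all
  moreover have "w \<in> Hom C (Dom C (q \<cdot> w)) (Dom C p)" "w' \<in> Hom C (Dom C (q \<cdot> w)) (Dom C p)"
    using p(1-8) assms(2-6) by simp_all
  ultimately show ?thesis using assms(7,8) by metis
qed

text \<open>The substitute for choosing a preimage of an element: a generalized element
  \<open>y\<close> lifts along an epimorphism after its domain is replaced by an epic cover
  \<open>t\<close>.\<close>

lemma epic_cover:
  assumes "epic C e" "y \<in> Arr C" "Cod C y = Cod C e"
  obtains t x where "epic C t" "x \<in> Hom C (Dom C t) (Dom C e)" "Cod C t = Dom C y" "e \<cdot> x = y \<cdot> t"
proof -
  obtain p q where "pullback C e y p q" "epic C q" using ex_pullback[of e y] assms by (metis epic_Arr)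
  then show thesis using pullbackD[of e y p q] that[of q p] by simp
qed

text \<open>Let \<open>u\<close> kill the corestriction \<open>f'\<close> and let \<open>l\<close>
  be the kernel of \<open>u\<close>. Then \<open>f\<close> factors through the monomorphism
  \<open>k \<cdot> l\<close>, which is the kernel of some \<open>h\<close>. Exactness forces
  \<open>h\<close> to kill \<open>k\<close>, so \<open>k\<close> factors through
  \<open>k \<cdot> l\<close>; hence \<open>l\<close> has a right inverse and
  \<open>u = 0\<close>.\<close>

lemma exact_kernel_epic:
  assumes "exact C f g" "is_kernel C k g"
  obtains f' where "f' \<in> Hom C (Dom C f) (Dom C k)" "k \<cdot> f' = f" "epic C f'"
proof -
  note fg = exactD[OF assms(1)] and k = is_kernelD[OF assms(2)]
  obtain f' where f': "f' \<in> Hom C (Dom C f) (Dom C k)" "k \<cdot> f' = f"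
    using is_kernel_factor[OF assms(2), of f] fg by auto
  have "epic C f'"
  proof (rule epicI)
    fix u assume u: "u \<in> Arr C" "Dom C u = Cod C f'" "u \<cdot> f' = Zer C (Dom C f') (Cod C u)"
    obtain l where l: "is_kernel C l u" using ex_kernel u by blast
    note ls = is_kernelD[OF l]
    obtain f'' where f'': "f'' \<in> Hom C (Dom C f') (Dom C l)" "l \<cdot> f'' = f'"
      using is_kernel_factor[OF l, of f'] f' u by auto
    have "monic C (k \<cdot> l)"
      using is_kernel_monic[OF l] is_kernel_monic[OF assms(2)] ls u f' by (intro monic_Cmp) simp_all
    then obtain h where h: "is_kernel C (k \<cdot> l) h" using monic_normal by blast
    have kl: "k \<cdot> l \<in> Arr C" "Dom C h = Cod C k" "h \<in> Arr C" "h \<cdot> k \<cdot> l = Zer C (Dom C l) (Cod C h)"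
      using is_kernelD[OF h] ls u f' k by simp_all
    have "h \<cdot> f = Zer C (Dom C f) (Cod C h)"
    proof -
      have "f = (k \<cdot> l) \<cdot> f''" using f'' f' ls k u by simp
      then show ?thesis
        using Cmp_rewr[OF kl(4), of f''] kl f'' f' ls k u fg by (metis Hom_iff Cmp_assoc' Cmp_simps Zer_Cmp Cod_Obj)
    qed
    then have "h \<cdot> k = Zer C (Dom C k) (Cod C h)" using exact_vanish[OF assms(1), of k h] k kl by simp
    then obtain s where s: "s \<in> Hom C (Dom C k) (Dom C (k \<cdot> l))" "(k \<cdot> l) \<cdot> s = k"
      using is_kernel_factor[OF h, of k] k kl by metis
    then have "k \<cdot> l \<cdot> s = k \<cdot> Ide C (Dom C k)" using ls k u f' by simp
    then have ls1: "l \<cdot> s = Ide C (Dom C k)"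
      using monic_cancel[OF is_kernel_monic[OF assms(2)], of "l \<cdot> s" "Ide C (Dom C k)"] ls k u f' s by simp
    have "u = u \<cdot> l \<cdot> s" using ls1 u f' by simp
    also have "\<dots> = Zer C (Dom C k) (Cod C u)" using Cmp_rewr[OF ls(4), of s] ls u s f' k by simp
    finally show "u = Zer C (Cod C f') (Cod C u)" using f' by simp
  qed (use f' in simp)
  then show thesis using that f' by blast
qed

section \<open>Short exact sequences under pullback and pushout\<close>

lemma pullback_short_exact:
  assumes "short_exact C a b" "pullback C b h h' b'" "epic C b'"
  obtains a' where "short_exact C a' b'" "Dom C a' = Dom C a" "h' \<cdot> a' = a"
proof -
  note s = short_exactD[OF assms(1)] and p = pullbackD[OF assms(2)]
  obtain a' where a': "a' \<in> Hom C (Dom C a) (Dom C h')" "h' \<cdot> a' = a" "b' \<cdot> a' = Zer C (Dom C a) (Dom C h)"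
    using pullback_factor[OF assms(2), of a "Zer C (Dom C a) (Dom C h)"] s p by auto
  have "is_kernel C a' b'"
  proof (rule is_kernelI)
    show "monic C a'"
    proof (rule monicI)
      fix u assume u: "u \<in> Arr C" "Cod C u = Dom C a'" "a' \<cdot> u = Zer C (Dom C u) (Cod C a')"
      have "a \<cdot> u = Zer C (Dom C u) (Cod C a)" using Cmp_rewr[OF a'(2), of u] u a'(1) p(1-8) s(1-3) by simp
      then show "u = Zer C (Dom C u) (Dom C a')" using monicD[OF s(5), of u] u a' by simp
    qed (use a' in simp)
    fix u assume u: "u \<in> Arr C" "Cod C u = Dom C b'" "b' \<cdot> u = Zer C (Dom C u) (Cod C b')"
    have "b \<cdot> h' \<cdot> u = Zer C (Dom C u) (Cod C b)" using Cmp_rewr[OF p(9), of u] u p(1-8) by simp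
    then obtain v where v: "v \<in> Hom C (Dom C u) (Dom C a)" "a \<cdot> v = h' \<cdot> u"
      using is_kernel_factor[OF s(7), of "h' \<cdot> u"] u p s by auto
    have "a' \<cdot> v = u"
      using pullback_cancel[OF assms(2), of "a' \<cdot> v" u] Cmp_rewr[OF a'(2), of v] Cmp_rewr[OF a'(3), of v]
        u v a'(1) p(1-8) s(1-3) by simp
    then show "\<exists>v. v \<in> Hom C (Dom C u) (Dom C a') \<and> a' \<cdot> v = u" using v a'(1) by auto
  qed (use a' p in simp_all)
  then show thesis using that[of a'] short_exact_kernelI assms a' by simp
qed

lemma short_exact_pullback:
  assumes "short_exact C a b" "h \<in> Arr C" "Cod C h = Cod C b"
  obtains a' b' h' where "short_exact C a' b'" "Dom C a' = Dom C a" "h' \<cdot> a' = a" "pullback C b h h' b'"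
    "epic C h \<Longrightarrow> epic C h'"
proof -
  note s = short_exactD[OF assms(1)]
  obtain h' b' where p: "pullback C b h h' b'" "epic C b \<Longrightarrow> epic C b'" "epic C h \<Longrightarrow> epic C h'"
    using ex_pullback[of b h] assms s by auto
  show thesis by (rule pullback_short_exact[OF assms(1) p(1)]) (use p s that in auto)
qed

lemma short_exact_pushout:
  assumes "short_exact C a b" "h \<in> Arr C" "Dom C h = Dom C a"
  obtains a' b' h' where "short_exact C a' b'" "Cod C b' = Cod C b" "b' \<cdot> h' = b"
    "pullback (opposite C) a h h' a'" "monic C h \<Longrightarrow> monic C h'"
proof (rule abelian_category.short_exact_pullback[OF abelian_opposite, of b a h])
  fix b' a' h' assume "short_exact (opposite C) b' a'" "Dom (opposite C) b' = Dom (opposite C) b"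
    "h' \<cdot>\<^bsub>opposite C\<^esub> b' = b" "pullback (opposite C) a h h' a'" "epic (opposite C) h \<Longrightarrow> epic (opposite C) h'"
  then show thesis by (intro that[of a' b' h']) simp_all
qed (use assms in simp_all)

text \<open>The cokernel of \<open>f\<close> is the image of \<open>g\<close>. An exact complex is
  cut in this way into short exact sequences of its successive cokernels, the form in which closure
  properties are propagated along it. Monicity is an element argument: a lift of \<open>u\<close>
  along \<open>c\<close>, taken on an epic cover, is killed by \<open>g\<close> and therefore by
  \<open>c\<close>.\<close>

lemma exact_cokernel_short_exact:
  assumes "exact C f g" "is_cokernel C c f" "is_cokernel C e g"
  obtains m where "m \<in> Hom C (Cod C c) (Cod C g)" "m \<cdot> c = g" "short_exact C m e"
proof -
  note fg = exactD[OF assms(1)] and c = is_cokernelD[OF assms(2)] and e = is_cokernelD[OF assms(3)]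
  obtain m where m: "m \<in> Hom C (Cod C c) (Cod C g)" "m \<cdot> c = g"
    using is_cokernel_factor[OF assms(2), of g] fg by auto
  have "monic C m"
  proof (rule monicI)
    fix u assume u: "u \<in> Arr C" "Cod C u = Dom C m" "m \<cdot> u = Zer C (Dom C u) (Cod C m)"
    obtain t x where t: "epic C t" "x \<in> Hom C (Dom C t) (Dom C c)" "Cod C t = Dom C u" "c \<cdot> x = u \<cdot> t"
      using epic_cover[OF is_cokernel_epic[OF assms(2)], of u] u m by auto
    have "g \<cdot> x = m \<cdot> c \<cdot> x" using Cmp_rewr[OF m(2), of x] t m c by simp
    also have "\<dots> = Zer C (Dom C x) (Cod C g)" using t Cmp_rewr[OF u(3), of t] u m by simp
    finally have "u \<cdot> t = Zer C (Dom C t) (Cod C u)"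
      using exact_vanish[OF assms(1), of x c] t c fg u m by simp
    then show "u = Zer C (Dom C u) (Dom C m)" using epicD[OF t(1), of u] t u by simp
  qed (use m in simp)
  moreover have "is_cokernel C e m"
  proof (rule is_cokernelI)
    have "(e \<cdot> m) \<cdot> c = Zer C (Dom C m) (Cod C e) \<cdot> c" using m e c fg by simp
    then show "e \<cdot> m = Zer C (Dom C m) (Cod C e)"
      using epic_cancel[OF is_cokernel_epic[OF assms(2)], of "e \<cdot> m" "Zer C (Dom C m) (Cod C e)"] m c e by simp
    fix u assume u: "u \<in> Arr C" "Dom C u = Cod C m" "u \<cdot> m = Zer C (Dom C m) (Cod C u)"
    have "u \<cdot> g = Zer C (Dom C g) (Cod C u)" using Cmp_rewr[OF u(3), of c] m u c fg by simp
    then obtain v where "v \<in> Hom C (Cod C e) (Cod C u)" "v \<cdot> e = u"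
      using is_cokernel_factor[OF assms(3), of u] u m by auto
    then show "\<exists>v. v \<in> Hom C (Cod C e) (Cod C u) \<and> v \<cdot> e = u" by blast
  qed (use m e is_cokernel_epic[OF assms(3)] in simp_all)
  ultimately show thesis using that[of m] m short_exact_cokernelI by blast
qed

end

section \<open>Vanishing of Yoneda Ext\<close>

text \<open>Vanishing in degree one as splitting, free of equivalence classes. A retraction is asked
  for; \<open>short_exact_retract_iff\<close> turns it into a section, which makes the notion
  self-dual.\<close>

definition Ext1_split :: "('o, 'm) lincat \<Rightarrow> 'o \<Rightarrow> 'o \<Rightarrow> bool" where
  "Ext1_split C X Y \<longleftrightarrow> (\<forall>a b. short_exact C a b \<and> Dom C a = Y \<and> Cod C b = X \<longrightarrow>
     (\<exists>r \<in> Hom C (Cod C a) Y. r \<cdot>\<^bsub>C\<^esub> a = Ide C Y))"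

text \<open>The two-fold extension with maps \<open>a\<close>, \<open>b\<close>, \<open>c\<close> comes from the filtered object \<open>M = Cod C i\<close>.
  In contrast to Yoneda equivalence, which is a zigzag, this is stated with one object, and it is
  visibly self-dual.\<close>

definition trivial2 :: "('o, 'm) lincat \<Rightarrow> 'm \<Rightarrow> 'm \<Rightarrow> 'm \<Rightarrow> bool" where
  "trivial2 C a b c \<longleftrightarrow> (\<exists>i p. i \<in> Arr C \<and> p \<in> Arr C \<and> Dom C i = Dom C b \<and> Cod C i = Dom C p \<and>
     Cod C p = Cod C b \<and> p \<cdot>\<^bsub>C\<^esub> i = b \<and> short_exact C i (c \<cdot>\<^bsub>C\<^esub> p) \<and> short_exact C (i \<cdot>\<^bsub>C\<^esub> a) p)"

text \<open>Two-fold extensions are presented as splices of two short exact sequences, with middle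
  map \<open>k \<cdot> b\<close>, because they arise in this form in all applications.\<close>

definition Ext2_split :: "('o, 'm) lincat \<Rightarrow> 'o \<Rightarrow> 'o \<Rightarrow> bool" where
  "Ext2_split C X Y \<longleftrightarrow> (\<forall>a b k c. short_exact C a b \<and> short_exact C k c \<and> Dom C a = Y \<and> Cod C c = X \<and>
     Cod C b = Dom C k \<longrightarrow> trivial2 C a (k \<cdot>\<^bsub>C\<^esub> b) c)"

lemma Ext_zero_related:
  assumes "Ext_zero C n X Y" "extension C n X Y fs" "extension C n X Y gs"
  shows "(fs, gs) \<in> ({(fs, gs). extension_map C n X Y fs gs} \<union> {(fs, gs). extension_map C n X Y gs fs})\<^sup>*"
proof -
  let ?r = "extension_equiv C n X Y"
  have "?r `` {fs} \<in> Yoneda_Ext C n X Y" "?r `` {gs} \<in> Yoneda_Ext C n X Y"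
    using assms(2,3) by (auto simp: Yoneda_Ext_def intro: quotientI)
  then have "?r `` {fs} = ?r `` {gs}" using assms(1) unfolding Ext_zero_def is_singleton_def by force
  moreover have "(gs, gs) \<in> ?r" using assms(3) by (simp add: extension_equiv_def)
  ultimately have "(fs, gs) \<in> ?r" by blast
  then show ?thesis by (simp add: extension_equiv_def)
qed

text \<open>If there is only one class, then any two extensions are joined by a zigzag of extension
  maps. A property that a single map preserves and reflects thus passes from one known extension to
  all.\<close>

lemma Ext_zero_invariant:
  assumes "Ext_zero C n X Y" "extension C n X Y fs" "extension C n X Y gs" "P fs"
    and "\<And>fs gs. extension_map C n X Y fs gs \<Longrightarrow> P fs \<longleftrightarrow> P gs"
  shows "P gs"
  using Ext_zero_related[OF assms(1-3)] assms(4)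
  by (induction rule: rtrancl_induct) (use assms(5) in auto)

text \<open>Here the equivalence is the full relation. The given extension excludes the empty
  quotient, which is not a singleton.\<close>

lemma Ext_zeroI:
  assumes "extension C n X Y fs" "\<And>fs gs. extension C n X Y fs \<Longrightarrow> extension C n X Y gs \<Longrightarrow> extension_map C n X Y fs gs"
  shows "Ext_zero C n X Y"
proof -
  have r: "extension_equiv C n X Y = {fs. extension C n X Y fs} \<times> {fs. extension C n X Y fs}"
    using assms(2) by (auto simp: extension_equiv_def)
  have "Yoneda_Ext C n X Y = {{fs. extension C n X Y fs}}"
    using assms(1) unfolding Yoneda_Ext_def r quotient_def by auto
  then show ?thesis by (simp add: Ext_zero_def)
qed

context abelian_category
begin

section \<open>Duality of the splitting conditions\<close>

lemma trivial2I:
  assumes "i \<in> Arr C" "p \<in> Arr C" "Dom C i = Dom C b" "Cod C i = Dom C p" "Cod C p = Cod C b"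
    "p \<cdot> i = b" "short_exact C i (c \<cdot> p)" "short_exact C (i \<cdot> a) p"
  shows "trivial2 C a b c"
  using assms unfolding trivial2_def by blast

lemma trivial2_oppositeI:
  assumes "trivial2 C c b a" shows "trivial2 (opposite C) a b c"
proof -
  obtain i p where "i \<in> Arr C" "p \<in> Arr C" "Dom C i = Dom C b" "Cod C i = Dom C p"
    "Cod C p = Cod C b" "p \<cdot> i = b" "short_exact C i (a \<cdot> p)" "short_exact C (i \<cdot> c) p"
    using assms unfolding trivial2_def by blast
  then show ?thesis by (intro abelian_category.trivial2I[OF abelian_opposite, of p i]) simp_all
qed

lemma trivial2_opposite [simp]: "trivial2 (opposite C) a b c = trivial2 C c b a"
  using trivial2_oppositeI[of c b a] abelian_category.trivial2_oppositeI[OF abelian_opposite, of a b c] by auto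

text \<open>The endomorphism \<open>Ide C (Cod C a) \<ominus> a \<cdot> r\<close> kills
  \<open>a\<close> and so descends along \<open>b\<close>; the descended morphism is the
  section.\<close>

lemma short_exact_section:
  assumes "short_exact C a b" "r \<in> Hom C (Cod C a) (Dom C a)" "r \<cdot> a = Ide C (Dom C a)"
  shows "\<exists>s \<in> Hom C (Cod C b) (Dom C b). b \<cdot> s = Ide C (Cod C b)"
proof -
  note s = short_exactD[OF assms(1)] and r = assms(2,3)
  have "(Ide C (Cod C a) \<ominus> a \<cdot> r) \<cdot> a = Zer C (Dom C a) (Cod C a)"
    using s(1-3) r by simp
  then obtain t where t: "t \<in> Hom C (Cod C b) (Dom C b)" "t \<cdot> b = Ide C (Cod C a) \<ominus> a \<cdot> r"
    using is_cokernel_factor[OF s(8), of "Ide C (Cod C a) \<ominus> a \<cdot> r"] s r by auto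
  have "(b \<cdot> t) \<cdot> b = b \<cdot> (Ide C (Cod C a) \<ominus> a \<cdot> r)" using t s(1-3) by simp
  also have "\<dots> = b \<ominus> Zer C (Dom C b) (Cod C b)" using r s(1-3) Cmp_rewr[OF s(4), of r] by simp
  also have "\<dots> = b" using s(1-3) by (intro Sub_eqI) simp_all
  finally have "b \<cdot> t = Ide C (Cod C b)" using epic_cancel[OF s(6), of "b \<cdot> t" "Ide C (Cod C b)"] t s(1-3) by simp
  then show ?thesis using t by blast
qed

lemma short_exact_retract_iff:
  assumes "short_exact C a b"
  shows "(\<exists>r \<in> Hom C (Cod C a) (Dom C a). r \<cdot> a = Ide C (Dom C a)) \<longleftrightarrow>
    (\<exists>s \<in> Hom C (Cod C b) (Dom C b). b \<cdot> s = Ide C (Cod C b))"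
proof
  assume "\<exists>r \<in> Hom C (Cod C a) (Dom C a). r \<cdot> a = Ide C (Dom C a)"
  then show "\<exists>s \<in> Hom C (Cod C b) (Dom C b). b \<cdot> s = Ide C (Cod C b)"
    using short_exact_section[OF assms] by blast
next
  assume "\<exists>s \<in> Hom C (Cod C b) (Dom C b). b \<cdot> s = Ide C (Cod C b)"
  then show "\<exists>r \<in> Hom C (Cod C a) (Dom C a). r \<cdot> a = Ide C (Dom C a)"
    using abelian_category.short_exact_section[OF abelian_opposite, of b a] assms by auto
qed

lemma Ext1_split_oppositeI:
  assumes "Ext1_split C Y X" shows "Ext1_split (opposite C) X Y"
  unfolding Ext1_split_def
proof (intro allI impI)
  fix a b assume "short_exact (opposite C) a b \<and> Dom (opposite C) a = Y \<and> Cod (opposite C) b = X"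
  then have s: "short_exact C b a" "Cod C a = Y" "Dom C b = X" by auto
  then have "\<exists>r \<in> Hom C (Cod C b) (Dom C b). r \<cdot> b = Ide C (Dom C b)"
    using assms unfolding Ext1_split_def by blast
  then have "\<exists>t \<in> Hom C (Cod C a) (Dom C a). a \<cdot> t = Ide C (Cod C a)"
    using short_exact_retract_iff[OF s(1)] by blast
  then show "\<exists>r\<in>Hom (opposite C) (Cod (opposite C) a) Y. r \<cdot>\<^bsub>opposite C\<^esub> a = Ide (opposite C) Y"
    using s by simp
qed

lemma Ext1_split_opposite [simp]: "Ext1_split (opposite C) X Y = Ext1_split C Y X"
  using Ext1_split_oppositeI[of Y X] abelian_category.Ext1_split_oppositeI[OF abelian_opposite, of X Y] by auto

lemma Ext2_split_oppositeI:
  assumes "Ext2_split C Y X" shows "Ext2_split (opposite C) X Y"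
  unfolding Ext2_split_def trivial2_opposite short_exact_opposite opposite_simps
proof (intro allI impI)
  fix a b k c assume "short_exact C b a \<and> short_exact C c k \<and> Cod C a = Y \<and> Dom C c = X \<and> Dom C b = Cod C k"
  then show "trivial2 C c (b \<cdot> k) a" using assms unfolding Ext2_split_def by auto
qed

lemma Ext2_split_opposite [simp]: "Ext2_split (opposite C) X Y = Ext2_split C Y X"
  using Ext2_split_oppositeI[of Y X] abelian_category.Ext2_split_oppositeI[OF abelian_opposite, of X Y] by auto

section \<open>Yoneda Ext in degrees one and two\<close>

lemma extension_1_iff:
  "extension C 1 X Y fs \<longleftrightarrow> (\<exists>a b. fs = [a, b] \<and> short_exact C a b \<and> Dom C a = Y \<and> Cod C b = X)"
  unfolding extension_def short_exact_def by (auto simp: length_Suc_conv)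

lemma extension_map_1_iff:
  "extension_map C 1 X Y [a, b] [a', b'] \<longleftrightarrow> extension C 1 X Y [a, b] \<and> extension C 1 X Y [a', b'] \<and>
    (\<exists>h \<in> Hom C (Dom C b) (Dom C b'). h \<cdot> a = a' \<and> b = b' \<cdot> h)"
proof
  assume "extension_map C 1 X Y [a, b] [a', b']"
  then obtain h where e: "extension C 1 X Y [a, b]" "extension C 1 X Y [a', b']" 
    and h: "h 0 = Ide C Y" "h 2 = Ide C X" "\<And>i. i \<le> 1 \<Longrightarrow> h i \<in> Hom C (Dom C ([a, b] ! i)) (Dom C ([a', b'] ! i)) \<and>
             h (Suc i) \<cdot> ([a, b] ! i) = ([a', b'] ! i) \<cdot> h i"
    unfolding extension_map_def by (auto simp: numeral_2_eq_2)
  have "short_exact C a b" "short_exact C a' b'" "Dom C a' = Y" "Cod C b = X"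
    using e unfolding extension_1_iff by auto
  then have "h 1 \<in> Hom C (Dom C b) (Dom C b') \<and> h 1 \<cdot> a = a' \<and> b = b' \<cdot> h 1"
  proof (intro conjI)
    show "h 1 \<in> Hom C (Dom C b) (Dom C b')" using h(3)[of 1] by simp
    have "h 1 \<cdot> a = a' \<cdot> Ide C Y" using h(3)[of 0] h(1) by simp
    then show "h 1 \<cdot> a = a'" using Cmp_Ide' \<open>Dom C a' = Y\<close> short_exactD(1)[OF \<open>short_exact C a' b'\<close>] by metis
    have "Ide C X \<cdot> b = b' \<cdot> h 1" using h(3)[of 1] h(2) by (simp add: numeral_2_eq_2)
    then show "b = b' \<cdot> h 1" using Ide_Cmp' \<open>Cod C b = X\<close> short_exactD(2)[OF \<open>short_exact C a b\<close>] by metis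
  qed
  then show "extension C 1 X Y [a, b] \<and> extension C 1 X Y [a', b'] \<and>
    (\<exists>h \<in> Hom C (Dom C b) (Dom C b'). h \<cdot> a = a' \<and> b = b' \<cdot> h)" using e by blast
next
  assume *: "extension C 1 X Y [a, b] \<and> extension C 1 X Y [a', b'] \<and>
    (\<exists>h \<in> Hom C (Dom C b) (Dom C b'). h \<cdot> a = a' \<and> b = b' \<cdot> h)"
  then obtain h where e: "extension C 1 X Y [a, b]" "extension C 1 X Y [a', b']" 
    and h: "h \<in> Hom C (Dom C b) (Dom C b')" "h \<cdot> a = a'" "b = b' \<cdot> h" by blast
  have s: "short_exact C a b" "short_exact C a' b'" "Dom C a = Y" "Dom C a' = Y" "Cod C b = X" "Cod C b' = X"
    using e unfolding extension_1_iff by auto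
  have o: "Y \<in> Obj C" "X \<in> Obj C" using s short_exactD(1,2) by (metis Dom_Obj, metis Cod_Obj)
  have "\<exists>h. h (0::nat) = Ide C Y \<and> h (Suc 1) = Ide C X \<and>
      (\<forall>i\<le>1. h i \<in> Hom C (Dom C ([a, b] ! i)) (Dom C ([a', b'] ! i)) \<and>
             h (Suc i) \<cdot> ([a, b] ! i) = ([a', b'] ! i) \<cdot> h i)"
    using h s o short_exactD(1,2)[OF s(1)] short_exactD(1,2)[OF s(2)]
    by (intro exI[of _ "\<lambda>i. if i = 0 then Ide C Y else if i = 1 then h else Ide C X"]) (auto simp: le_Suc_eq simp del: Cmp_simps)
  then show "extension_map C 1 X Y [a, b] [a', b']" using e unfolding extension_map_def by simp
qed

lemma biproduct_short_exact:
  assumes "biproduct C A B S i j p q" shows "short_exact C i q"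
proof (rule short_exact_kernelI)
  note b = biproductD[OF assms]
  have o: "A \<in> Obj C" "B \<in> Obj C" using b Dom_Obj by blast+
  show "epic C q"
  proof (rule epicI)
    fix u assume u: "u \<in> Arr C" "Dom C u = Cod C q" "u \<cdot> q = Zer C (Dom C q) (Cod C u)"
    then show "u = Zer C (Cod C q) (Cod C u)" using Cmp_rewr[OF u(3), of j] b o by simp
  qed (use b in simp)
  show "is_kernel C i q"
  proof (rule is_kernelI)
    show "monic C i"
    proof (rule monicI)
      fix u assume u: "u \<in> Arr C" "Cod C u = Dom C i" "i \<cdot> u = Zer C (Dom C u) (Cod C i)"
      then show "u = Zer C (Dom C u) (Dom C i)" using Cmp_rewr[OF b(14), of u] b o by simp
    qed (use b in simp)
    fix u assume u: "u \<in> Arr C" "Cod C u = Dom C q" "q \<cdot> u = Zer C (Dom C u) (Cod C q)"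
    have "u = (i \<cdot> p \<oplus> j \<cdot> q) \<cdot> u" using u b by simp
    also have "\<dots> = i \<cdot> p \<cdot> u" using u b(1-13) o by simp
    finally show "\<exists>v. v \<in> Hom C (Dom C u) (Dom C i) \<and> i \<cdot> v = u" using u b by (intro exI[of _ "p \<cdot> u"]) simp
  qed (use b in simp_all)
qed

text \<open>From left to right, splitting travels from the biproduct extension along a zigzag: an
  extension map carries sections forwards and retractions backwards. Conversely, a retraction
  \<open>r\<close> of the first sequence and a section \<open>u\<close> of the second give the
  extension map \<open>a' \<cdot> r \<oplus> u \<cdot> b\<close>.\<close>

lemma Ext_zero_1_iff:
  assumes "X \<in> Obj C" "Y \<in> Obj C"
  shows "Ext_zero C 1 X Y \<longleftrightarrow> Ext1_split C X Y"
proof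
  let ?P = "\<lambda>fs. \<exists>r \<in> Hom C (Cod C (fs ! 0)) (Dom C (fs ! 0)). r \<cdot> (fs ! 0) = Ide C (Dom C (fs ! 0))"
  obtain S i j p q where b: "biproduct C Y X S i j p q" using ex_biproduct assms by blast
  note bs = biproductD[OF b]
  have e: "extension C 1 X Y [i, q]" unfolding extension_1_iff using biproduct_short_exact[OF b] bs by simp
  {
    assume z: "Ext_zero C 1 X Y"
    show "Ext1_split C X Y"
      unfolding Ext1_split_def
    proof (intro allI impI)
      fix a b assume ab: "short_exact C a b \<and> Dom C a = Y \<and> Cod C b = X"
      have "?P [a, b]"
      proof (rule Ext_zero_invariant[where P = ?P, OF z e])
        show "extension C 1 X Y [a, b]" using ab unfolding extension_1_iff by blast
        show "?P [i, q]" using bs by (intro bexI[of _ p]) simp_all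
        fix fs gs assume m: "extension_map C 1 X Y fs gs"
        then have "extension C 1 X Y fs" "extension C 1 X Y gs" by (simp_all add: extension_map_def)
        then obtain a b a' b' where f: "fs = [a, b]" "gs = [a', b']" and s: "short_exact C a b" "short_exact C a' b'"
          and t: "Dom C a = Y" "Cod C b = X" "Dom C a' = Y" "Cod C b' = X"
          unfolding extension_1_iff by metis
        obtain h where h: "h \<in> Hom C (Dom C b) (Dom C b')" "h \<cdot> a = a'" "b = b' \<cdot> h"
          using m unfolding f extension_map_1_iff by metis
        note s1 = short_exactD[OF s(1)] and s2 = short_exactD[OF s(2)]
        show "?P fs \<longleftrightarrow> ?P gs"
        proof
          assume "?P fs"
          then obtain u where u: "u \<in> Hom C (Cod C b) (Dom C b)" "b \<cdot> u = Ide C (Cod C b)"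
            using short_exact_retract_iff[OF s(1)] by (auto simp: f)
          have "b' \<cdot> h \<cdot> u = Ide C X"
            using Cmp_rewr[OF h(3)[symmetric], of u] u h(1) t s1 s2(1-3) by simp
          then have "\<exists>s \<in> Hom C (Cod C b') (Dom C b'). b' \<cdot> s = Ide C (Cod C b')"
            using u h(1) t s1 s2(1-3) by (intro bexI[of _ "h \<cdot> u"]) simp_all
          then show "?P gs" using short_exact_retract_iff[OF s(2)] by (simp add: f)
        next
          assume "?P gs"
          then obtain r where r: "r \<in> Hom C (Cod C a') (Dom C a')" "r \<cdot> a' = Ide C (Dom C a')" by (auto simp: f)
          then have "r \<cdot> h \<in> Hom C (Cod C a) (Dom C a)" "(r \<cdot> h) \<cdot> a = Ide C (Dom C a)"
            using h(1,2) t s1(1-3) s2(1-3) by simp_all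
          then show "?P fs" unfolding f by auto
        qed
      qed
      then show "\<exists>r\<in>Hom C (Cod C a) Y. r \<cdot> a = Ide C Y" using ab by auto
    qed
  next
    assume sp: "Ext1_split C X Y"
    show "Ext_zero C 1 X Y"
    proof (rule Ext_zeroI[OF e])
      fix fs gs assume fg: "extension C 1 X Y fs" "extension C 1 X Y gs"
      then obtain a b a' b' where f: "fs = [a, b]" "gs = [a', b']" and s: "short_exact C a b" "short_exact C a' b'"
          and t: "Dom C a = Y" "Cod C b = X" "Dom C a' = Y" "Cod C b' = X"
          unfolding extension_1_iff by metis
      note s1 = short_exactD[OF s(1)] and s2 = short_exactD[OF s(2)]
      obtain r where r: "r \<in> Hom C (Cod C a) Y" "r \<cdot> a = Ide C Y"
        using sp s(1) t unfolding Ext1_split_def by blast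
      have "\<exists>r\<in>Hom C (Cod C a') (Dom C a'). r \<cdot> a' = Ide C (Dom C a')"
        using sp s(2) t unfolding Ext1_split_def by metis
      then obtain u where u: "u \<in> Hom C X (Dom C b')" "b' \<cdot> u = Ide C X"
        using short_exact_retract_iff[OF s(2)] t by auto
      let ?h = "a' \<cdot> r \<oplus> u \<cdot> b"
      have "?h \<in> Hom C (Dom C b) (Dom C b')" using r u s1 s2 t by simp
      moreover have "?h \<cdot> a = a'" using r u s1 s2 t assms by simp
      moreover have "b' \<cdot> ?h = b"
        using r u s1(1-3) s2(1-3) t assms Cmp_rewr[OF s2(4), of r] Cmp_rewr[OF u(2), of b] by simp
      ultimately show "extension_map C 1 X Y fs gs"
        using fg unfolding f extension_map_1_iff by (auto simp del: Hom_iff)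
    qed
  }
qed

text \<open>The filtered object of the source extension is the pullback of \<open>p'\<close> along
  \<open>h2\<close>. The projection \<open>p\<close> has the same kernel object as
  \<open>p'\<close>, and \<open>i\<close> is induced by \<open>i' \<cdot> h1\<close> and
  \<open>b\<close>. The instance in the opposite category pushes out along \<open>h1\<close> and
  gives the converse passage.\<close>

lemma trivial2_pullback:
  assumes ex: "monic C a" "exact C a b" "exact C b c" "epic C c"
    and h: "h1 \<in> Hom C (Dom C b) (Dom C b')" "h2 \<in> Hom C (Cod C b) (Cod C b')"
    and t': "b' \<in> Arr C" "a' \<in> Arr C" "c' \<in> Arr C" "Dom C a' = Dom C a" "Cod C a' = Dom C b'"
      "Dom C c' = Cod C b'" "Cod C c' = Cod C c"
    and eq: "h1 \<cdot> a = a'" "h2 \<cdot> b = b' \<cdot> h1" "c' \<cdot> h2 = c"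
    and tr: "trivial2 C a' b' c'"
  shows "trivial2 C a b c"
proof -
  note ab = exactD[OF ex(2)] and bc = exactD[OF ex(3)]
  obtain i' p' where i': "i' \<in> Arr C" "p' \<in> Arr C" "Dom C i' = Dom C b'" "Cod C i' = Dom C p'"
     "Cod C p' = Cod C b'" "p' \<cdot> i' = b'" "short_exact C i' (c' \<cdot> p')" "short_exact C (i' \<cdot> a') p'"
    using tr unfolding trivial2_def by blast
  have h2a: "h2 \<in> Arr C" "Cod C h2 = Cod C p'" using h i' by simp_all
  obtain m p q where m: "short_exact C m p" "Dom C m = Dom C (i' \<cdot> a')" "q \<cdot> m = i' \<cdot> a'" "pullback C p' h2 q p"
    using short_exact_pullback[OF i'(8) h2a] by blast
  note ms = short_exactD[OF m(1)] and q = pullbackD[OF m(4)]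
  have "p' \<cdot> i' \<cdot> h1 = h2 \<cdot> b" using Cmp_rewr[OF i'(6), of h1] i'(1-4) h eq(2) by simp
  then obtain i where i: "i \<in> Hom C (Dom C b) (Dom C q)" "q \<cdot> i = i' \<cdot> h1" "p \<cdot> i = b"
    using pullback_factor[OF m(4), of "i' \<cdot> h1" b] i'(1-5) h t' ab by auto
  have "i \<cdot> a = m"
  proof (rule pullback_cancel[OF m(4)])
    have "(q \<cdot> i) \<cdot> a = (i' \<cdot> h1) \<cdot> a" using i by simp
    also have "\<dots> = q \<cdot> m" using eq(1) m(3) i'(1-4) h ab t' by simp
    finally show "q \<cdot> i \<cdot> a = q \<cdot> m" using i(1) q(1-8) ab by simp
    have "p \<cdot> i \<cdot> a = b \<cdot> a" using Cmp_rewr[OF i(3), of a] i(1) q(1-8) ab by simp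
    then show "p \<cdot> i \<cdot> a = p \<cdot> m" using ab ms m(2) i'(1-4) t' h q(1-8) by simp
  qed (use i(1) ab ms q m(2) t' i' in simp_all)
  then have ia: "short_exact C (i \<cdot> a) p" using m(1) by simp
  note ias = short_exactD[OF ia]
  have ts: "p \<in> Arr C" "Cod C p = Cod C b" "i \<in> Arr C" "Cod C i = Dom C p" "Dom C i = Dom C b"
    using q(1-8) h i(1) by simp_all
  \<comment> \<open>A morphism killed by \<open>i\<close> is killed by \<open>b\<close>, hence
    factors through \<open>a\<close>; but \<open>i \<cdot> a\<close> is monic.\<close>
  have "monic C i"
  proof (rule monicI)
    fix u assume u: "u \<in> Arr C" "Cod C u = Dom C i" "i \<cdot> u = Zer C (Dom C u) (Cod C i)"
    have "b \<cdot> u = Zer C (Dom C u) (Cod C b)" using Cmp_rewr[OF i(3), of u] u ts by simp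
    then obtain v where v: "v \<in> Hom C (Dom C u) (Dom C a)" "a \<cdot> v = u"
      using is_kernel_factor[OF exact_monic_kernel[OF ex(2,1)], of u] u ts ab by auto
    have "(i \<cdot> a) \<cdot> v = Zer C (Dom C v) (Cod C i)" using v u ts ab by simp
    then have "v = Zer C (Dom C v) (Dom C a)" using monicD[OF ias(5), of v] v ts ab by simp
    then have "u = a \<cdot> Zer C (Dom C v) (Dom C a)" using v by metis
    then show "u = Zer C (Dom C u) (Dom C i)" using v u(1) ts ab by simp
  qed (fact ts)
  \<comment> \<open>A morphism killing \<open>i\<close> kills \<open>i \<cdot> a\<close>, so it
    factors through the cokernel \<open>p\<close>. The factor kills \<open>p \<cdot> i = b\<close>
    and therefore factors through \<open>c\<close>.\<close>
  moreover have "is_cokernel C (c \<cdot> p) i"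
  proof (rule is_cokernelI)
    show "epic C (c \<cdot> p)" using epic_Cmp[OF ias(6) ex(4)] ts bc by simp
    show "(c \<cdot> p) \<cdot> i = Zer C (Dom C i) (Cod C (c \<cdot> p))" using ts i(3) bc by simp
    fix u assume u: "u \<in> Arr C" "Dom C u = Cod C i" "u \<cdot> i = Zer C (Dom C i) (Cod C u)"
    have "u \<cdot> i \<cdot> a = Zer C (Dom C a) (Cod C u)" using Cmp_rewr[OF u(3), of a] u ts ab by simp
    then obtain v where v: "v \<in> Hom C (Cod C p) (Cod C u)" "v \<cdot> p = u"
      using is_cokernel_factor[OF ias(8), of u] u ts ab by auto
    have "v \<cdot> b = Zer C (Dom C b) (Cod C v)" using Cmp_rewr[OF v(2), of i] i(3) u v(1) ts by simp
    then obtain w where w: "w \<in> Hom C (Cod C c) (Cod C v)" "w \<cdot> c = v"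
      using is_cokernel_factor[OF exact_epic_cokernel[OF ex(3,4)], of v] v ts bc by auto
    then show "\<exists>v. v \<in> Hom C (Cod C (c \<cdot> p)) (Cod C u) \<and> v \<cdot> c \<cdot> p = u"
      using v Cmp_rewr[OF w(2), of p] ts bc by (intro exI[of _ w]) simp
  qed (use ts bc in simp_all)
  ultimately show ?thesis
    using i(3) ia ts short_exact_cokernelI by (intro trivial2I[of i p]) auto
qed

lemma extension_2_iff:
  "extension C 2 X Y fs \<longleftrightarrow> (\<exists>a b c. fs = [a, b, c] \<and> monic C a \<and> exact C a b \<and> exact C b c \<and> epic C c \<and>
     Dom C a = Y \<and> Cod C c = X)"
  unfolding extension_def by (auto simp: length_Suc_conv numeral_2_eq_2 All_less_Suc)

lemma trivial2_extension_map:
  assumes "extension_map C 2 X Y fs gs"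
  shows "trivial2 C (fs ! 0) (fs ! 1) (fs ! 2) \<longleftrightarrow> trivial2 C (gs ! 0) (gs ! 1) (gs ! 2)"
proof -
  have "extension C 2 X Y fs" "extension C 2 X Y gs" using assms by (simp_all add: extension_map_def)
  then obtain a b c a' b' c' where f: "fs = [a, b, c]" "gs = [a', b', c']"
    and e: "monic C a" "exact C a b" "exact C b c" "epic C c"
    and e': "monic C a'" "exact C a' b'" "exact C b' c'" "epic C c'"
    and t: "Dom C a = Y" "Cod C c = X" "Dom C a' = Y" "Cod C c' = X"
    unfolding extension_2_iff by metis
  obtain h where h: "h 0 = Ide C Y" "h (Suc 2) = Ide C X" "\<And>i. i \<le> 2 \<Longrightarrow> h i \<in> Hom C (Dom C (fs ! i)) (Dom C (gs ! i)) \<and>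
             h (Suc i) \<cdot> (fs ! i) = (gs ! i) \<cdot> h i"
    using assms unfolding extension_map_def by blast
  note d = exactD[OF e(2)] exactD[OF e(3)] exactD[OF e'(2)] exactD[OF e'(3)]
  have h1: "h 1 \<in> Hom C (Dom C b) (Dom C b')" "h 2 \<in> Hom C (Cod C b) (Cod C b')"
    using h(3)[of 1] h(3)[of 2] d by (simp_all add: f)
  have "h 1 \<cdot> a = a' \<cdot> Ide C Y" "Ide C X \<cdot> c = c' \<cdot> h 2"
    using h(3)[of 0] h(3)[of 2] h(1,2) by (simp_all add: f)
  then have eq: "h 1 \<cdot> a = a'" "c' \<cdot> h 2 = c" using d t by (metis Cmp_Ide', metis Ide_Cmp')
  have eq2: "h 2 \<cdot> b = b' \<cdot> h 1" using h(3)[of 1] by (simp add: f numeral_2_eq_2)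
  note eq = eq(1) eq2 eq(2)
  have "trivial2 C a b c" if "trivial2 C a' b' c'"
    by (rule trivial2_pullback[OF e h1]) (use d t eq that in simp_all)
  moreover have "trivial2 C a' b' c'" if "trivial2 C a b c"
    using abelian_category.trivial2_pullback[OF abelian_opposite, of c' b' a' "h 2" b "h 1" c a]
      trivial2_opposite e' h1 d t eq that by simp
  ultimately show ?thesis by (auto simp: f)
qed

lemma monic_Ide: "A \<in> Obj C \<Longrightarrow> monic C (Ide C A)"
  by (rule monicI) simp_all

lemma kernel_Zer: "A \<in> Obj C \<Longrightarrow> B \<in> Obj C \<Longrightarrow> is_kernel C (Ide C A) (Zer C A B)"
  by (rule is_kernelI) (auto simp: monic_Ide)

lemma cokernel_Zer: "A \<in> Obj C \<Longrightarrow> B \<in> Obj C \<Longrightarrow> is_cokernel C (Ide C B) (Zer C A B)"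
  using abelian_category.kernel_Zer[OF abelian_opposite, of B A] by simp

lemma exact_monic_Cmp:
  assumes "exact C f g" "monic C k" "Cod C g = Dom C k"
  shows "exact C f (k \<cdot> g)"
  unfolding exact_iff
proof (intro conjI allI impI)
  note fg = exactD[OF assms(1)]
  fix u v assume u: "u \<in> Arr C" "v \<in> Arr C" "Cod C u = Dom C (k \<cdot> g)" "Dom C v = Dom C (k \<cdot> g)"
    "(k \<cdot> g) \<cdot> u = Zer C (Dom C u) (Cod C (k \<cdot> g))" "v \<cdot> f = Zer C (Dom C f) (Cod C v)"
  have "g \<cdot> u = Zer C (Dom C u) (Cod C g)" using monicD[OF assms(2), of "g \<cdot> u"] u fg assms by simp
  then show "v \<cdot> u = Zer C (Dom C u) (Cod C v)"
    using exact_vanish[OF assms(1), of u v] u fg assms by simp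
qed (use exactD[OF assms(1)] assms in simp_all)

lemma exact_Cmp_epic: "exact C f g \<Longrightarrow> epic C k \<Longrightarrow> Cod C k = Dom C f \<Longrightarrow> exact C (f \<cdot> k) g"
  using abelian_category.exact_monic_Cmp[OF abelian_opposite, of g f k] by simp

lemma is_kernel_monic_Cmp:
  assumes "is_kernel C k f" "monic C m" "Cod C f = Dom C m"
  shows "is_kernel C k (m \<cdot> f)"
  using exact_monic_kernel[OF exact_monic_Cmp[OF kernel_exact[OF assms(1)] assms(2,3)] is_kernel_monic[OF assms(1)]] .

lemma is_cokernel_Cmp_epic:
  assumes "is_cokernel C c f" "epic C e" "Cod C e = Dom C f"
  shows "is_cokernel C c (f \<cdot> e)"
  using abelian_category.is_kernel_monic_Cmp[OF abelian_opposite, of c f e] assms by simp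

lemma Ext_zero_2_split:
  assumes "X \<in> Obj C" "Y \<in> Obj C" "Ext_zero C 2 X Y"
  shows "Ext2_split C X Y"
  unfolding Ext2_split_def
proof (intro allI impI)
  fix a b k c assume *: "short_exact C a b \<and> short_exact C k c \<and> Dom C a = Y \<and> Cod C c = X \<and> Cod C b = Dom C k"
  then have se: "short_exact C a b" "short_exact C k c" by auto
  note s = short_exactD[OF se(1)] and s' = short_exactD[OF se(2)]
  have kb: "exact C a (k \<cdot> b)" by (rule exact_monic_Cmp[OF kernel_exact[OF s(7)] s'(5)]) (use * in simp)
  have kc: "exact C (k \<cdot> b) c" by (rule exact_Cmp_epic[OF kernel_exact[OF s'(7)] s(6)]) (use * in simp)
  have e1: "extension C 2 X Y [a, k \<cdot> b, c]" unfolding extension_2_iff using kb kc s s' * by simp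
  obtain S i j p q where b: "biproduct C Y X S i j p q" using ex_biproduct assms by blast
  note bs = biproductD[OF b]
  have "biproduct C X Y S j i q p" using b Add_commute[of "i \<cdot> p" "j \<cdot> q"] bs by (simp add: biproduct_def)
  then have se2: "short_exact C i q" "short_exact C j p" using biproduct_short_exact b by blast+
  \<comment> \<open>The starting point of the zigzag is the extension with two identities around a
    zero map; the biproduct of \<open>Y\<close> and \<open>X\<close> is its filtered object.\<close>
  let ?z = "Zer C Y X"
  have ides: "monic C (Ide C Y)" "epic C (Ide C X)"
    using is_kernel_monic[OF kernel_Zer, of Y X] is_cokernel_epic[OF cokernel_Zer, of Y X] assms by simp_all
  have ex1: "exact C (Ide C Y) ?z" "exact C ?z (Ide C X)"
    using kernel_exact[OF kernel_Zer, of Y X] cokernel_exact[OF cokernel_Zer, of Y X] assms by simp_all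
  have e2: "extension C 2 X Y [Ide C Y, ?z, Ide C X]"
    unfolding extension_2_iff using assms(1,2) ides ex1 by simp
  have tr: "trivial2 C (Ide C Y) ?z (Ide C X)"
    by (rule trivial2I[of i q]) (use assms(1,2) bs se2 in simp_all)
  show "trivial2 C a (k \<cdot> b) c"
    using Ext_zero_invariant[where P = "\<lambda>fs. trivial2 C (fs ! 0) (fs ! 1) (fs ! 2)", OF assms(3) e2 e1]
      tr trivial2_extension_map by simp
qed

text \<open>Pushing out along \<open>u\<close> gives an extension of \<open>X\<close> by
  \<open>Z\<close>. It splits, and its retraction composed with the pushout map extends
  \<open>u\<close>.\<close>

lemma extend_short_exact:
  assumes "Ext1_split C X Z" "short_exact C a b" "Cod C b = X" "u \<in> Hom C (Dom C a) Z"
  obtains e where "e \<in> Hom C (Cod C a) Z" "e \<cdot> a = u"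
proof -
  note s = short_exactD[OF assms(2)]
  obtain a' b' h' where p: "short_exact C a' b'" "Cod C b' = Cod C b" "b' \<cdot> h' = b" "pullback (opposite C) a u h' a'"
    using short_exact_pushout[OF assms(2), of u] assms s by (metis Hom_iff)
  note p' = abelian_category.pullbackD[OF abelian_opposite p(4), simplified]
  have Z: "Dom C a' = Z" using p' assms by simp
  then obtain r where r: "r \<in> Hom C (Cod C a') Z" "r \<cdot> a' = Ide C Z"
    using assms(1,3) p unfolding Ext1_split_def by blast
  have "(r \<cdot> h') \<cdot> a = r \<cdot> a' \<cdot> u" using r p' assms Z by simp
  also have "\<dots> = u" using Cmp_rewr[OF r(2), of u] r p' assms Z by simp
  finally show thesis using that[of "r \<cdot> h'"] r p' assms Z by simp
qed

lemma lift_short_exact: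
  assumes "Ext1_split C Z X" "short_exact C a b" "Dom C a = X" "u \<in> Hom C Z (Cod C b)"
  obtains e where "e \<in> Hom C Z (Dom C b)" "b \<cdot> e = u"
  using abelian_category.extend_short_exact[OF abelian_opposite, of X Z b a u] assms by auto

text \<open>Since \<open>u\<close> kills \<open>g\<close>, it factors through the cokernel of
  \<open>g\<close>, which is the image of \<open>f\<close>. From there it extends along the short
  exact sequence ending in the cokernel of \<open>f\<close>.\<close>

lemma extend_exact:
  assumes "exact C g f" "is_cokernel C c f" "Ext1_split C (Cod C c) Z" "u \<in> Hom C (Dom C f) Z"
    "u \<cdot> g = Zer C (Dom C g) Z"
  obtains e where "e \<in> Hom C (Cod C f) Z" "e \<cdot> f = u"
proof -
  note gf = exactD[OF assms(1)]
  obtain c0 where c0: "is_cokernel C c0 g" using ex_cokernel gf by blast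
  note c0s = is_cokernelD[OF c0]
  obtain m where m: "m \<in> Hom C (Cod C c0) (Cod C f)" "m \<cdot> c0 = f" "short_exact C m c"
    using exact_cokernel_short_exact[OF assms(1) c0 assms(2)] by blast
  obtain u' where u': "u' \<in> Hom C (Cod C c0) Z" "u' \<cdot> c0 = u"
    using is_cokernel_factor[OF c0, of u] assms gf by auto
  obtain e where e: "e \<in> Hom C (Cod C m) Z" "e \<cdot> m = u'"
    using extend_short_exact[OF assms(3) m(3)] u' m by auto
  have "e \<cdot> f = u" using Cmp_rewr[OF e(2), of c0] e m u' c0s gf by simp
  then show thesis using that e m by simp
qed

lemma lift_exact:
  assumes "exact C f g" "is_kernel C k f" "Ext1_split C Z (Dom C k)" "u \<in> Hom C Z (Cod C f)"
    "g \<cdot> u = Zer C Z (Cod C g)"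
  obtains e where "e \<in> Hom C Z (Dom C f)" "f \<cdot> e = u"
  using abelian_category.extend_exact[OF abelian_opposite, of g f k Z u] assms by auto

end

section \<open>Cotorsion pairs and the horseshoe step\<close>

text \<open>The form in which hereditary complete cotorsion pairs are used: only \<open>Ext\<^sup>1\<close> and \<open>Ext\<^sup>2\<close> matter, and
  the notion is self-dual.\<close>

definition hered_cotorsion :: "('o, 'm) lincat \<Rightarrow> 'o set \<Rightarrow> 'o set \<Rightarrow> bool" where
  "hered_cotorsion C \<X> \<Y> \<longleftrightarrow>
    \<X> = {A \<in> Obj C. \<forall>B\<in>\<Y>. Ext1_split C A B} \<and> \<Y> = {B \<in> Obj C. \<forall>A\<in>\<X>. Ext1_split C A B} \<and>
    (\<forall>A\<in>\<X>. \<forall>B\<in>\<Y>. Ext2_split C A B) \<and> complete_pair C \<X> \<Y>"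

context abelian_category
begin

lemma hered_cotorsionD:
  assumes "hered_cotorsion C \<X> \<Y>"
  shows "A \<in> \<X> \<Longrightarrow> A \<in> Obj C" "B \<in> \<Y> \<Longrightarrow> B \<in> Obj C"
    "A \<in> \<X> \<Longrightarrow> B \<in> \<Y> \<Longrightarrow> Ext1_split C A B" "A \<in> \<X> \<Longrightarrow> B \<in> \<Y> \<Longrightarrow> Ext2_split C A B"
    "A \<in> Obj C \<Longrightarrow> (\<And>B. B \<in> \<Y> \<Longrightarrow> Ext1_split C A B) \<Longrightarrow> A \<in> \<X>"
  using assms unfolding hered_cotorsion_def by blast+

lemma complete_pair_oppositeI:
  assumes "complete_pair C \<X> \<Y>" shows "complete_pair (opposite C) \<Y> \<X>"
  unfolding complete_pair_def
proof (intro ballI conjI)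
  fix A assume "A \<in> Obj (opposite C)"
  then obtain f g f' g' where "short_exact C f g" "Dom C f \<in> \<Y>" "Cod C f \<in> \<X>" "Cod C g = A"
    and "short_exact C f' g'" "Dom C f' = A" "Cod C f' \<in> \<Y>" "Cod C g' \<in> \<X>"
    using assms unfolding complete_pair_def by auto
  then show "\<exists>f g. short_exact (opposite C) f g \<and> Dom (opposite C) f \<in> \<X> \<and> Cod (opposite C) f \<in> \<Y> \<and> Cod (opposite C) g = A"
    and "\<exists>f g. short_exact (opposite C) f g \<and> Dom (opposite C) f = A \<and> Cod (opposite C) f \<in> \<X> \<and> Cod (opposite C) g \<in> \<Y>"
    using short_exactD(3)[of f g] short_exactD(3)[of f' g'] by auto
qed

lemma complete_pair_opposite [simp]: "complete_pair (opposite C) \<Y> \<X> = complete_pair C \<X> \<Y>"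
  using complete_pair_oppositeI abelian_category.complete_pair_oppositeI[OF abelian_opposite, of \<Y> \<X>] by auto

lemma hered_cotorsion_opposite [simp]: "hered_cotorsion (opposite C) \<Y> \<X> = hered_cotorsion C \<X> \<Y>"
  unfolding hered_cotorsion_def by auto

lemma pullback_swap: "pullback C f g p q \<Longrightarrow> pullback C g f q p"
  unfolding pullback_def[of C g f q p]
proof (intro conjI allI impI)
  assume pb: "pullback C f g p q"
  note p = pullbackD[OF pb]
  show "g \<cdot> q = f \<cdot> p" "Dom C q = Dom C p" "Cod C g = Cod C f" using p by simp_all
  fix u v assume uv: "u \<in> Arr C" "v \<in> Arr C" "Cod C u = Dom C g" "Cod C v = Dom C f" "Dom C u = Dom C v"
    "g \<cdot> u = f \<cdot> v"
  have "\<exists>!w. w \<in> Hom C (Dom C u) (Dom C p) \<and> p \<cdot> w = v \<and> q \<cdot> w = u"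
    by (rule pullback_ex1[OF pb]) (use uv in simp_all)
  then show "\<exists>!w. w \<in> Hom C (Dom C v) (Dom C q) \<and> q \<cdot> w = u \<and> p \<cdot> w = v"
    unfolding uv(5) p(6) by (simp only: conj_commute conj_left_commute)
qed (auto dest: pullbackD)

lemma pullback_monic:
  assumes "pullback C f g p q" "monic C g" shows "monic C p"
proof (rule monicI)
  note p = pullbackD[OF assms(1)]
  fix u assume u: "u \<in> Arr C" "Cod C u = Dom C p" "p \<cdot> u = Zer C (Dom C u) (Cod C p)"
  have "g \<cdot> q \<cdot> u = Zer C (Dom C u) (Cod C g)" using Cmp_rewr[OF p(9), of u] u p(1-8) by simp
  then have "q \<cdot> u = Zer C (Dom C u) (Cod C q)" using monicD[OF assms(2), of "q \<cdot> u"] u p(1-8) by simp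
  then show "u = Zer C (Dom C u) (Dom C p)"
    using u p(1-8) by (rule_tac pullback_cancel[OF assms(1)]) simp_all
qed (use pullbackD[OF assms(1)] in simp)

lemma pullback_kernel:
  assumes "pullback C f g p q" "is_kernel C g b"
  shows "is_kernel C p (b \<cdot> f)"
proof (rule is_kernelI)
  note p = pullbackD[OF assms(1)] and g = is_kernelD[OF assms(2)]
  show "monic C p" using pullback_monic[OF assms(1) is_kernel_monic[OF assms(2)]] .
  show "(b \<cdot> f) \<cdot> p = Zer C (Dom C p) (Cod C (b \<cdot> f))" using p g Cmp_rewr[OF g(4), of q] by simp
  fix u assume u: "u \<in> Arr C" "Cod C u = Dom C (b \<cdot> f)" "(b \<cdot> f) \<cdot> u = Zer C (Dom C u) (Cod C (b \<cdot> f))"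
  obtain v where v: "v \<in> Hom C (Dom C u) (Dom C g)" "g \<cdot> v = f \<cdot> u"
  proof (rule is_kernel_factor[OF assms(2), of "f \<cdot> u"])
    show "b \<cdot> f \<cdot> u = Zer C (Dom C (f \<cdot> u)) (Cod C b)" using u p(1-8) g(1-3) by simp
  qed (use u p(1-8) g(1-3) in simp_all)
  obtain w where "w \<in> Hom C (Dom C v) (Dom C p)" "p \<cdot> w = u" "q \<cdot> w = v"
    by (rule pullback_factor[OF assms(1), of u v]) (use u v p(1-8) g(1-3) in simp_all)
  then show "\<exists>v. v \<in> Hom C (Dom C u) (Dom C p) \<and> p \<cdot> v = u" using v by auto
qed (use pullbackD[OF assms(1)] is_kernelD[OF assms(2)] in simp_all)

section \<open>Closure properties of the two classes\<close>

lemma Ext1_splitI: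
  assumes "\<And>a b. short_exact C a b \<Longrightarrow> Dom C a = Y \<Longrightarrow> Cod C b = X \<Longrightarrow>
    \<exists>r. r \<in> Hom C (Cod C a) Y \<and> r \<cdot> a = Ide C Y"
  shows "Ext1_split C X Y"
  using assms unfolding Ext1_split_def by (simp del: Hom_iff) blast

text \<open>Replaces the exact sequence of Ext. The extension is restricted to the subobject
  \<open>Dom C a\<close> and split there by \<open>r\<close>. The inclusion \<open>h\<close> of the
  restricted extension has cokernel \<open>Cod C b\<close>, so \<open>r\<close> extends along
  \<open>h\<close> to a retraction of the whole.\<close>

lemma Ext1_split_middle:
  assumes "short_exact C a b" "Ext1_split C (Dom C a) Y" "Ext1_split C (Cod C b) Y"
  shows "Ext1_split C (Cod C a) Y"
proof (rule Ext1_splitI)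
  note s = short_exactD[OF assms(1)]
  fix m e assume me: "short_exact C m e" "Dom C m = Y" "Cod C e = Cod C a"
  note ms = short_exactD[OF me(1)]
  obtain m' e' h where p: "short_exact C m' e'" "Dom C m' = Dom C m" "h \<cdot> m' = m" "pullback C e a h e'"
    using short_exact_pullback[OF me(1) s(1)] me by metis
  note ps = pullbackD[OF p(4)] and m's = short_exactD[OF p(1)]
  obtain r where r: "r \<in> Hom C (Cod C m') Y" "r \<cdot> m' = Ide C Y"
    using assms(2) p me ps unfolding Ext1_split_def by metis
  have "short_exact C h (b \<cdot> e)"
    using pullback_kernel[OF p(4) s(7)] epic_Cmp[OF ms(6) s(6)] me s by (intro short_exact_kernelI) simp_all
  then obtain w where w: "w \<in> Hom C (Cod C h) Y" "w \<cdot> h = r"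
    using extend_short_exact[OF assms(3), of h "b \<cdot> e" r] r ps me s m's by auto
  have "w \<cdot> m = r \<cdot> m'" using Cmp_rewr[OF w(2), of m'] p(3) w(1) ps(1-8) m's(1-3) by simp
  then show "\<exists>r. r \<in> Hom C (Cod C m) Y \<and> r \<cdot> m = Ide C Y" using r w ps ms by auto
qed

text \<open>Splicing an extension of \<open>Dom C a\<close> with the given sequence produces a
  two-fold extension of \<open>Cod C b\<close> by \<open>Y\<close>. Its filtered object is an
  extension of \<open>Cod C a\<close> by \<open>Y\<close>, hence split, and restriction of the
  retraction along \<open>i\<close> splits the original extension.\<close>

lemma Ext1_split_kernel:
  assumes "short_exact C a b" "Ext1_split C (Cod C a) Y" "Ext2_split C (Cod C b) Y"
  shows "Ext1_split C (Dom C a) Y"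
proof (rule Ext1_splitI)
  note s = short_exactD[OF assms(1)]
  fix m e assume me: "short_exact C m e" "Dom C m = Y" "Cod C e = Dom C a"
  note ms = short_exactD[OF me(1)]
  have "trivial2 C m (a \<cdot> e) b" using assms(1,3) me unfolding Ext2_split_def by blast
  then obtain i p where i: "i \<in> Arr C" "p \<in> Arr C" "Dom C i = Dom C (a \<cdot> e)" "Cod C i = Dom C p"
    "Cod C p = Cod C (a \<cdot> e)" "short_exact C (i \<cdot> m) p" unfolding trivial2_def by blast
  have "Dom C (i \<cdot> m) = Y" "Cod C p = Cod C a" using i(1-5) s(1-3) me(2,3) ms(1-3) by simp_all
  then obtain r where r: "r \<in> Hom C (Cod C (i \<cdot> m)) Y" "r \<cdot> i \<cdot> m = Ide C Y"
    using assms(2) i(6) unfolding Ext1_split_def by metis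
  then show "\<exists>r. r \<in> Hom C (Cod C m) Y \<and> r \<cdot> m = Ide C Y"
    using i(1-5) s(1-3) me(2,3) ms(1-3) by (intro exI[of _ "r \<cdot> i"]) simp
qed

lemma hered_cotorsion_left_middle:
  assumes "hered_cotorsion C \<X> \<Y>" "short_exact C a b" "Dom C a \<in> \<X>" "Cod C b \<in> \<X>"
  shows "Cod C a \<in> \<X>"
  using hered_cotorsionD[OF assms(1)] Ext1_split_middle[OF assms(2)] assms(3,4) short_exactD(1)[OF assms(2)]
  by (metis Cod_Obj)

lemma hered_cotorsion_left_kernel:
  assumes "hered_cotorsion C \<X> \<Y>" "short_exact C a b" "Cod C a \<in> \<X>" "Cod C b \<in> \<X>"
  shows "Dom C a \<in> \<X>"
  using hered_cotorsionD[OF assms(1)] Ext1_split_kernel[OF assms(2)] assms(3,4) short_exactD(1)[OF assms(2)]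
  by (metis Dom_Obj)

lemma hered_cotorsion_right_middle:
  assumes "hered_cotorsion C \<X> \<Y>" "short_exact C a b" "Dom C a \<in> \<Y>" "Cod C b \<in> \<Y>"
  shows "Cod C a \<in> \<Y>"
  using abelian_category.hered_cotorsion_left_middle[OF abelian_opposite, of \<Y> \<X> b a] assms short_exactD[OF assms(2)]
  by simp

lemma zero_objectD:
  assumes "zero_object C Z"
  shows "Z \<in> Obj C" "f \<in> Hom C A Z \<Longrightarrow> f = Zer C A Z" "f \<in> Hom C Z A \<Longrightarrow> f = Zer C Z A"
proof -
  show Z: "Z \<in> Obj C" using assms by (simp add: zero_object_def)
  show "f = Zer C A Z" if "f \<in> Hom C A Z"
    using assms that Hom_Obj[OF that] unfolding zero_object_def by (metis Hom_iff Zer_simps)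
  show "f = Zer C Z A" if "f \<in> Hom C Z A"
    using assms that Hom_Obj[OF that] unfolding zero_object_def by (metis Hom_iff Zer_simps)
qed

text \<open>Viewing an isomorphism as a short exact sequence with zero cokernel makes invariance
  under isomorphism a case of closure under extensions.\<close>

lemma iso_short_exact:
  assumes "zero_object C Z" "v \<in> Hom C A B" "w \<in> Hom C B A" "v \<cdot> w = Ide C B" "w \<cdot> v = Ide C A"
  shows "short_exact C v (Zer C B Z)"
proof (rule short_exact_kernelI)
  have o: "A \<in> Obj C" "B \<in> Obj C" "Z \<in> Obj C"
    using Hom_Obj[OF assms(2)] zero_objectD[OF assms(1)] by auto
  show "is_kernel C v (Zer C B Z)"
  proof (rule is_kernelI)
    show "monic C v"
    proof (rule monicI)
      fix u assume u: "u \<in> Arr C" "Cod C u = Dom C v" "v \<cdot> u = Zer C (Dom C u) (Cod C v)"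
      then show "u = Zer C (Dom C u) (Dom C v)" using Cmp_rewr[OF assms(5), of u] assms(2,3) by simp
    qed (use assms in simp)
    fix u assume u: "u \<in> Arr C" "Cod C u = Dom C (Zer C B Z)"
    then show "\<exists>z. z \<in> Hom C (Dom C u) (Dom C v) \<and> v \<cdot> z = u"
      using Cmp_rewr[OF assms(4), of u] assms(2,3) o by (intro exI[of _ "w \<cdot> u"]) simp
  qed (use assms o in simp_all)
  show "epic C (Zer C B Z)"
  proof (rule epicI)
    fix u assume "u \<in> Arr C" "Dom C u = Cod C (Zer C B Z)"
    then show "u = Zer C (Cod C (Zer C B Z)) (Cod C u)" using zero_objectD(3)[OF assms(1), of u "Cod C u"] o by simp
  qed (use o in simp)
qed

lemma hered_cotorsion_left_zero:
  assumes "hered_cotorsion C \<X> \<Y>" "zero_object C Z" shows "Z \<in> \<X>"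
proof (rule hered_cotorsionD(5)[OF assms(1) zero_objectD(1)[OF assms(2)]])
  fix B assume "B \<in> \<Y>"
  show "Ext1_split C Z B"
  proof (rule Ext1_splitI)
    fix a b assume ab: "short_exact C a b" "Dom C a = B" "Cod C b = Z"
    note s = short_exactD[OF ab(1)]
    have Z: "Z \<in> Obj C" using zero_objectD(1)[OF assms(2)] .
    have "b \<cdot> Zer C Z (Dom C b) = Ide C Z"
      using zero_objectD(2)[OF assms(2), of "Ide C Z" Z] Z s(1-3) ab by simp
    then have "\<exists>t \<in> Hom C (Cod C b) (Dom C b). b \<cdot> t = Ide C (Cod C b)"
      using s(1-3) ab Z by (intro bexI[of _ "Zer C Z (Dom C b)"]) simp_all
    then show "\<exists>r. r \<in> Hom C (Cod C a) B \<and> r \<cdot> a = Ide C B"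
      using short_exact_retract_iff[OF ab(1)] ab by blast
  qed
qed

lemma hered_cotorsion_right_zero:
  assumes "hered_cotorsion C \<X> \<Y>" "zero_object C Z" shows "Z \<in> \<Y>"
  using abelian_category.hered_cotorsion_left_zero[OF abelian_opposite, of \<Y> \<X> Z] assms by simp

lemma hered_cotorsion_left_iso:
  assumes "hered_cotorsion C \<X> \<Y>" "v \<in> Hom C A B" "w \<in> Hom C B A" "v \<cdot> w = Ide C B" "w \<cdot> v = Ide C A" "A \<in> \<X>"
  shows "B \<in> \<X>"
proof -
  obtain Z where Z: "zero_object C Z" using ex_zero_object by blast
  have "B \<in> Obj C" using Hom_Obj[OF assms(2)] by simp
  then show ?thesis
    using hered_cotorsion_left_middle[OF assms(1) iso_short_exact[OF Z assms(2-5)]]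
      hered_cotorsion_left_zero[OF assms(1) Z] zero_objectD(1)[OF Z] assms by simp
qed

lemma hered_cotorsion_right_iso:
  assumes "hered_cotorsion C \<X> \<Y>" "v \<in> Hom C A B" "w \<in> Hom C B A" "v \<cdot> w = Ide C B" "w \<cdot> v = Ide C A" "A \<in> \<Y>"
  shows "B \<in> \<Y>"
  using abelian_category.hered_cotorsion_left_iso[OF abelian_opposite, of \<Y> \<X> w A B v] assms by simp

text \<open>The definitions of fibration and resolution provide one kernel with the required
  property; since kernels are isomorphic, every kernel has it.\<close>

lemma hered_cotorsion_kernel:
  assumes "hered_cotorsion C \<X> \<Y>" "is_kernel C k f" "is_kernel C k' f" "Dom C k \<in> \<Y>"
  shows "Dom C k' \<in> \<Y>"
proof -
  note k = is_kernelD[OF assms(2)] and k' = is_kernelD[OF assms(3)]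
  obtain v where v: "v \<in> Hom C (Dom C k) (Dom C k')" "k' \<cdot> v = k"
    using is_kernel_factor[OF assms(3), of k] k by auto
  obtain w where w: "w \<in> Hom C (Dom C k') (Dom C k)" "k \<cdot> w = k'"
    using is_kernel_factor[OF assms(2), of k'] k' by auto
  have "k' \<cdot> v \<cdot> w = k' \<cdot> Ide C (Dom C k')" using Cmp_rewr[OF v(2), of w] v w k(1-3) k'(1-3) by simp
  then have vw: "v \<cdot> w = Ide C (Dom C k')"
    using monic_cancel[OF is_kernel_monic[OF assms(3)], of "v \<cdot> w" "Ide C (Dom C k')"] v w k(1-3) k'(1-3) by simp
  have "k \<cdot> w \<cdot> v = k \<cdot> Ide C (Dom C k)" using Cmp_rewr[OF w(2), of v] v w k(1-3) k'(1-3) by simp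
  then have "w \<cdot> v = Ide C (Dom C k)"
    using monic_cancel[OF is_kernel_monic[OF assms(2)], of "w \<cdot> v" "Ide C (Dom C k)"] v w k(1-3) k'(1-3) by simp
  then show ?thesis using hered_cotorsion_right_iso[OF assms(1) v(1) w(1) vw _ assms(4)] by blast
qed

lemma hered_cotorsion_cokernel:
  assumes "hered_cotorsion C \<X> \<Y>" "is_cokernel C c f" "is_cokernel C c' f" "Cod C c \<in> \<X>"
  shows "Cod C c' \<in> \<X>"
  using abelian_category.hered_cotorsion_kernel[OF abelian_opposite, of \<Y> \<X> c f c'] assms by simp

text \<open>With \<open>P\<close> the pullback of \<open>q2\<close> along \<open>g\<close>, the middle object is obtained by applying the
  hypothesis on \<open>Ext\<^sup>2\<close> to \<open>Dom k \<rightarrow> Dom q \<rightarrow> P \<rightarrow> Dom q2\<close>.\<close>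

lemma horseshoe_step:
  assumes fg: "short_exact C f g" and kq: "short_exact C k q" "Cod C q = Dom C f"
    and kq2: "short_exact C k2 q2" "Cod C q2 = Cod C g"
    and ext: "Ext2_split C (Dom C q2) (Dom C k)"
  obtains k1 q1 \<alpha> \<beta> \<kappa> \<mu> where "short_exact C k1 q1" "Cod C q1 = Cod C f" "short_exact C \<alpha> \<beta>" "short_exact C \<kappa> \<mu>"
    "Dom C \<alpha> = Dom C q" "Cod C \<alpha> = Dom C q1" "Cod C \<beta> = Dom C q2"
    "Dom C \<kappa> = Dom C k" "Cod C \<kappa> = Dom C k1" "Cod C \<mu> = Dom C k2"
    "f \<cdot> q = q1 \<cdot> \<alpha>" "g \<cdot> q1 = q2 \<cdot> \<beta>" "k1 \<cdot> \<kappa> = \<alpha> \<cdot> k" "k2 \<cdot> \<mu> = \<beta> \<cdot> k1"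
proof -
  note s = short_exactD[OF fg] and s0 = short_exactD[OF kq(1)] and s2 = short_exactD[OF kq2(1)]
  obtain f' p h where pb: "short_exact C f' p" "Dom C f' = Dom C f" "h \<cdot> f' = f" "pullback C g q2 h p"
    and he: "epic C q2 \<Longrightarrow> epic C h"
    using short_exact_pullback[OF fg s2(2)] kq2 by metis
  have he: "epic C h" using he s2 by simp
  note p = pullbackD[OF pb(4)] and f's = short_exactD[OF pb(1)]
  obtain l where l: "short_exact C l h" "Dom C l = Dom C k2" "p \<cdot> l = k2"
    using pullback_short_exact[OF kq2(1) pullback_swap[OF pb(4)] he] by metis
  note ls = short_exactD[OF l(1)]
  have "trivial2 C k (f' \<cdot> q) p" using ext kq pb(1,2) p f's unfolding Ext2_split_def by metis
  then obtain i \<pi> where i: "i \<in> Arr C" "\<pi> \<in> Arr C" "Dom C i = Dom C (f' \<cdot> q)" "Cod C i = Dom C \<pi>"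
     "Cod C \<pi> = Cod C (f' \<cdot> q)" "\<pi> \<cdot> i = f' \<cdot> q" "short_exact C i (p \<cdot> \<pi>)" "short_exact C (i \<cdot> k) \<pi>"
    unfolding trivial2_def by blast
  have t: "f' \<in> Arr C" "p \<in> Arr C" "h \<in> Arr C" "Dom C f' = Dom C f" "Cod C f' = Dom C p" "Dom C h = Dom C p"
    "Cod C h = Cod C f" "Cod C p = Dom C q2" "Dom C l = Dom C k2" "Cod C l = Dom C p" "l \<in> Arr C"
    "Dom C i = Dom C q" "Cod C \<pi> = Dom C p" "f \<in> Arr C" "g \<in> Arr C" "Cod C f = Dom C g"
    "k \<in> Arr C" "q \<in> Arr C" "k2 \<in> Arr C" "q2 \<in> Arr C" "Cod C k = Dom C q" "Cod C k2 = Dom C q2"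
    "Cod C q = Dom C f" "Cod C q2 = Cod C g" "i \<in> Arr C" "\<pi> \<in> Arr C" "Cod C i = Dom C \<pi>"
    using p f's(1-3) s(1-3) s0(1-3) s2(1-3) i(1-5) l(2) ls(1-3) kq(2) kq2(2) pb(2) by simp_all
  note \<pi>s = short_exactD[OF i(8)]
  have q1e: "epic C (h \<cdot> \<pi>)" using epic_Cmp[OF \<pi>s(6) he] t by simp
  obtain k1 where k1: "is_kernel C k1 (h \<cdot> \<pi>)" using ex_kernel t by (metis Cmp_simps(1))
  have k1s: "k1 \<in> Arr C" "Cod C k1 = Dom C \<pi>" "h \<cdot> \<pi> \<cdot> k1 = Zer C (Dom C k1) (Cod C f)"
    using is_kernelD[OF k1] t by simp_all
  have e1: "h \<cdot> \<pi> \<cdot> i = f \<cdot> q" using Cmp_rewr[OF pb(3), of q] i(6) t by simp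
  have e2: "g \<cdot> h \<cdot> \<pi> = q2 \<cdot> p \<cdot> \<pi>" using Cmp_rewr[OF p(9), of \<pi>] t by simp
  have "(h \<cdot> \<pi>) \<cdot> i \<cdot> k = (h \<cdot> \<pi> \<cdot> i) \<cdot> k" using t by simp
  also have "\<dots> = Zer C (Dom C k) (Cod C f)" unfolding e1 using t s0(4) by simp
  finally obtain \<kappa> where \<kappa>: "\<kappa> \<in> Hom C (Dom C k) (Dom C k1)" "k1 \<cdot> \<kappa> = i \<cdot> k"
    using is_kernel_factor[OF k1, of "i \<cdot> k"] t by auto
  obtain \<mu> where \<mu>: "\<mu> \<in> Hom C (Dom C k1) (Dom C l)" "l \<cdot> \<mu> = \<pi> \<cdot> k1"
    using is_kernel_factor[OF ls(7), of "\<pi> \<cdot> k1"] t k1s by auto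
  have e3: "k2 \<cdot> \<mu> = p \<cdot> \<pi> \<cdot> k1" using Cmp_rewr[OF l(3), of \<mu>] \<mu> t by simp
  \<comment> \<open>The kernel of \<open>h \<cdot> \<pi>\<close> is the preimage under
    \<open>\<pi>\<close> of the kernel \<open>l\<close> of \<open>h\<close>, and
    \<open>Dom C l = Dom C k2\<close>. So \<open>\<mu>\<close> is \<open>\<pi>\<close> restricted to
    this preimage, and its kernel is that of \<open>\<pi>\<close>, namely
    \<open>i \<cdot> k\<close>.\<close>
  have "is_kernel C \<kappa> \<mu>"
  proof (rule is_kernelI)
    show "monic C \<kappa>"
    proof (rule monicI)
      fix u assume u: "u \<in> Arr C" "Cod C u = Dom C \<kappa>" "\<kappa> \<cdot> u = Zer C (Dom C u) (Cod C \<kappa>)"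
      have "(i \<cdot> k) \<cdot> u = Zer C (Dom C u) (Cod C i)" using Cmp_rewr[OF \<kappa>(2), of u] u \<kappa>(1) t k1s by simp
      then show "u = Zer C (Dom C u) (Dom C \<kappa>)" using monicD[OF \<pi>s(5), of u] u \<kappa>(1) t by simp
    qed (use \<kappa> in simp)
    have "l \<cdot> \<mu> \<cdot> \<kappa> = \<pi> \<cdot> i \<cdot> k" using Cmp_rewr[OF \<mu>(2), of \<kappa>] \<mu>(1) \<kappa> t k1s by simp
    also have "\<dots> = Zer C (Dom C k) (Cod C \<pi>)" using \<pi>s(4) t by simp
    finally show "\<mu> \<cdot> \<kappa> = Zer C (Dom C \<kappa>) (Cod C \<mu>)" using monicD[OF ls(5), of "\<mu> \<cdot> \<kappa>"] \<mu>(1) \<kappa>(1) t by simp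
    fix u assume u: "u \<in> Arr C" "Cod C u = Dom C \<mu>" "\<mu> \<cdot> u = Zer C (Dom C u) (Cod C \<mu>)"
    have "\<pi> \<cdot> k1 \<cdot> u = Zer C (Dom C u) (Cod C \<pi>)" using Cmp_rewr[OF \<mu>(2), of u] u \<mu>(1) t k1s by simp
    then obtain v where v: "v \<in> Hom C (Dom C u) (Dom C k)" "i \<cdot> k \<cdot> v = k1 \<cdot> u"
      using is_kernel_factor[OF \<pi>s(7), of "k1 \<cdot> u"] u \<mu>(1) t k1s by auto
    have "k1 \<cdot> \<kappa> \<cdot> v = k1 \<cdot> u" using Cmp_rewr[OF \<kappa>(2), of v] v \<kappa>(1) t k1s by simp
    then have "\<kappa> \<cdot> v = u" using monic_cancel[OF is_kernel_monic[OF k1], of "\<kappa> \<cdot> v" u] v u \<kappa>(1) \<mu>(1) k1s by simp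
    then show "\<exists>v. v \<in> Hom C (Dom C u) (Dom C \<kappa>) \<and> \<kappa> \<cdot> v = u" using v \<kappa>(1) by auto
  qed (use \<mu> \<kappa> in simp_all)
  moreover have "epic C \<mu>"
  proof (rule epicI)
    fix u assume u: "u \<in> Arr C" "Dom C u = Cod C \<mu>" "u \<cdot> \<mu> = Zer C (Dom C \<mu>) (Cod C u)"
    obtain z x where zx: "epic C z" "x \<in> Hom C (Dom C z) (Dom C \<pi>)" "Cod C z = Dom C l" "\<pi> \<cdot> x = l \<cdot> z"
      using epic_cover[OF \<pi>s(6), of l] t by auto
    have "h \<cdot> \<pi> \<cdot> x = Zer C (Dom C x) (Cod C h)" using zx Cmp_rewr[OF ls(4), of z] t by simp
    then obtain y where y: "y \<in> Hom C (Dom C z) (Dom C k1)" "k1 \<cdot> y = x"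
      using is_kernel_factor[OF k1, of x] zx t by auto
    have "l \<cdot> \<mu> \<cdot> y = l \<cdot> z" using Cmp_rewr[OF \<mu>(2), of y] y zx \<mu>(1) t k1s by simp
    then have "\<mu> \<cdot> y = z" using monic_cancel[OF ls(5), of "\<mu> \<cdot> y" z] y zx \<mu>(1) by simp
    then have "u \<cdot> z = Zer C (Dom C z) (Cod C u)" using Cmp_rewr[OF u(3), of y] y u \<mu>(1) by simp
    then show "u = Zer C (Cod C \<mu>) (Cod C u)" using epicD[OF zx(1), of u] u zx \<mu>(1) by simp
  qed (use \<mu> in simp)
  ultimately have "short_exact C \<kappa> \<mu>" by (rule short_exact_kernelI)
  then show thesis
    using that[of k1 "h \<cdot> \<pi>" i "p \<cdot> \<pi>" \<kappa> \<mu>] short_exact_kernelI[OF k1 q1e] i(7) e1 e2 e3 t k1s \<kappa> \<mu> by simp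
qed

end

section \<open>One-sided resolutions\<close>

definition half_resolution ::
  "('o, 'm) lincat \<Rightarrow> 'o set \<Rightarrow> 'o set \<Rightarrow> 'o \<Rightarrow> (nat \<Rightarrow> 'o) \<Rightarrow> (nat \<Rightarrow> 'm) \<Rightarrow> 'm \<Rightarrow> bool" where
  "half_resolution C \<X> \<Y> A q d e \<longleftrightarrow>
    e \<in> Hom C (q 0) A \<and> (\<forall>i. d i \<in> Hom C (q (Suc i)) (q i)) \<and> epic C e \<and>
    exact C (d 0) e \<and> (\<forall>i. exact C (d (Suc i)) (d i)) \<and> (\<forall>i. q i \<in> \<X>) \<and>
    (\<exists>k. is_kernel C k e \<and> Dom C k \<in> \<Y>) \<and> (\<forall>i. \<exists>k. is_kernel C k (d i) \<and> Dom C k \<in> \<Y>)"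

text \<open>A half resolution cut into short exact sequences: \<open>k i\<close> is the inclusion of
  a syzygy and \<open>p (Suc i)\<close> covers it. Recursive constructions only see the current
  syzygy, which this form exposes.\<close>

definition syzygies ::
  "('o, 'm) lincat \<Rightarrow> 'o set \<Rightarrow> 'o set \<Rightarrow> 'o \<Rightarrow> (nat \<Rightarrow> 'm) \<Rightarrow> (nat \<Rightarrow> 'm) \<Rightarrow> bool" where
  "syzygies C \<X> \<Y> A k p \<longleftrightarrow> Cod C (p 0) = A \<and>
    (\<forall>i. short_exact C (k i) (p i) \<and> Cod C (k i) \<in> \<X> \<and> Dom C (k i) \<in> \<Y> \<and> Cod C (p (Suc i)) = Dom C (k i))"

context abelian_category
begin

lemma half_resolutionD:
  assumes "half_resolution C \<X> \<Y> A q d e"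
  shows "e \<in> Arr C" "Dom C e = q 0" "Cod C e = A" "d i \<in> Arr C" "Dom C (d i) = q (Suc i)" "Cod C (d i) = q i"
    "epic C e" "exact C (d 0) e" "exact C (d (Suc i)) (d i)" "q i \<in> \<X>"
    "\<exists>k. is_kernel C k e \<and> Dom C k \<in> \<Y>" "\<exists>k. is_kernel C k (d i) \<and> Dom C k \<in> \<Y>"
    "e \<cdot> d 0 = Zer C (q 1) A" "d i \<cdot> d (Suc i) = Zer C (q (Suc (Suc i))) (q i)"
proof -
  show "e \<in> Arr C" "Dom C e = q 0" "Cod C e = A" "d i \<in> Arr C" "Dom C (d i) = q (Suc i)" "Cod C (d i) = q i"
    "epic C e" "exact C (d 0) e" "exact C (d (Suc i)) (d i)" "q i \<in> \<X>"
    "\<exists>k. is_kernel C k e \<and> Dom C k \<in> \<Y>" "\<exists>k. is_kernel C k (d i) \<and> Dom C k \<in> \<Y>"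
    using assms unfolding half_resolution_def by simp_all
  show "e \<cdot> d 0 = Zer C (q 1) A" "d i \<cdot> d (Suc i) = Zer C (q (Suc (Suc i))) (q i)"
    using assms exactD(4)[of "d 0" e] exactD(4)[of "d (Suc i)" "d i"] unfolding half_resolution_def by simp_all
qed

lemma syzygiesD:
  assumes "syzygies C \<X> \<Y> A k p"
  shows "Cod C (p 0) = A" "short_exact C (k i) (p i)" "Cod C (k i) \<in> \<X>" "Dom C (k i) \<in> \<Y>"
    "Cod C (p (Suc i)) = Dom C (k i)" "k i \<in> Arr C" "p i \<in> Arr C" "Dom C (p i) = Cod C (k i)"
proof -
  show "Cod C (p 0) = A" and i: "short_exact C (k i) (p i)"
    and "Cod C (k i) \<in> \<X>" "Dom C (k i) \<in> \<Y>" "Cod C (p (Suc i)) = Dom C (k i)"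
    using assms unfolding syzygies_def by simp_all
  show "k i \<in> Arr C" "p i \<in> Arr C" "Dom C (p i) = Cod C (k i)" using short_exactD(1-3)[OF i] by simp_all
qed

lemma half_resolution_syzygies:
  assumes "syzygies C \<X> \<Y> A k p"
  shows "half_resolution C \<X> \<Y> A (\<lambda>i. Cod C (k i)) (\<lambda>i. k i \<cdot> p (Suc i)) (p 0)"
proof -
  note s = syzygiesD[OF assms]
  note se = short_exactD[OF s(2)]
  have ker: "is_kernel C (k (Suc i)) (k i \<cdot> p (Suc i))" for i
    by (rule is_kernel_monic_Cmp[OF se(7) se(5)]) (simp add: s)
  show ?thesis unfolding half_resolution_def
  proof (intro conjI allI)
    show "exact C (k 0 \<cdot> p (Suc 0)) (p 0)"
      by (rule exact_Cmp_epic[OF kernel_exact[OF se(7)] se(6)]) (simp add: s)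
    fix i
    show "exact C (k (Suc i) \<cdot> p (Suc (Suc i))) (k i \<cdot> p (Suc i))"
      by (rule exact_Cmp_epic[OF kernel_exact[OF ker] se(6)]) (simp add: s)
    show "\<exists>l. is_kernel C l (k i \<cdot> p (Suc i)) \<and> Dom C l \<in> \<Y>" using ker s(4) by blast
    show "\<exists>k. is_kernel C k (p 0) \<and> Dom C k \<in> \<Y>" using se(7) s(4) by blast
  qed (use s se(6) in simp_all)
qed

lemma ex_syzygies:
  assumes "half_resolution C \<X> \<Y> A q d e"
  obtains k p where "syzygies C \<X> \<Y> A k p" "q = (\<lambda>i. Cod C (k i))" "d = (\<lambda>i. k i \<cdot> p (Suc i))" "e = p 0"
proof -
  note h = half_resolutionD[OF assms]
  \<comment> \<open>\<open>z i\<close> is the morphism whose kernel is the syzygy number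
    \<open>i\<close>: the augmentation first, then the differentials with their index shifted by
    one.\<close>
  define z where "z i = (case i of 0 \<Rightarrow> e | Suc j \<Rightarrow> d j)" for i
  have z: "exact C (d i) (z i)" "\<exists>k. is_kernel C k (z i) \<and> Dom C k \<in> \<Y>" "Dom C (z i) = q i" for i
    using h by (auto simp: z_def split: nat.split)
  then obtain k where k: "is_kernel C (k i) (z i)" "Dom C (k i) \<in> \<Y>" for i by metis
  have "\<exists>p. p \<in> Hom C (q (Suc i)) (Dom C (k i)) \<and> k i \<cdot> p = d i \<and> epic C p" for i
    using exact_kernel_epic[OF z(1) k(1), of i] h(5) by metis
  then obtain p' where p': "p' i \<in> Hom C (q (Suc i)) (Dom C (k i))" "k i \<cdot> p' i = d i" "epic C (p' i)" for i
    by metis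
  define p where "p i = (case i of 0 \<Rightarrow> e | Suc j \<Rightarrow> p' j)" for i
  have ks: "k i \<in> Arr C" "Cod C (k i) = q i" for i using is_kernelD[OF k(1)[of i]] z(3) by simp_all
  \<comment> \<open>After the first index, \<open>z i\<close> is \<open>p i\<close> followed by the
    monomorphism \<open>k j\<close>, so both have the same kernel.\<close>
  have "is_kernel C (k i) (p i)" for i
  proof (cases i)
    case 0 then show ?thesis using k(1)[of 0] by (simp add: p_def z_def)
  next
    case (Suc j)
    have d: "k j \<cdot> p' j = z i" "monic C (k j)" using p'(2) is_kernel_monic[OF k(1)] by (simp_all add: Suc z_def)
    show ?thesis
    proof (rule is_kernelI)
      note kk = is_kernelD[OF k(1)[of i]]
      have "k j \<cdot> p' j \<cdot> k i = Zer C (Dom C (k i)) (q j)"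
        using Cmp_rewr[OF d(1), of "k i"] kk p'(1)[of j] ks[of j] d(1) h by (simp add: Suc z_def)
      then show "p i \<cdot> k i = Zer C (Dom C (k i)) (Cod C (p i))"
        using monicD[OF d(2), of "p' j \<cdot> k i"] kk(2) p'(1)[of j] ks[of j] ks[of i] by (simp add: p_def Suc)
      fix u assume u: "u \<in> Arr C" "Cod C u = Dom C (p i)" "p i \<cdot> u = Zer C (Dom C u) (Cod C (p i))"
      have "z i \<cdot> u = Zer C (Dom C u) (Cod C (z i))"
        using Cmp_rewr[OF d(1), of u] u p'(1)[of j] ks[of j] h by (simp add: Suc p_def z_def)
      then show "\<exists>v. v \<in> Hom C (Dom C u) (Dom C (k i)) \<and> k i \<cdot> v = u"
        using is_kernel_factor[OF k(1)[of i], of u] u(1,2) z(3)[of i] p'(1)[of j] by (auto simp: p_def Suc)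
    qed (use p'(1)[of j] ks[of i] is_kernel_monic[OF k(1)[of i]] in \<open>simp_all add: p_def Suc\<close>)
  qed
  moreover have "epic C (p i)" for i using p'(3) h(7) by (simp add: p_def split: nat.split)
  ultimately have "syzygies C \<X> \<Y> A k p"
    unfolding syzygies_def using short_exact_kernelI k(2) ks h(3,10) p'(1) by (simp add: p_def)
  then show thesis by (rule that) (use ks p'(2) in \<open>simp_all add: p_def\<close>)
qed

lemma ex_half_resolution:
  assumes "hered_cotorsion C \<X> \<Y>" "A \<in> Obj C"
  shows "\<exists>q d e. half_resolution C \<X> \<Y> A q d e"
proof -
  have ex: "\<exists>k p. short_exact C k p \<and> Cod C k \<in> \<X> \<and> Dom C k \<in> \<Y> \<and> Cod C p = B" if "B \<in> Obj C" for B
    using assms(1) that unfolding hered_cotorsion_def complete_pair_def by blast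
  obtain F where F: "\<And>n. (case F n of (k, p) \<Rightarrow> short_exact C k p \<and> Cod C k \<in> \<X> \<and> Dom C k \<in> \<Y> \<and> (n = 0 \<longrightarrow> Cod C p = A)) \<and>
    (case F n of (k, p) \<Rightarrow> case F (Suc n) of (k', p') \<Rightarrow> Cod C p' = Dom C k)"
  proof (atomize_elim, rule dependent_nat_choice, goal_cases)
    case 1 then show ?case using ex[OF assms(2)] by auto
  next
    case (2 x n)
    obtain k p where x: "x = (k, p)" by (cases x)
    then have "Dom C k \<in> Obj C" using 2 short_exactD(1) by auto
    from ex[OF this] show ?case by (auto simp: x)
  qed
  have "syzygies C \<X> \<Y> A (\<lambda>i. fst (F i)) (\<lambda>i. snd (F i))"
    unfolding syzygies_def using F by (auto simp: case_prod_beta)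
  then show ?thesis using half_resolution_syzygies by blast
qed

text \<open>The terms need not be projective. Lifting works because the kernels in the target
  resolution lie in \<open>\<Y>\<close>, to which the terms of the source, lying in
  \<open>\<X>\<close>, are orthogonal.\<close>

lemma half_resolution_lift:
  assumes hc: "hered_cotorsion C \<X> \<Y>"
    and r: "half_resolution C \<X> \<Y> A q d e" and r': "half_resolution C \<X> \<Y> A' q' d' e'"
    and f: "f \<in> Hom C A A'"
  shows "\<exists>\<phi>. (\<forall>i. \<phi> i \<in> Hom C (q i) (q' i)) \<and> e' \<cdot> \<phi> 0 = f \<cdot> e \<and> (\<forall>i. d' i \<cdot> \<phi> (Suc i) = \<phi> i \<cdot> d i)"
proof -
  note h = half_resolutionD[OF r] and h' = half_resolutionD[OF r']
  have qo: "q i \<in> Obj C" "q' i \<in> Obj C" for i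
    using h(10) h'(10) hered_cotorsionD(1)[OF hc] by auto
  have o: "A \<in> Obj C" "A' \<in> Obj C" using Hom_Obj[OF f] by auto
  define z where "z i = (case i of 0 \<Rightarrow> e' | Suc j \<Rightarrow> d' j)" for i
  have z: "exact C (d' i) (z i)" "Dom C (z i) = q' i" "z i \<in> Arr C" for i
    using h' by (auto simp: z_def split: nat.split)
  \<comment> \<open>The last clause of the invariant says that \<open>\<phi> n \<cdot> d n\<close>
    is killed by \<open>z n\<close>, exactly what is needed to lift it along \<open>d' n\<close> in
    the next step.\<close>
  obtain \<phi> where \<phi>: "\<And>n. (\<phi> n \<in> Hom C (q n) (q' n) \<and> (n = 0 \<longrightarrow> e' \<cdot> \<phi> n = f \<cdot> e) \<and>
      z n \<cdot> \<phi> n \<cdot> d n = Zer C (q (Suc n)) (Cod C (z n))) \<and> d' n \<cdot> \<phi> (Suc n) = \<phi> n \<cdot> d n"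
  proof (atomize_elim, rule dependent_nat_choice, goal_cases)
    case 1
    obtain k where k: "is_kernel C k e'" "Dom C k \<in> \<Y>" using h'(11) by blast
    obtain \<psi> where \<psi>: "\<psi> \<in> Hom C (q 0) (Dom C e')" "e' \<cdot> \<psi> = f \<cdot> e"
      by (rule lift_short_exact[OF hered_cotorsionD(3)[OF hc h(10)[of 0] k(2)] short_exact_kernelI[OF k(1) h'(7)], of "f \<cdot> e"])
        (use f h h' in simp_all)
    have "e' \<cdot> \<psi> \<cdot> d 0 = f \<cdot> e \<cdot> d 0" using Cmp_rewr[OF \<psi>(2), of "d 0"] \<psi>(1) f h(1-6) h'(1-6) by simp
    then have "e' \<cdot> \<psi> \<cdot> d 0 = Zer C (q 1) A'" using h(13) f qo by simp
    then show ?case using \<psi> h'(1-3) by (intro exI[of _ \<psi>]) (simp add: z_def)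
  next
    case (2 \<psi> n)
    obtain k where k: "is_kernel C k (d' n)" "Dom C k \<in> \<Y>" using h'(12) by blast
    obtain \<psi>' where \<psi>': "\<psi>' \<in> Hom C (q (Suc n)) (Dom C (d' n))" "d' n \<cdot> \<psi>' = \<psi> \<cdot> d n"
      by (rule lift_exact[OF z(1) k(1) hered_cotorsionD(3)[OF hc h(10)[of "Suc n"] k(2)], of "\<psi> \<cdot> d n"])
        (use 2 h(1-6) h'(1-6) z in simp_all)
    have "d' n \<cdot> \<psi>' \<cdot> d (Suc n) = \<psi> \<cdot> d n \<cdot> d (Suc n)"
      using Cmp_rewr[OF \<psi>'(2), of "d (Suc n)"] \<psi>'(1) 2 h(1-6) h'(1-6) by simp
    then have "d' n \<cdot> \<psi>' \<cdot> d (Suc n) = Zer C (q (Suc (Suc n))) (q' n)" using h(14) 2 qo by simp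
    then show ?case using \<psi>' h' by (intro exI[of _ \<psi>']) (simp add: z_def)
  qed
  then show ?thesis by (intro exI[of _ \<phi>]) blast
qed

lemma half_resolution_homotopy:
  assumes hc: "hered_cotorsion C \<X> \<Y>"
    and r: "half_resolution C \<X> \<Y> A q d e" and r': "half_resolution C \<X> \<Y> A' q' d' e'"
    and \<phi>: "\<And>i. \<phi> i \<in> Hom C (q i) (q' i)" "e' \<cdot> \<phi> 0 = Zer C (q 0) A'" "\<And>i. d' i \<cdot> \<phi> (Suc i) = \<phi> i \<cdot> d i"
  shows "\<exists>s. (\<forall>i. s i \<in> Hom C (q i) (q' (Suc i))) \<and> \<phi> 0 = d' 0 \<cdot> s 0 \<and>
    (\<forall>i. \<phi> (Suc i) = d' (Suc i) \<cdot> s (Suc i) \<oplus> s i \<cdot> d i)"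
proof -
  note h = half_resolutionD[OF r] and h' = half_resolutionD[OF r']
  have qo: "q i \<in> Obj C" "q' i \<in> Obj C" for i
    using h(10) h'(10) hered_cotorsionD(1)[OF hc] by auto
  have \<phi>1: "\<phi> i \<in> Arr C" "Dom C (\<phi> i) = q i" "Cod C (\<phi> i) = q' i" for i using \<phi>(1)[of i] by simp_all
  \<comment> \<open>The clause \<open>d' n \<cdot> s n \<cdot> d n = \<phi> n \<cdot> d n\<close>
    makes the remaining error \<open>\<phi> (Suc n) \<ominus> s n \<cdot> d n\<close> a cycle, so
    that it lifts along \<open>d' (Suc n)\<close>.\<close>
  obtain s where s: "\<And>n. (s n \<in> Hom C (q n) (q' (Suc n)) \<and> (n = 0 \<longrightarrow> d' 0 \<cdot> s n = \<phi> 0) \<and>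
      d' n \<cdot> s n \<cdot> d n = \<phi> n \<cdot> d n) \<and> d' (Suc n) \<cdot> s (Suc n) = \<phi> (Suc n) \<ominus> s n \<cdot> d n"
  proof (atomize_elim, rule dependent_nat_choice, goal_cases)
    case 1
    obtain k where k: "is_kernel C k (d' 0)" "Dom C k \<in> \<Y>" using h'(12) by blast
    obtain t where t: "t \<in> Hom C (q 0) (Dom C (d' 0))" "d' 0 \<cdot> t = \<phi> 0"
      by (rule lift_exact[OF h'(8) k(1) hered_cotorsionD(3)[OF hc h(10)[of 0] k(2)], of "\<phi> 0"])
        (use \<phi>1 \<phi>(2) h(1-6) h'(1-6) in simp_all)
    have "d' 0 \<cdot> t \<cdot> d 0 = \<phi> 0 \<cdot> d 0" using Cmp_rewr[OF t(2), of "d 0"] t(1) h(1-6) h'(1-6) by simp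
    then show ?case using t h' by (intro exI[of _ t]) simp
  next
    case (2 t n)
    then have t: "t \<in> Arr C" "Dom C t = q n" "Cod C t = q' (Suc n)" "d' n \<cdot> t \<cdot> d n = \<phi> n \<cdot> d n" by simp_all
    obtain k where k: "is_kernel C k (d' (Suc n))" "Dom C k \<in> \<Y>" using h'(12) by blast
    have v: "d' n \<cdot> (\<phi> (Suc n) \<ominus> t \<cdot> d n) = Zer C (q (Suc n)) (q' n)"
      using t \<phi>1 h(1-6) h'(1-6) \<phi>(3)[of n] by simp
    obtain t' where t': "t' \<in> Hom C (q (Suc n)) (Dom C (d' (Suc n)))" "d' (Suc n) \<cdot> t' = \<phi> (Suc n) \<ominus> t \<cdot> d n"
      by (rule lift_exact[OF h'(9) k(1) hered_cotorsionD(3)[OF hc h(10)[of "Suc n"] k(2)], of "\<phi> (Suc n) \<ominus> t \<cdot> d n"])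
        (use t(1-3) \<phi>1 v h(1-6) h'(1-6) in \<open>simp_all del: Cmp_Sub\<close>)
    have "d' (Suc n) \<cdot> t' \<cdot> d (Suc n) = (\<phi> (Suc n) \<ominus> t \<cdot> d n) \<cdot> d (Suc n)"
      using Cmp_rewr[OF t'(2), of "d (Suc n)"] t'(1) h(1-6) h'(1-6) by simp
    also have "\<dots> = \<phi> (Suc n) \<cdot> d (Suc n) \<ominus> Zer C (q (Suc (Suc n))) (q' (Suc n))"
      using t(1-3) \<phi>1 h(1-6) h'(1-6) h(14)[of n] qo by simp
    also have "\<dots> = \<phi> (Suc n) \<cdot> d (Suc n)"
      using \<phi>1 h(1-6) qo by (intro Sub_eqI) simp_all
    finally show ?case using t' h' by (intro exI[of _ t']) simp
  qed
  have s1: "s i \<in> Arr C" "Dom C (s i) = q i" "Cod C (s i) = q' (Suc i)"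
    "d' (Suc i) \<cdot> s (Suc i) = \<phi> (Suc i) \<ominus> s i \<cdot> d i" for i using s[of i] by simp_all
  have "\<phi> (Suc i) = d' (Suc i) \<cdot> s (Suc i) \<oplus> s i \<cdot> d i" for i
    using s1 \<phi>1 h(1-6) by simp
  then show ?thesis using s[of 0] s1(1-3) by (intro exI[of _ s]) simp
qed

text \<open>The horseshoe step is iterated: its row of kernels is again a short exact sequence,
  whose outer terms are the next syzygies of the given resolutions. New terms and new syzygies stay
  in their classes by closure under extensions.\<close>

lemma half_resolution_horseshoe:
  assumes hc: "hered_cotorsion C \<X> \<Y>"
    and r: "half_resolution C \<X> \<Y> A q d e" and r2: "half_resolution C \<X> \<Y> A2 q2 d2 e2"
    and fg: "short_exact C f g" "Dom C f = A" "Cod C g = A2"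
  obtains q1 d1 e1 \<alpha> \<beta> where "half_resolution C \<X> \<Y> (Cod C f) q1 d1 e1"
    "\<And>i. \<alpha> i \<in> Hom C (q i) (q1 i)" "\<And>i. \<beta> i \<in> Hom C (q1 i) (q2 i)" "\<And>i. short_exact C (\<alpha> i) (\<beta> i)"
    "e1 \<cdot> \<alpha> 0 = f \<cdot> e" "e2 \<cdot> \<beta> 0 = g \<cdot> e1"
    "\<And>i. d1 i \<cdot> \<alpha> (Suc i) = \<alpha> i \<cdot> d i" "\<And>i. d2 i \<cdot> \<beta> (Suc i) = \<beta> i \<cdot> d1 i"
proof -
  obtain k p where kp: "syzygies C \<X> \<Y> A k p" "q = (\<lambda>i. Cod C (k i))" "d = (\<lambda>i. k i \<cdot> p (Suc i))" "e = p 0"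
    by (rule ex_syzygies[OF r])
  obtain k2 p2 where kp2: "syzygies C \<X> \<Y> A2 k2 p2" "q2 = (\<lambda>i. Cod C (k2 i))" "d2 = (\<lambda>i. k2 i \<cdot> p2 (Suc i))" "e2 = p2 0"
    by (rule ex_syzygies[OF r2])
  note s = syzygiesD[OF kp(1)] and s2 = syzygiesD[OF kp2(1)]
  \<comment> \<open>A state consists of the middle sequence \<open>k1\<close>, \<open>p1\<close>,
    the row \<open>\<alpha>\<close>, \<open>\<beta>\<close> of terms and the row
    \<open>\<kappa>\<close>, \<open>\<mu>\<close> of syzygies. \<open>P\<close> describes one stage,
    and \<open>S\<close> says that the next stage covers the row \<open>\<kappa>\<close>,
    \<open>\<mu>\<close>.\<close>
  define P where "P n = (\<lambda>(k1, p1, \<alpha>, \<beta>, \<kappa>, \<mu>). short_exact C k1 p1 \<and> short_exact C \<alpha> \<beta> \<and> short_exact C \<kappa> \<mu> \<and>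
    Dom C \<alpha> = Cod C (k n) \<and> Cod C \<alpha> = Dom C p1 \<and> Cod C \<beta> = Cod C (k2 n) \<and>
    Dom C \<kappa> = Dom C (k n) \<and> Cod C \<kappa> = Dom C k1 \<and> Cod C \<mu> = Dom C (k2 n) \<and>
    k1 \<cdot> \<kappa> = \<alpha> \<cdot> k n \<and> k2 n \<cdot> \<mu> = \<beta> \<cdot> k1 \<and>
    (n = 0 \<longrightarrow> Cod C p1 = Cod C f \<and> f \<cdot> p 0 = p1 \<cdot> \<alpha> \<and> g \<cdot> p1 = p2 0 \<cdot> \<beta>))" for n
  define S where "S n = (\<lambda>(k1 :: 'b, p1 :: 'b, \<alpha> :: 'b, \<beta> :: 'b, \<kappa>, \<mu>) (k1' :: 'b, p1', \<alpha>', \<beta>', \<kappa>' :: 'b, \<mu>' :: 'b).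
    Cod C p1' = Dom C k1 \<and> \<kappa> \<cdot> p (Suc n) = p1' \<cdot> \<alpha>' \<and> \<mu> \<cdot> p1' = p2 (Suc n) \<cdot> \<beta>')" for n
  have "\<exists>F. \<forall>n. P n (F n) \<and> S n (F n) (F (Suc n))"
  proof (rule dependent_nat_choice)
    have e: "Ext2_split C (Dom C (p2 0)) (Dom C (k 0))" using hered_cotorsionD(4)[OF hc] s s2 by simp
    have c: "Cod C (p 0) = Dom C f" "Cod C (p2 0) = Cod C g" using s(1) s2(1) fg(2,3) by simp_all
    obtain k1 p1 \<alpha> \<beta> \<kappa> \<mu> where
      "short_exact C k1 p1" "Cod C p1 = Cod C f" "short_exact C \<alpha> \<beta>" "short_exact C \<kappa> \<mu>"
      "Dom C \<alpha> = Dom C (p 0)" "Cod C \<alpha> = Dom C p1" "Cod C \<beta> = Dom C (p2 0)"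
      "Dom C \<kappa> = Dom C (k 0)" "Cod C \<kappa> = Dom C k1" "Cod C \<mu> = Dom C (k2 0)"
      "f \<cdot> p 0 = p1 \<cdot> \<alpha>" "g \<cdot> p1 = p2 0 \<cdot> \<beta>" "k1 \<cdot> \<kappa> = \<alpha> \<cdot> k 0" "k2 0 \<cdot> \<mu> = \<beta> \<cdot> k1"
      by (rule horseshoe_step[OF fg(1) s(2)[of 0] c(1) s2(2)[of 0] c(2) e])
    then have "P 0 (k1, p1, \<alpha>, \<beta>, \<kappa>, \<mu>)" unfolding P_def using s s2 by simp
    then show "\<exists>x. P 0 x" by blast
  next
    fix x n assume "P n x"
    obtain k1 p1 \<alpha> \<beta> \<kappa> \<mu> where x: "x = (k1, p1, \<alpha>, \<beta>, \<kappa>, \<mu>)" by (cases x) auto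
    have \<kappa>: "short_exact C \<kappa> \<mu>" "Cod C (p (Suc n)) = Dom C \<kappa>" "Cod C (p2 (Suc n)) = Cod C \<mu>" "Cod C \<kappa> = Dom C k1"
      using \<open>P n x\<close> s s2 unfolding P_def x by simp_all
    have e: "Ext2_split C (Dom C (p2 (Suc n))) (Dom C (k (Suc n)))" using hered_cotorsionD(4)[OF hc] s s2 by simp
    obtain k1' p1' \<alpha>' \<beta>' \<kappa>' \<mu>' where
      "short_exact C k1' p1'" "Cod C p1' = Cod C \<kappa>" "short_exact C \<alpha>' \<beta>'" "short_exact C \<kappa>' \<mu>'"
      "Dom C \<alpha>' = Dom C (p (Suc n))" "Cod C \<alpha>' = Dom C p1'" "Cod C \<beta>' = Dom C (p2 (Suc n))"
      "Dom C \<kappa>' = Dom C (k (Suc n))" "Cod C \<kappa>' = Dom C k1'" "Cod C \<mu>' = Dom C (k2 (Suc n))"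
      "\<kappa> \<cdot> p (Suc n) = p1' \<cdot> \<alpha>'" "\<mu> \<cdot> p1' = p2 (Suc n) \<cdot> \<beta>'" "k1' \<cdot> \<kappa>' = \<alpha>' \<cdot> k (Suc n)" "k2 (Suc n) \<cdot> \<mu>' = \<beta>' \<cdot> k1'"
      by (rule horseshoe_step[OF \<kappa>(1) s(2)[of "Suc n"] \<kappa>(2) s2(2)[of "Suc n"] \<kappa>(3) e])
    then have "P (Suc n) (k1', p1', \<alpha>', \<beta>', \<kappa>', \<mu>') \<and> S n x (k1', p1', \<alpha>', \<beta>', \<kappa>', \<mu>')"
      unfolding P_def S_def x using s s2 \<kappa> by simp
    then show "\<exists>y. P (Suc n) y \<and> S n x y" by blast
  qed
  then obtain F where F: "\<And>n. P n (F n)" "\<And>n. S n (F n) (F (Suc n))" by blast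
  define k1 p1 \<alpha> \<beta> \<kappa> \<mu> where "k1 n = fst (F n)" and "p1 n = fst (snd (F n))" and "\<alpha> n = fst (snd (snd (F n)))"
    and "\<beta> n = fst (snd (snd (snd (F n))))" and "\<kappa> n = fst (snd (snd (snd (snd (F n)))))"
    and "\<mu> n = snd (snd (snd (snd (snd (F n)))))" for n
  have F': "F n = (k1 n, p1 n, \<alpha> n, \<beta> n, \<kappa> n, \<mu> n)" for n
    by (simp add: k1_def p1_def \<alpha>_def \<beta>_def \<kappa>_def \<mu>_def)
  have P: "short_exact C (k1 n) (p1 n)" "short_exact C (\<alpha> n) (\<beta> n)" "short_exact C (\<kappa> n) (\<mu> n)"
    "Dom C (\<alpha> n) = Cod C (k n)" "Cod C (\<alpha> n) = Dom C (p1 n)" "Cod C (\<beta> n) = Cod C (k2 n)"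
    "Dom C (\<kappa> n) = Dom C (k n)" "Cod C (\<kappa> n) = Dom C (k1 n)" "Cod C (\<mu> n) = Dom C (k2 n)"
    "k1 n \<cdot> \<kappa> n = \<alpha> n \<cdot> k n" "k2 n \<cdot> \<mu> n = \<beta> n \<cdot> k1 n" for n
    using F(1)[of n] unfolding F' P_def by simp_all
  have P0: "Cod C (p1 0) = Cod C f" "f \<cdot> p 0 = p1 0 \<cdot> \<alpha> 0" "g \<cdot> p1 0 = p2 0 \<cdot> \<beta> 0"
    using F(1)[of 0] unfolding F' P_def by simp_all
  have S: "Cod C (p1 (Suc n)) = Dom C (k1 n)" "\<kappa> n \<cdot> p (Suc n) = p1 (Suc n) \<cdot> \<alpha> (Suc n)"
    "\<mu> n \<cdot> p1 (Suc n) = p2 (Suc n) \<cdot> \<beta> (Suc n)" for n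
    using F(2)[of n] unfolding F' S_def by simp_all
  note t = short_exactD(1-3)[OF P(1)] short_exactD(1-3)[OF P(2)] short_exactD(1-3)[OF P(3)] P(4-9) S(1) s(5-8) s2(5-8)
  have "syzygies C \<X> \<Y> (Cod C f) k1 p1"
    unfolding syzygies_def
  proof (intro conjI allI)
    fix i
    have "Cod C (\<alpha> i) \<in> \<X>" by (rule hered_cotorsion_left_middle[OF hc P(2)]) (simp_all add: t s s2)
    then show "Cod C (k1 i) \<in> \<X>" using t by simp
    have "Cod C (\<kappa> i) \<in> \<Y>" by (rule hered_cotorsion_right_middle[OF hc P(3)]) (simp_all add: t s s2)
    then show "Dom C (k1 i) \<in> \<Y>" using t by simp
  qed (use P P0 S in simp_all)
  note half = half_resolution_syzygies[OF this]
  show thesis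
  proof (rule that[OF half, of \<alpha> \<beta>])
    fix i
    show "\<alpha> i \<in> Hom C (q i) (Cod C (k1 i))" "\<beta> i \<in> Hom C (Cod C (k1 i)) (q2 i)" "short_exact C (\<alpha> i) (\<beta> i)"
      using t P(2) by (simp_all add: kp kp2)
    show "p1 0 \<cdot> \<alpha> 0 = f \<cdot> e" "e2 \<cdot> \<beta> 0 = g \<cdot> p1 0" using P0 by (simp_all add: kp kp2)
    have "k1 i \<cdot> p1 (Suc i) \<cdot> \<alpha> (Suc i) = (k1 i \<cdot> \<kappa> i) \<cdot> p (Suc i)" using S(2)[of i] t by simp
    also have "\<dots> = \<alpha> i \<cdot> k i \<cdot> p (Suc i)" unfolding P(10) using t by simp
    finally show "(k1 i \<cdot> p1 (Suc i)) \<cdot> \<alpha> (Suc i) = \<alpha> i \<cdot> d i" using t by (simp add: kp)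
    have "k2 i \<cdot> p2 (Suc i) \<cdot> \<beta> (Suc i) = (k2 i \<cdot> \<mu> i) \<cdot> p1 (Suc i)" using S(3)[of i] t by simp
    also have "\<dots> = \<beta> i \<cdot> k1 i \<cdot> p1 (Suc i)" unfolding P(11) using t by simp
    finally show "d2 i \<cdot> \<beta> (Suc i) = \<beta> i \<cdot> k1 i \<cdot> p1 (Suc i)" using t by (simp add: kp2)
  qed
qed

end

section \<open>Resolutions for an abelian model structure\<close>

definition abelian_model :: "('o, 'm) lincat \<Rightarrow> 'o set \<Rightarrow> 'o set \<Rightarrow> 'o set \<Rightarrow> bool" where
  "abelian_model C \<Q> \<W> \<R> \<longleftrightarrow>
    thick C \<W> \<and> hered_cotorsion C \<Q> (\<W> \<inter> \<R>) \<and> hered_cotorsion C (\<Q> \<inter> \<W>) \<R>"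

text \<open>Degrees are reflected by i -> -1 - i, which exchanges 0 and -1, where the halves meet. A
  differential joins neighbouring degrees, so its index, the degree of its source, becomes -i; the
  connecting differential \<open>dif X 0\<close> is fixed.\<close>

definition dual_resolution :: "('o, 'm) resolution \<Rightarrow> ('o, 'm) resolution" where
  "dual_resolution X = \<lparr>ob = (\<lambda>i. ob X (- 1 - i)), dif = (\<lambda>i. dif X (- i)), aug = coaug X, coaug = aug X\<rparr>"

lemma int_half_cases:
  obtains (nonneg) n where "i = int n" | (neg) n where "i = - 1 - int n"
proof (cases "i \<ge> 0")
  case True then show thesis using nonneg[of "nat i"] by simp
next
  case False then show thesis using neg[of "nat (- 1 - i)"] by simp
qed

definition glue :: "(nat \<Rightarrow> 'a) \<Rightarrow> (nat \<Rightarrow> 'a) \<Rightarrow> int \<Rightarrow> 'a" where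
  "glue x y i = (if i \<ge> 0 then x (nat i) else y (nat (- 1 - i)))"

lemma glue_simps [simp]: "glue x y (int n) = x n" "glue x y (- 1 - int n) = y n"
  "glue x y 0 = x 0" "glue x y (-1) = y 0" "glue x y (int n + 1) = x (Suc n)" "glue x y (- 2 - int n) = y (Suc n)"
  by (simp_all add: glue_def nat_add_distrib nat_diff_distrib')

context abelian_category
begin

section \<open>Duality and existence of two-sided resolutions\<close>

lemma thick_oppositeI: "thick C \<W> \<Longrightarrow> thick (opposite C) \<W>"
  unfolding thick_def[of "opposite C"]
proof (intro conjI allI impI; (elim conjE)?)
  assume t: "thick C \<W>"
  then show "\<W> \<subseteq> Obj (opposite C)" by (simp add: thick_def)
  fix f g assume "short_exact (opposite C) f g"
  then have s: "short_exact C g f" "Cod C g = Dom C f" using short_exactD(3) by auto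
  have T: "Dom C g \<in> \<W> \<Longrightarrow> Dom C f \<in> \<W> \<Longrightarrow> Cod C f \<in> \<W>" "Dom C g \<in> \<W> \<Longrightarrow> Cod C f \<in> \<W> \<Longrightarrow> Dom C f \<in> \<W>"
    "Dom C f \<in> \<W> \<Longrightarrow> Cod C f \<in> \<W> \<Longrightarrow> Dom C g \<in> \<W>"
    using t s unfolding thick_def by metis+
  { assume "Dom (opposite C) f \<in> \<W>" "Cod (opposite C) f \<in> \<W>" then show "Cod (opposite C) g \<in> \<W>" using T s by simp }
  { assume "Dom (opposite C) f \<in> \<W>" "Cod (opposite C) g \<in> \<W>" then show "Cod (opposite C) f \<in> \<W>" using T s by simp }
  { assume "Cod (opposite C) f \<in> \<W>" "Cod (opposite C) g \<in> \<W>" then show "Dom (opposite C) f \<in> \<W>" using T s by simp }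
qed

lemma thick_opposite [simp]: "thick (opposite C) \<W> = thick C \<W>"
  using thick_oppositeI abelian_category.thick_oppositeI[OF abelian_opposite, of \<W>] by auto

lemma abelian_model_opposite [simp]: "abelian_model (opposite C) \<R> \<W> \<Q> = abelian_model C \<Q> \<W> \<R>"
  unfolding abelian_model_def thick_opposite Int_commute[of \<R> \<W>] Int_commute[of \<W> \<Q>] hered_cotorsion_opposite
  by blast

lemma hered_cotorsionI:
  assumes "cotorsion_pair C \<X> \<Y>" "complete_pair C \<X> \<Y>" "hereditary_pair C \<X> \<Y>"
  shows "hered_cotorsion C \<X> \<Y>"
proof -
  have p: "\<X> = left_perp C \<Y>" "\<Y> = right_perp C \<X>"
    using assms(1) unfolding cotorsion_pair_def by blast+
  have "left_perp C \<Y> \<subseteq> Obj C" "right_perp C \<X> \<subseteq> Obj C"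
    by (auto simp: left_perp_def right_perp_def)
  then have o: "\<X> \<subseteq> Obj C" "\<Y> \<subseteq> Obj C" unfolding p[symmetric] .
  have "\<X> = {A \<in> Obj C. \<forall>B\<in>\<Y>. Ext_zero C 1 A B}" "\<Y> = {B \<in> Obj C. \<forall>A\<in>\<X>. Ext_zero C 1 A B}"
    by (fact p[unfolded left_perp_def right_perp_def])+
  moreover have "{A \<in> Obj C. \<forall>B\<in>\<Y>. Ext_zero C 1 A B} = {A \<in> Obj C. \<forall>B\<in>\<Y>. Ext1_split C A B}"
    "{B \<in> Obj C. \<forall>A\<in>\<X>. Ext_zero C 1 A B} = {B \<in> Obj C. \<forall>A\<in>\<X>. Ext1_split C A B}"
    using Ext_zero_1_iff o by blast+
  moreover have "\<forall>A\<in>\<X>. \<forall>B\<in>\<Y>. Ext2_split C A B"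
    using assms(3) o Ext_zero_2_split unfolding hereditary_pair_def by (meson one_le_numeral subsetD)
  ultimately show ?thesis using assms(2) unfolding hered_cotorsion_def by argo
qed

lemma abelian_modelI: "hereditary_abelian_model C \<Q> \<W> \<R> \<Longrightarrow> abelian_model C \<Q> \<W> \<R>"
  unfolding hereditary_abelian_model_def abelian_model_def using hered_cotorsionI by blast

text \<open>Only exactness at degrees 0 and -1 involves both halves. There \<open>dif X 0\<close> is
  the epimorphism \<open>aug X\<close> followed by the monomorphism \<open>coaug X\<close>, and
  composing with these does not affect exactness of the adjacent half.\<close>

lemma M_resolution_iff:
  "M_resolution C \<Q> \<W> \<R> A X \<longleftrightarrow>
    half_resolution C (\<Q> \<inter> \<W>) \<R> A (\<lambda>i. ob X (int i)) (\<lambda>i. dif X (int i + 1)) (aug X) \<and>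
    half_resolution (opposite C) (\<W> \<inter> \<R>) \<Q> A (\<lambda>i. ob X (- 1 - int i)) (\<lambda>i. dif X (- 1 - int i)) (coaug X) \<and>
    dif X 0 = coaug X \<cdot> aug X"
    (is "?M \<longleftrightarrow> ?P \<and> ?N \<and> ?Z")
proof
  assume M: ?M
  have d: "dif X i \<in> Hom C (ob X i) (ob X (i - 1))" "exact C (dif X (i + 1)) (dif X i)" for i
    using M unfolding M_resolution_def by blast+
  have 1: ?P
    unfolding half_resolution_def
  proof (intro conjI allI)
    fix i
    show "dif X (int i + 1) \<in> Hom C (ob X (int (Suc i))) (ob X (int i))" using d(1)[of "int i + 1"] by (simp add: add.commute)
    show "exact C (dif X (int (Suc i) + 1)) (dif X (int i + 1))" using d(2)[of "int i + 1"] by (simp add: ac_simps)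
    show "ob X (int i) \<in> \<Q> \<inter> \<W>" "\<exists>k. is_kernel C k (dif X (int i + 1)) \<and> Dom C k \<in> \<R>"
      using M unfolding M_resolution_def by simp_all
  qed (use M in \<open>simp_all add: M_resolution_def\<close>)
  have 2: ?N
    unfolding half_resolution_def
  proof (intro conjI allI)
    fix i
    show "dif X (- 1 - int i) \<in> Hom (opposite C) (ob X (- 1 - int (Suc i))) (ob X (- 1 - int i))"
      using d(1)[of "- 1 - int i"] by (simp add: algebra_simps)
    show "exact (opposite C) (dif X (- 1 - int (Suc i))) (dif X (- 1 - int i))"
      using d(2)[of "- 1 - int (Suc i)"] by (simp add: algebra_simps)
    show "ob X (- 1 - int i) \<in> \<W> \<inter> \<R>"
      "\<exists>k. is_kernel (opposite C) k (dif X (- 1 - int i)) \<and> Dom (opposite C) k \<in> \<Q>"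
      using M unfolding M_resolution_def by simp_all
  qed (use M in \<open>simp_all add: M_resolution_def\<close>)
  show "?P \<and> ?N \<and> ?Z" using 1 2 M unfolding M_resolution_def by blast
next
  assume R: "?P \<and> ?N \<and> ?Z"
  then have P: ?P and N: ?N and Z: ?Z by blast+
  note p = half_resolutionD[OF P]
  note n = abelian_category.half_resolutionD[OF abelian_opposite N, unfolded opposite_simps exact_opposite
      monic_opposite epic_opposite is_kernel_opposite is_cokernel_opposite]
  have z: "aug X \<in> Arr C" "coaug X \<in> Arr C" "Dom C (aug X) = ob X 0" "Cod C (coaug X) = ob X (-1)"
    "Cod C (aug X) = A" "Dom C (coaug X) = A" using p n by simp_all
  have d: "dif X i \<in> Hom C (ob X i) (ob X (i - 1)) \<and> exact C (dif X (i + 1)) (dif X i)" for i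
  proof (cases i rule: int_half_cases)
    case (nonneg k)
    show ?thesis
    proof (cases k)
      case 0
      have "exact C (dif X 1) (coaug X \<cdot> aug X)" by (rule exact_monic_Cmp[OF _ n(7)]) (use p(8) z in simp_all)
      then show ?thesis using z Z by (simp add: nonneg 0)
    next
      case (Suc j)
      then show ?thesis using p(4-6)[of j] p(9)[of j] by (simp add: nonneg ac_simps)
    qed
  next
    case (neg k)
    show ?thesis
    proof (cases k)
      case 0
      have "exact C (coaug X \<cdot> aug X) (dif X (-1))" by (rule exact_Cmp_epic[OF _ p(7)]) (use n(8) z in simp_all)
      then show ?thesis using z Z n(4-6)[of 0] by (simp add: neg 0)
    next
      case (Suc j)
      then show ?thesis using n(4-6)[of k] n(9)[of j] by (simp add: neg algebra_simps)
    qed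
  qed
  have "ob X i \<in> \<Q> \<inter> \<W>" if "i \<ge> 0" for i using p(10)[of "nat i"] that by simp
  moreover have "ob X i \<in> \<W> \<inter> \<R>" if "i \<le> -1" for i using n(10)[of "nat (- 1 - i)"] that by simp
  moreover have "\<exists>k. is_kernel C k (dif X i) \<and> Dom C k \<in> \<R>" if "i \<ge> 1" for i
    using p(12)[of "nat (i - 1)"] that by simp
  moreover have "\<exists>c. is_cokernel C c (dif X i) \<and> Cod C c \<in> \<Q>" if "i \<le> -1" for i
    using n(12)[of "nat (- 1 - i)"] that by simp
  ultimately show ?M unfolding M_resolution_def using d Z z p(7,8,11) n(7,8,11) by simp
qed

lemma M_resolution_opposite:
  assumes "M_resolution C \<Q> \<W> \<R> A X"
  shows "M_resolution (opposite C) \<R> \<W> \<Q> A (dual_resolution X)"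
  unfolding abelian_category.M_resolution_iff[OF abelian_opposite]
  using assms[unfolded M_resolution_iff] by (simp add: dual_resolution_def Int_commute algebra_simps)

lemma M_resolutionD:
  assumes "M_resolution C \<Q> \<W> \<R> A X"
  shows "dif X i \<in> Arr C" "Dom C (dif X i) = ob X i" "Cod C (dif X i) = ob X (i - 1)"
    "exact C (dif X (i + 1)) (dif X i)" "ob X i \<in> Obj C" "dif X i \<cdot> dif X (i + 1) = Zer C (ob X (i + 1)) (ob X (i - 1))"
    "aug X \<in> Arr C" "Dom C (aug X) = ob X 0" "Cod C (aug X) = A" "coaug X \<in> Arr C" "Dom C (coaug X) = A"
    "Cod C (coaug X) = ob X (-1)" "dif X 0 = coaug X \<cdot> aug X" "A \<in> Obj C" "ob X i \<in> \<W>"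
    "i \<ge> 0 \<Longrightarrow> ob X i \<in> \<Q>" "i \<le> -1 \<Longrightarrow> ob X i \<in> \<R>"
proof -
  have d: "dif X i \<in> Hom C (ob X i) (ob X (i - 1))" "exact C (dif X (i + 1)) (dif X i)"
    "dif X (i + 1) \<in> Hom C (ob X (i + 1)) (ob X (i + 1 - 1))"
    and a: "aug X \<in> Hom C (ob X 0) A" "coaug X \<in> Hom C A (ob X (-1))"
    using assms unfolding M_resolution_def by blast+
  show "dif X i \<in> Arr C" "Dom C (dif X i) = ob X i" "Cod C (dif X i) = ob X (i - 1)"
    "exact C (dif X (i + 1)) (dif X i)" "ob X i \<in> Obj C"
    using d Hom_Obj[OF d(1)] by simp_all
  show "dif X i \<cdot> dif X (i + 1) = Zer C (ob X (i + 1)) (ob X (i - 1))" using exactD(4)[OF d(2)] d by simp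
  show "aug X \<in> Arr C" "Dom C (aug X) = ob X 0" "Cod C (aug X) = A" "coaug X \<in> Arr C" "Dom C (coaug X) = A"
    "Cod C (coaug X) = ob X (-1)" "A \<in> Obj C"
    using a Hom_Obj[OF a(2)] by simp_all
  show "dif X 0 = coaug X \<cdot> aug X" "i \<ge> 0 \<Longrightarrow> ob X i \<in> \<Q>" "i \<le> -1 \<Longrightarrow> ob X i \<in> \<R>"
    using assms unfolding M_resolution_def by blast+
  show "ob X i \<in> \<W>" using assms unfolding M_resolution_def by (cases "i \<ge> 0") auto
qed

lemma ex_M_resolution:
  assumes m: "abelian_model C \<Q> \<W> \<R>" and A: "A \<in> Obj C"
  shows "\<exists>X. M_resolution C \<Q> \<W> \<R> A X"
proof -
  obtain q d e where p: "half_resolution C (\<Q> \<inter> \<W>) \<R> A q d e"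
    using ex_half_resolution[of "\<Q> \<inter> \<W>" \<R> A] m A unfolding abelian_model_def by blast
  have "hered_cotorsion (opposite C) (\<W> \<inter> \<R>) \<Q>" using m unfolding abelian_model_def by simp
  then obtain q' d' e' where n: "half_resolution (opposite C) (\<W> \<inter> \<R>) \<Q> A q' d' e'"
    using abelian_category.ex_half_resolution[OF abelian_opposite] A by fastforce
  \<comment> \<open>The first half numbers its differentials from the one with source in degree 1,
    hence the shift for positive indices; index 0 is taken by the connecting composite.\<close>
  let ?X = "\<lparr>ob = glue q q', dif = (\<lambda>i. if i = 0 then e' \<cdot> e else glue d d' (if i > 0 then i - 1 else i)), aug = e, coaug = e'\<rparr>"
  have "(if (- 1 - int i) = 0 then e' \<cdot> e else glue d d' (if (- 1 - int i) > 0 then (- 1 - int i) - 1 else (- 1 - int i))) = d' i"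
    "(if int i + 1 = 0 then e' \<cdot> e else glue d d' (if int i + 1 > 0 then int i + 1 - 1 else int i + 1)) = d i" for i
    by simp_all
  then have "M_resolution C \<Q> \<W> \<R> A ?X"
    unfolding M_resolution_iff resolution.simps using p n by simp
  then show ?thesis by blast
qed

section \<open>Lifting, homotopy and horseshoe for two-sided resolutions\<close>

lemma chain_liftD:
  assumes "chain_lift C X Y f \<phi>"
  shows "\<phi> i \<in> Arr C" "Dom C (\<phi> i) = ob X i" "Cod C (\<phi> i) = ob Y i" "dif Y i \<cdot> \<phi> i = \<phi> (i - 1) \<cdot> dif X i"
    "aug Y \<cdot> \<phi> 0 = f \<cdot> aug X" "\<phi> (-1) \<cdot> coaug X = coaug Y \<cdot> f"
  using assms unfolding chain_lift_def by simp_all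

lemma chain_lift_glue:
  assumes X: "M_resolution C \<Q> \<W> \<R> A X" and Y: "M_resolution C \<Q> \<W> \<R> A' Y" and f: "f \<in> Hom C A A'"
    and p: "\<And>i. \<phi> i \<in> Hom C (ob X (int i)) (ob Y (int i))" "aug Y \<cdot> \<phi> 0 = f \<cdot> aug X"
      "\<And>i. dif Y (int i + 1) \<cdot> \<phi> (Suc i) = \<phi> i \<cdot> dif X (int i + 1)"
    and n: "\<And>i. \<psi> i \<in> Hom C (ob X (- 1 - int i)) (ob Y (- 1 - int i))" "\<psi> 0 \<cdot> coaug X = coaug Y \<cdot> f"
      "\<And>i. dif Y (- 1 - int i) \<cdot> \<psi> i = \<psi> (Suc i) \<cdot> dif X (- 1 - int i)"
  shows "chain_lift C X Y f (glue \<phi> \<psi>)"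
  unfolding chain_lift_def
proof (intro conjI allI)
  note x = M_resolutionD[OF X] and y = M_resolutionD[OF Y]
  fix i
  show "glue \<phi> \<psi> i \<in> Hom C (ob X i) (ob Y i)"
    by (cases i rule: int_half_cases) (use p(1) n(1) in \<open>simp_all del: Hom_iff\<close>)
  show "aug Y \<cdot> glue \<phi> \<psi> 0 = f \<cdot> aug X" "glue \<phi> \<psi> (-1) \<cdot> coaug X = coaug Y \<cdot> f"
    using p(2) n(2) by simp_all
  show "dif Y i \<cdot> glue \<phi> \<psi> i = glue \<phi> \<psi> (i - 1) \<cdot> dif X i"
  proof (cases i rule: int_half_cases)
    case (nonneg k)
    show ?thesis
    proof (cases k)
      case 0
      \<comment> \<open>The two independently lifted halves agree across the junction because both
        composites equal \<open>coaug Y \<cdot> f \<cdot> aug X\<close>.\<close>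
      have "coaug Y \<cdot> aug Y \<cdot> \<phi> 0 = \<psi> 0 \<cdot> coaug X \<cdot> aug X"
        using Cmp_rewr[OF n(2), of "aug X"] p(2) x(7-12) y(7-12) f n(1)[of 0] by simp
      then show ?thesis using p(1)[of 0] n(1)[of 0] x(7-13) y(7-13) by (simp add: nonneg 0)
    next
      case (Suc j)
      have e: "int (Suc j) = int j + 1" "int j + 1 - 1 = int j" by simp_all
      show ?thesis unfolding nonneg Suc e glue_simps by (fact p(3))
    qed
  next
    case (neg k)
    have "- 1 - int k - 1 = - 2 - int k" by simp
    then show ?thesis unfolding neg using n(3)[of k] by (simp only: glue_simps)
  qed
qed

lemma ex_chain_lift:
  assumes m: "abelian_model C \<Q> \<W> \<R>" and X: "M_resolution C \<Q> \<W> \<R> A X" and Y: "M_resolution C \<Q> \<W> \<R> A' Y"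
    and f: "f \<in> Hom C A A'"
  shows "\<exists>\<phi>. chain_lift C X Y f \<phi>"
proof -
  note x = X[unfolded M_resolution_iff] and y = Y[unfolded M_resolution_iff]
  have hc: "hered_cotorsion C (\<Q> \<inter> \<W>) \<R>" "hered_cotorsion (opposite C) (\<W> \<inter> \<R>) \<Q>"
    using m unfolding abelian_model_def by simp_all
  obtain \<phi> where p: "\<And>i. \<phi> i \<in> Hom C (ob X (int i)) (ob Y (int i))" "aug Y \<cdot> \<phi> 0 = f \<cdot> aug X"
      "\<And>i. dif Y (int i + 1) \<cdot> \<phi> (Suc i) = \<phi> i \<cdot> dif X (int i + 1)"
    using half_resolution_lift[OF hc(1) conjunct1[OF x] conjunct1[OF y] f] by blast
  have "f \<in> Hom (opposite C) A' A" using f by simp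
  from abelian_category.half_resolution_lift[OF abelian_opposite hc(2) conjunct1[OF conjunct2[OF y]] conjunct1[OF conjunct2[OF x]] this]
  obtain \<psi> where n: "\<And>i. \<psi> i \<in> Hom C (ob X (- 1 - int i)) (ob Y (- 1 - int i))" "\<psi> 0 \<cdot> coaug X = coaug Y \<cdot> f"
      "\<And>i. dif Y (- 1 - int i) \<cdot> \<psi> i = \<psi> (Suc i) \<cdot> dif X (- 1 - int i)"
    unfolding opposite_simps Hom_opposite by metis
  show ?thesis using chain_lift_glue[OF X Y f p n] by blast
qed

text \<open>Lifts of equal morphisms can be subtracted, so the homotopy of any two lifts reduces to
  lifts of zero.\<close>

lemma chain_lift_Zer_homotopy:
  assumes m: "abelian_model C \<Q> \<W> \<R>" and X: "M_resolution C \<Q> \<W> \<R> A X" and Y: "M_resolution C \<Q> \<W> \<R> A' Y"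
    and \<phi>: "chain_lift C X Y (Zer C A A') \<phi>"
  shows "\<exists>s. \<forall>i. s i \<in> Hom C (ob X i) (ob Y (i + 1)) \<and> \<phi> i = dif Y (i + 1) \<cdot> s i \<oplus> s (i - 1) \<cdot> dif X i"
proof -
  note x = X[unfolded M_resolution_iff] and y = Y[unfolded M_resolution_iff]
  note xd = M_resolutionD[OF X] and yd = M_resolutionD[OF Y] and l = chain_liftD[OF \<phi>]
  have hc: "hered_cotorsion C (\<Q> \<inter> \<W>) \<R>" "hered_cotorsion (opposite C) (\<W> \<inter> \<R>) \<Q>"
    using m unfolding abelian_model_def by simp_all
  have l': "dif Y (int i + 1) \<cdot> \<phi> (int (Suc i)) = \<phi> (int i) \<cdot> dif X (int i + 1)"
    "dif Y (- 1 - int i) \<cdot> \<phi> (- 1 - int i) = \<phi> (- 1 - int (Suc i)) \<cdot> dif X (- 1 - int i)" for i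
    using l(4)[of "int i + 1"] l(4)[of "- 1 - int i"] by (simp_all add: algebra_simps)
  have "\<exists>s. (\<forall>i. s i \<in> Hom C (ob X (int i)) (ob Y (int (Suc i)))) \<and> \<phi> (int 0) = dif Y (int 0 + 1) \<cdot> s 0 \<and>
    (\<forall>i. \<phi> (int (Suc i)) = dif Y (int (Suc i) + 1) \<cdot> s (Suc i) \<oplus> s i \<cdot> dif X (int i + 1))"
    by (rule half_resolution_homotopy[OF hc(1) conjunct1[OF x] conjunct1[OF y]]) (use l l' xd yd in simp_all)
  then obtain s where s: "\<And>i. s i \<in> Hom C (ob X (int i)) (ob Y (int (Suc i)))" "\<phi> 0 = dif Y 1 \<cdot> s 0"
    "\<And>i. \<phi> (int (Suc i)) = dif Y (int (Suc i) + 1) \<cdot> s (Suc i) \<oplus> s i \<cdot> dif X (int i + 1)" by auto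
  have "\<exists>s. (\<forall>i. s i \<in> Hom (opposite C) (ob Y (- 1 - int i)) (ob X (- 1 - int (Suc i)))) \<and>
    \<phi> (- 1 - int 0) = dif X (- 1 - int 0) \<cdot>\<^bsub>opposite C\<^esub> s 0 \<and>
    (\<forall>i. \<phi> (- 1 - int (Suc i)) = Add (opposite C) (dif X (- 1 - int (Suc i)) \<cdot>\<^bsub>opposite C\<^esub> s (Suc i)) (s i \<cdot>\<^bsub>opposite C\<^esub> dif Y (- 1 - int i)))"
    by (rule abelian_category.half_resolution_homotopy[OF abelian_opposite hc(2) conjunct1[OF conjunct2[OF y]] conjunct1[OF conjunct2[OF x]]])
      (use l l' xd yd in simp_all)
  then obtain t where t: "\<And>i. t i \<in> Hom C (ob X (- 1 - int (Suc i))) (ob Y (- 1 - int i))" "\<phi> (- 1) = t 0 \<cdot> dif X (- 1)"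
    "\<And>i. \<phi> (- 1 - int (Suc i)) = t (Suc i) \<cdot> dif X (- 1 - int (Suc i)) \<oplus> dif Y (- 1 - int i) \<cdot> t i"
    unfolding opposite_simps Hom_opposite by auto
  \<comment> \<open>The component from degree -1 to degree 0 is zero: the halves already give
    \<open>\<phi> 0 = dif Y 1 \<cdot> s 0\<close> and
    \<open>\<phi> (-1) = t 0 \<cdot> dif X (-1)\<close>, so nothing has to cross the junction. This
    extra component shifts the index of \<open>t\<close> by one.\<close>
  define u where "u = glue s (\<lambda>i. case i of 0 \<Rightarrow> Zer C (ob X (-1)) (ob Y 0) | Suc j \<Rightarrow> t j)"
  have u: "u (int i) = s i" "u (-1) = Zer C (ob X (-1)) (ob Y 0)" "u (-2 - int i) = t i" for i by (simp_all add: u_def)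
  have u2: "u 0 = s 0" "u (-2) = t 0" using u(1)[of 0] u(3)[of 0] by simp_all
  have "u i \<in> Hom C (ob X i) (ob Y (i + 1)) \<and> \<phi> i = dif Y (i + 1) \<cdot> u i \<oplus> u (i - 1) \<cdot> dif X i" for i
  proof (cases i rule: int_half_cases)
    case (nonneg k)
    show ?thesis
    proof (cases k)
      case 0
      show ?thesis using s(1)[of 0] s(2) xd(1-5) yd(1-5)[of 1] yd(5)[of 0] u2 u by (simp add: nonneg 0)
    next
      case (Suc j)
      have e: "int (Suc j) - 1 = int j" "int (Suc j) + 1 = int (Suc (Suc j))" "int j + 1 = int (Suc j)" by simp_all
      show ?thesis using s(1)[of "Suc j"] s(3)[of j] unfolding nonneg Suc e u by (simp del: of_nat_Suc)
    qed
  next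
    case (neg k)
    show ?thesis
    proof (cases k)
      case 0
      show ?thesis using t(1)[of 0] t(2) xd yd u2 u by (simp add: neg 0)
    next
      case (Suc j)
      have e: "- 1 - int (Suc j) = - 2 - int j" "- 2 - int j + 1 = - 1 - int j" "- 2 - int j - 1 = - 2 - int (Suc j)"
        "- 1 - int (Suc (Suc j)) = - 2 - int (Suc j)" by simp_all
      note t' = t(1)[of j] t(1)[of "Suc j"] t(3)[of j]
      show ?thesis
        using t' Add_commute[of "t (Suc j) \<cdot> dif X (- 2 - int j)" "dif Y (- 1 - int j) \<cdot> t j"] xd(1-6)[of "- 2 - int j"] yd(1-6)[of "- 1 - int j"]
        unfolding neg Suc e u by (simp del: of_nat_Suc)
    qed
  qed
  then show ?thesis by blast
qed

lemma M_resolution_horseshoe: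
  assumes m: "abelian_model C \<Q> \<W> \<R>" and X: "M_resolution C \<Q> \<W> \<R> A X" and Y: "M_resolution C \<Q> \<W> \<R> A2 Y"
    and fg: "short_exact C f g" "Dom C f = A" "Cod C g = A2"
  obtains V \<alpha> \<beta> where "M_resolution C \<Q> \<W> \<R> (Cod C f) V" "chain_lift C X V f \<alpha>" "chain_lift C V Y g \<beta>"
    "\<And>n. short_exact C (\<alpha> n) (\<beta> n)"
proof -
  note x = X[unfolded M_resolution_iff] and y = Y[unfolded M_resolution_iff]
  note xd = M_resolutionD[OF X] and yd = M_resolutionD[OF Y] and s = short_exactD[OF fg(1)]
  have hc: "hered_cotorsion C (\<Q> \<inter> \<W>) \<R>" "hered_cotorsion (opposite C) (\<W> \<inter> \<R>) \<Q>"
    using m unfolding abelian_model_def by simp_all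
  obtain q1 d1 e1 \<alpha> \<beta> where p: "half_resolution C (\<Q> \<inter> \<W>) \<R> (Cod C f) q1 d1 e1"
    "\<And>i. \<alpha> i \<in> Hom C (ob X (int i)) (q1 i)" "\<And>i. \<beta> i \<in> Hom C (q1 i) (ob Y (int i))" "\<And>i. short_exact C (\<alpha> i) (\<beta> i)"
    "e1 \<cdot> \<alpha> 0 = f \<cdot> aug X" "aug Y \<cdot> \<beta> 0 = g \<cdot> e1"
    "\<And>i. d1 i \<cdot> \<alpha> (Suc i) = \<alpha> i \<cdot> dif X (int i + 1)" "\<And>i. dif Y (int i + 1) \<cdot> \<beta> (Suc i) = \<beta> i \<cdot> d1 i"
    using half_resolution_horseshoe[OF hc(1) conjunct1[OF x] conjunct1[OF y] fg] by metis
  \<comment> \<open>In the opposite category the sequence is read backwards, so the two rows of maps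
    exchange roles. As \<open>Dom C g = Cod C f\<close>, this half resolves the same middle object
    as the first.\<close>
  have gf: "short_exact (opposite C) g f" "Dom (opposite C) g = A2" "Cod (opposite C) f = A" using fg by simp_all
  obtain q2 d2 e2 \<beta>' \<alpha>' where n: "half_resolution (opposite C) (\<W> \<inter> \<R>) \<Q> (Cod (opposite C) g) q2 d2 e2"
    "\<And>i. \<beta>' i \<in> Hom C (q2 i) (ob Y (- 1 - int i))" "\<And>i. \<alpha>' i \<in> Hom C (ob X (- 1 - int i)) (q2 i)"
    "\<And>i. short_exact C (\<alpha>' i) (\<beta>' i)"
    "\<beta>' 0 \<cdot> e2 = coaug Y \<cdot> g" "\<alpha>' 0 \<cdot> coaug X = e2 \<cdot> f"
    "\<And>i. \<beta>' (Suc i) \<cdot> d2 i = dif Y (- 1 - int i) \<cdot> \<beta>' i" "\<And>i. \<alpha>' (Suc i) \<cdot> dif X (- 1 - int i) = d2 i \<cdot> \<alpha>' i"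
    using abelian_category.half_resolution_horseshoe[OF abelian_opposite hc(2) conjunct1[OF conjunct2[OF y]] conjunct1[OF conjunct2[OF x]] gf]
    unfolding opposite_simps(1,2,5-8) Hom_opposite short_exact_opposite by metis
  let ?V = "\<lparr>ob = glue q1 q2, dif = (\<lambda>i. if i = 0 then e2 \<cdot> e1 else glue d1 d2 (if i > 0 then i - 1 else i)), aug = e1, coaug = e2\<rparr>"
  have e: "(if (- 1 - int i) = 0 then e2 \<cdot> e1 else glue d1 d2 (if (- 1 - int i) > 0 then (- 1 - int i) - 1 else (- 1 - int i))) = d2 i"
    "(if int i + 1 = 0 then e2 \<cdot> e1 else glue d1 d2 (if int i + 1 > 0 then int i + 1 - 1 else int i + 1)) = d1 i" for i
    by simp_all
  have V: "M_resolution C \<Q> \<W> \<R> (Cod C f) ?V"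
    unfolding M_resolution_iff resolution.simps e using p(1) n(1) s(3) by simp
  show thesis
  proof (rule that[OF V])
    show "chain_lift C X ?V f (glue \<alpha> \<alpha>')"
      by (rule chain_lift_glue[OF X V]; (unfold resolution.simps e)?) (use fg(2) p n s in \<open>simp_all\<close>)
    have V': "M_resolution C \<Q> \<W> \<R> (Dom C g) ?V" using V s(3) by simp
    show "chain_lift C ?V Y g (glue \<beta> \<beta>')"
      by (rule chain_lift_glue[OF V' Y]; (unfold resolution.simps e)?) (use fg(3) p n s in \<open>simp_all\<close>)
    show "short_exact C (glue \<alpha> \<alpha>' i) (glue \<beta> \<beta>' i)" for i
      by (cases i rule: int_half_cases) (use p(4) n(4) in simp_all)
  qed
qed

end

section \<open>Cohomology of Hom complexes\<close>

definition chain_complex :: "('o, 'm) lincat \<Rightarrow> ('o, 'm) resolution \<Rightarrow> bool" where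
  "chain_complex C X \<longleftrightarrow> (\<forall>i. dif X i \<in> Hom C (ob X i) (ob X (i - 1)) \<and>
    dif X i \<cdot>\<^bsub>C\<^esub> dif X (i + 1) = Zer C (ob X (i + 1)) (ob X (i - 1)))"

definition hom_cocycles :: "('o, 'm) lincat \<Rightarrow> ('o, 'm) resolution \<Rightarrow> 'o \<Rightarrow> int \<Rightarrow> 'm set" where
  "hom_cocycles C X B n = {c \<in> Hom C (ob X n) B. c \<cdot>\<^bsub>C\<^esub> dif X (n + 1) = Zer C (ob X (n + 1)) B}"

text \<open>Both source complex and coefficient object may change, so that one notion covers
  postcomposition with a morphism of coefficients and precomposition with a chain lift.\<close>

definition cochain_map ::
  "('o, 'm) lincat \<Rightarrow> ('o, 'm) resolution \<Rightarrow> 'o \<Rightarrow> ('o, 'm) resolution \<Rightarrow> 'o \<Rightarrow> (int \<Rightarrow> 'm \<Rightarrow> 'm) \<Rightarrow> bool" where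
  "cochain_map C X B Y B' \<theta> \<longleftrightarrow>
    (\<forall>n. \<forall>c\<in>Hom C (ob X n) B. \<theta> n c \<in> Hom C (ob Y n) B' \<and>
      \<theta> (n + 1) (c \<cdot>\<^bsub>C\<^esub> dif X (n + 1)) = \<theta> n c \<cdot>\<^bsub>C\<^esub> dif Y (n + 1)) \<and>
    (\<forall>n. \<forall>c\<in>Hom C (ob X n) B. \<forall>c'\<in>Hom C (ob X n) B. \<theta> n (Add C c c') = Add C (\<theta> n c) (\<theta> n c'))"

context abelian_category
begin

text \<open>For negative indices this is part of the definition. At 0 the cokernel is that of
  \<open>coaug X\<close>, as \<open>aug X\<close> is epic, and at 1 it is \<open>A\<close>. Going
  up, the cokernel of \<open>dif X (i + 1)\<close> is the kernel of an epimorphism from the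
  cofibrant term \<open>ob X (i - 1)\<close> onto the cofibrant cokernel of
  \<open>dif X i\<close>.\<close>

lemma M_resolution_cokernel_left:
  assumes m: "abelian_model C \<Q> \<W> \<R>" and X: "M_resolution C \<Q> \<W> \<R> A X" and A: "A \<in> \<Q>"
    and c: "is_cokernel C c (dif X n)"
  shows "Cod C c \<in> \<Q>"
proof -
  note x = M_resolutionD[OF X]
  have hc: "hered_cotorsion C \<Q> (\<W> \<inter> \<R>)" using m unfolding abelian_model_def by blast
  have neg: "Cod C c \<in> \<Q>" if "is_cokernel C c (dif X n)" "n \<le> 0" for c n
  proof (cases "n = 0")
    case True
    obtain c' where c': "is_cokernel C c' (coaug X)" "Cod C c' \<in> \<Q>"
      using X unfolding M_resolution_def by blast
    have "epic C (aug X)" using X unfolding M_resolution_def by blast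
    then have "is_cokernel C c' (dif X 0)" unfolding x(13) by (intro is_cokernel_Cmp_epic[OF c'(1)]) (use x in simp_all)
    then show ?thesis using hered_cotorsion_cokernel[OF hc _ that(1)] c'(2) True by simp
  next
    case False
    then have "n \<le> -1" using that(2) by simp
    then obtain c' where c': "is_cokernel C c' (dif X n)" "Cod C c' \<in> \<Q>"
      using X unfolding M_resolution_def by blast
    then show ?thesis using hered_cotorsion_cokernel[OF hc _ that(1)] by simp
  qed
  have "\<forall>c. is_cokernel C c (dif X (1 + int k)) \<longrightarrow> Cod C c \<in> \<Q>" for k
  proof (induction k)
    case 0
    have "is_cokernel C (aug X) (dif X 1)"
      using X unfolding M_resolution_def by (intro exact_epic_cokernel) blast+
    then show ?case using hered_cotorsion_cokernel[OF hc] A x(9) by auto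
  next
    case (Suc k)
    show ?case
    proof (intro allI impI)
      fix c assume c: "is_cokernel C c (dif X (1 + int (Suc k)))"
      then have c: "is_cokernel C c (dif X (1 + int k + 1))" by (simp add: ac_simps)
      obtain e where e: "is_cokernel C e (dif X (1 + int k))" using ex_cokernel x(1) by blast
      obtain m where m: "m \<in> Hom C (Cod C c) (Cod C (dif X (1 + int k)))" "short_exact C m e"
        by (rule exact_cokernel_short_exact[OF x(4) c e])
      have "Dom C m \<in> \<Q>"
        by (rule hered_cotorsion_left_kernel[OF hc m(2)]) (use Suc e m x(3) x(16) in simp_all)
      then show "Cod C c \<in> \<Q>" using m by simp
    qed
  qed
  from this[of "nat (n - 1)"] show ?thesis using c neg[of c n] by (cases "n \<le> 0") auto
qed

text \<open>Each term is an extension of two successive cokernels of differentials. This reaches the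
  negative degrees, whose terms are by definition only trivially fibrant.\<close>

lemma M_resolution_ob_left:
  assumes m: "abelian_model C \<Q> \<W> \<R>" and X: "M_resolution C \<Q> \<W> \<R> A X" and A: "A \<in> \<Q>"
  shows "ob X n \<in> \<Q> \<inter> \<W>"
proof -
  note x = M_resolutionD[OF X]
  have hc: "hered_cotorsion C \<Q> (\<W> \<inter> \<R>)" using m unfolding abelian_model_def by blast
  obtain c where c: "is_cokernel C c (dif X (n + 1 + 1))" using ex_cokernel x(1) by blast
  obtain e where e: "is_cokernel C e (dif X (n + 1))" using ex_cokernel x(1) by blast
  obtain l where l: "l \<in> Hom C (Cod C c) (Cod C (dif X (n + 1)))" "short_exact C l e"
    by (rule exact_cokernel_short_exact[OF x(4) c e])
  have "Cod C l \<in> \<Q>"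
    by (rule hered_cotorsion_left_middle[OF hc l(2)])
      (use l M_resolution_cokernel_left[OF m X A] c e in simp_all)
  then show ?thesis using l x by simp
qed

text \<open>All terms are in \<open>\<W>\<close>, so thickness transfers membership between
  neighbouring cokernels in both directions. The induction starts at index 1, where the cokernel is
  isomorphic to the trivially cofibrant object \<open>A\<close>.\<close>

lemma M_resolution_cokernel_trivial:
  assumes m: "abelian_model C \<Q> \<W> \<R>" and X: "M_resolution C \<Q> \<W> \<R> A X" and A: "A \<in> \<Q>" "A \<in> \<W>"
    and c: "is_cokernel C c (dif X n)"
  shows "Cod C c \<in> \<W>"
proof -
  note x = M_resolutionD[OF X]
  have hc: "hered_cotorsion C (\<Q> \<inter> \<W>) \<R>" and t: "thick C \<W>" using m unfolding abelian_model_def by blast+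
  have step: "Cod C c \<in> \<W> \<longleftrightarrow> Cod C e \<in> \<W>"
    if c: "is_cokernel C c (dif X (n + 1))" and e: "is_cokernel C e (dif X n)" for c e n
  proof -
    obtain m where m: "m \<in> Hom C (Cod C c) (Cod C (dif X n))" "short_exact C m e"
      by (rule exact_cokernel_short_exact[OF x(4) c e])
    then have "Dom C m = Cod C c" "Cod C m \<in> \<W>" using x(3,15) by simp_all
    then show ?thesis using t m(2) unfolding thick_def by metis
  qed
  have "\<forall>c. is_cokernel C c (dif X n) \<longrightarrow> Cod C c \<in> \<W>"
  proof (induction n rule: int_induct[where k = 1])
    case base
    have "is_cokernel C (aug X) (dif X 1)"
      using X unfolding M_resolution_def by (intro exact_epic_cokernel) blast+
    then show ?case using hered_cotorsion_cokernel[OF hc, of "aug X" "dif X 1"] A x(9) by auto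
  next
    case (step1 i)
    obtain e where e: "is_cokernel C e (dif X i)" using ex_cokernel x(1) by blast
    then show ?case using step[OF _ e] step1 by blast
  next
    case (step2 i)
    obtain c where c: "is_cokernel C c (dif X (i - 1 + 1))" using ex_cokernel x(1) by blast
    then show ?case using step[OF c] step2 by simp
  qed
  then show ?thesis using c by blast
qed

lemma M_resolution_kernel_right:
  assumes m: "abelian_model C \<Q> \<W> \<R>" and X: "M_resolution C \<Q> \<W> \<R> A X" and A: "A \<in> \<R>"
    and k: "is_kernel C k (dif X n)"
  shows "Dom C k \<in> \<R>"
  using abelian_category.M_resolution_cokernel_left[OF abelian_opposite _ M_resolution_opposite[OF X] A, of k "- n"]
    m k by (simp add: dual_resolution_def)

text \<open>The obstruction to writing a cocycle as a coboundary lies in Ext^1 of the cokernel of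
  \<open>dif X n\<close>, a cofibrant object, with values in the trivially fibrant
  \<open>Z\<close>.\<close>

lemma M_resolution_extend:
  assumes m: "abelian_model C \<Q> \<W> \<R>" and X: "M_resolution C \<Q> \<W> \<R> A X" and A: "A \<in> \<Q>" and Z: "Z \<in> \<W> \<inter> \<R>"
    and u: "u \<in> Hom C (ob X n) Z" "u \<cdot> dif X (n + 1) = Zer C (ob X (n + 1)) Z"
  shows "\<exists>e \<in> Hom C (ob X (n - 1)) Z. e \<cdot> dif X n = u"
proof -
  note x = M_resolutionD[OF X]
  have hc: "hered_cotorsion C \<Q> (\<W> \<inter> \<R>)" using m unfolding abelian_model_def by blast
  obtain c where c: "is_cokernel C c (dif X n)" using ex_cokernel x(1) by blast
  have "Ext1_split C (Cod C c) Z" by (rule hered_cotorsionD(3)[OF hc M_resolution_cokernel_left[OF m X A c] Z])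
  from extend_exact[OF x(4) c this] u x show ?thesis by (metis Hom_iff)
qed

text \<open>The image of \<open>dif X n\<close> is fibrant and the cokernel trivially cofibrant, so that the inclusion
  of the former splits.\<close>

lemma M_resolution_core_extend:
  assumes m: "abelian_model C \<Q> \<W> \<R>" and X: "M_resolution C \<Q> \<W> \<R> A X" and A: "A \<in> \<Q> \<inter> \<W> \<inter> \<R>"
    and u: "u \<in> Hom C (ob X n) B" "u \<cdot> dif X (n + 1) = Zer C (ob X (n + 1)) B"
  shows "\<exists>e \<in> Hom C (ob X (n - 1)) B. e \<cdot> dif X n = u"
proof -
  note x = M_resolutionD[OF X]
  have hc: "hered_cotorsion C (\<Q> \<inter> \<W>) \<R>" using m unfolding abelian_model_def by blast
  obtain c where c: "is_cokernel C c (dif X n)" using ex_cokernel x(1) by blast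
  have e: "exact C (dif X n) (dif X (n - 1))" using x(4)[of "n - 1"] by simp
  obtain k where k: "is_kernel C k (dif X (n - 1))" using ex_kernel x(1) by blast
  note ks = is_kernelD[OF k]
  obtain f' where f': "f' \<in> Hom C (Dom C (dif X n)) (Dom C k)" "k \<cdot> f' = dif X n" "epic C f'"
    by (rule exact_kernel_epic[OF e k])
  have f's: "f' \<in> Arr C" "Dom C f' = ob X n" "Cod C f' = Dom C k" using f'(1) x(2) by simp_all
  have "Ext1_split C (Cod C c) (Dom C k)"
    using hered_cotorsionD(3)[OF hc] M_resolution_cokernel_left[OF m X _ c] M_resolution_cokernel_trivial[OF m X _ _ c]
      M_resolution_kernel_right[OF m X _ k] A by simp
  moreover have "f' \<cdot> dif X (n + 1) = Zer C (ob X (n + 1)) (Dom C k)"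
    using monicD[OF is_kernel_monic[OF k], of "f' \<cdot> dif X (n + 1)"] Cmp_rewr[OF f'(2), of "dif X (n + 1)"] f's ks(1-3) x(1-3,6)
    by simp
  ultimately obtain r where r: "r \<in> Hom C (Cod C (dif X n)) (Dom C k)" "r \<cdot> dif X n = f'"
    using extend_exact[OF x(4) c, of "Dom C k" f'] f's x(2) by (metis Hom_iff)
  \<comment> \<open>The object \<open>B\<close> is arbitrary, so \<open>u\<close> is not extended by
    orthogonality. By exactness it factors through the image of \<open>dif X n\<close>, and the
    factor is composed with \<open>r\<close>.\<close>
  obtain l where l: "is_kernel C l f'" using ex_kernel f's by blast
  note ls = is_kernelD[OF l]
  have "dif X n \<cdot> l = Zer C (Dom C l) (Cod C (dif X n))"
    using Cmp_rewr[OF f'(2), of l] ls f's ks(1-3) x(1-3) by simp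
  then have "u \<cdot> l = Zer C (Dom C l) (Cod C u)"
    using exact_vanish[OF x(4)[of n], of l u] ls f's u x(1-3) by simp
  then obtain u' where u': "u' \<in> Hom C (Cod C f') (Cod C u)" "u' \<cdot> f' = u"
    using is_cokernel_factor[OF exact_epic_cokernel[OF kernel_exact[OF l] f'(3)], of u] u f's ls(3) by auto
  have "(u' \<cdot> r) \<cdot> dif X n = u" "u' \<cdot> r \<in> Hom C (ob X (n - 1)) B"
    using u' r f's x(1-3) u by simp_all
  then show ?thesis by blast
qed

section \<open>Cocycles, coboundaries and cohomology classes of Hom complexes\<close>

lemma chain_complex_M_resolution: "M_resolution C \<Q> \<W> \<R> A X \<Longrightarrow> chain_complex C X"
  unfolding chain_complex_def using M_resolutionD(1-3,6) by auto

lemma chain_complexD: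
  assumes "chain_complex C X"
  shows "dif X i \<in> Arr C" "Dom C (dif X i) = ob X i" "Cod C (dif X i) = ob X (i - 1)" "ob X i \<in> Obj C"
    "dif X i \<cdot> dif X (i + 1) = Zer C (ob X (i + 1)) (ob X (i - 1))" "dif X (i - 1) \<cdot> dif X i = Zer C (ob X i) (ob X (i - 1 - 1))"
proof -
  have *: "dif X i \<in> Hom C (ob X i) (ob X (i - 1))" using assms unfolding chain_complex_def by blast
  then show "dif X i \<in> Arr C" "Dom C (dif X i) = ob X i" "Cod C (dif X i) = ob X (i - 1)" "ob X i \<in> Obj C"
    using Hom_Obj[OF *] by simp_all
  have "\<And>i. dif X i \<cdot> dif X (i + 1) = Zer C (ob X (i + 1)) (ob X (i - 1))"
    using assms unfolding chain_complex_def by blast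
  from this[of i] this[of "i - 1"] show "dif X i \<cdot> dif X (i + 1) = Zer C (ob X (i + 1)) (ob X (i - 1))"
    "dif X (i - 1) \<cdot> dif X i = Zer C (ob X i) (ob X (i - 1 - 1))" by simp_all
qed

abbreviation cohom :: "('a, 'b) resolution \<Rightarrow> 'a \<Rightarrow> int \<Rightarrow> 'b set monoid" where
  "cohom X B \<equiv> cohomology (hom_complex C X B)"

abbreviation cls :: "('a, 'b) resolution \<Rightarrow> 'a \<Rightarrow> int \<Rightarrow> 'b \<Rightarrow> 'b set" where
  "cls X B \<equiv> cohomology_class (hom_complex C X B)"

lemma hom_cocyclesD:
  assumes "c \<in> hom_cocycles C X B n"
  shows "c \<in> Arr C" "Dom C c = ob X n" "Cod C c = B" "c \<cdot> dif X (n + 1) = Zer C (ob X (n + 1)) B"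
    "c \<in> Hom C (ob X n) B"
  using assms by (simp_all add: hom_cocycles_def)

lemma hom_cocycles_Sub:
  assumes "chain_complex C X" "B \<in> Obj C" "c \<in> hom_cocycles C X B n" "c' \<in> hom_cocycles C X B n"
  shows "c \<oplus> c' \<in> hom_cocycles C X B n" "c \<ominus> c' \<in> hom_cocycles C X B n"
  using assms(2-4) chain_complexD[OF assms(1)] by (simp_all add: hom_cocycles_def)

lemma hom_cocycles_coboundary:
  assumes "chain_complex C X" "B \<in> Obj C" "e \<in> Hom C (ob X (n - 1)) B"
  shows "e \<cdot> dif X n \<in> hom_cocycles C X B n"
  using assms(2,3) chain_complexD[OF assms(1)] by (simp add: hom_cocycles_def)

lemma Zer_hom_cocycles: "chain_complex C X \<Longrightarrow> B \<in> Obj C \<Longrightarrow> Zer C (ob X n) B \<in> hom_cocycles C X B n"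
  using chain_complexD by (simp add: hom_cocycles_def)

lemma inv_hom_group:
  assumes "c \<in> Hom C A B"
  shows "inv\<^bsub>hom_group C A B\<^esub> c = Zer C A B \<ominus> c"
proof -
  interpret H: comm_group "hom_group C A B" using Hom_Obj[OF assms] by (simp add: hom_comm_group)
  have "Zer C A B \<ominus> c = \<one>\<^bsub>hom_group C A B\<^esub> \<otimes>\<^bsub>hom_group C A B\<^esub> inv\<^bsub>hom_group C A B\<^esub> c"
    using assms by (simp add: Sub_def)
  also have "\<dots> = inv\<^bsub>hom_group C A B\<^esub> c" using assms by (intro H.l_one H.inv_closed) simp
  finally show ?thesis ..
qed

lemma subgroup_hom_groupI:
  assumes "A \<in> Obj C" "B \<in> Obj C" "S \<subseteq> Hom C A B" "Zer C A B \<in> S" "\<And>x y. x \<in> S \<Longrightarrow> y \<in> S \<Longrightarrow> x \<oplus> y \<in> S"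
    "\<And>x. x \<in> S \<Longrightarrow> Zer C A B \<ominus> x \<in> S"
  shows "subgroup S (hom_group C A B)"
proof -
  interpret H: comm_group "hom_group C A B" using assms by (simp add: hom_comm_group)
  show ?thesis
  proof (rule H.subgroupI)
    show "inv\<^bsub>hom_group C A B\<^esub> a \<in> S" if "a \<in> S" for a
      using inv_hom_group[of a A B] assms(3,6) that by (metis subsetD)
  qed (use assms in auto)
qed

lemma cocycles_hom_complex:
  "cocycles (hom_complex C X B) n = (hom_group C (ob X n) B)\<lparr>carrier := hom_cocycles C X B n\<rparr>"
  by (simp add: cocycles_def hom_complex_def kernel_def hom_cocycles_def)

lemma coboundaries_hom_complex:
  "coboundaries (hom_complex C X B) n = (\<lambda>e. e \<cdot> dif X n) ` Hom C (ob X (n - 1)) B"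
  by (simp add: coboundaries_def hom_complex_def)

lemma subgroup_cocycles:
  assumes "chain_complex C X" "B \<in> Obj C"
  shows "subgroup (hom_cocycles C X B n) (hom_group C (ob X n) B)"
proof (rule subgroup_hom_groupI)
  show "hom_cocycles C X B n \<subseteq> Hom C (ob X n) B" by (auto simp: hom_cocycles_def)
qed (use assms chain_complexD(4)[OF assms(1)] hom_cocycles_Sub[OF assms] Zer_hom_cocycles[OF assms] in simp_all)

lemma comm_group_cocycles:
  assumes "chain_complex C X" "B \<in> Obj C"
  shows "comm_group (cocycles (hom_complex C X B) n)"
proof -
  interpret H: comm_group "hom_group C (ob X n) B" using assms chain_complexD(4) by (simp add: hom_comm_group)
  note sub = subgroup_cocycles[OF assms, of n]
  show ?thesis
    unfolding cocycles_hom_complex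
    by (rule group.group_comm_groupI[OF subgroup.subgroup_is_group[OF sub H.is_group]])
      (simp add: Add_commute hom_cocycles_def)
qed

lemma subgroup_coboundaries:
  assumes "chain_complex C X" "B \<in> Obj C"
  shows "subgroup (coboundaries (hom_complex C X B) n) (cocycles (hom_complex C X B) n)"
proof -
  note x = chain_complexD[OF assms(1)]
  interpret H: comm_group "hom_group C (ob X n) B" using assms x by (simp add: hom_comm_group)
  have "subgroup (coboundaries (hom_complex C X B) n) (hom_group C (ob X n) B)"
    unfolding coboundaries_hom_complex
  proof (rule subgroup_hom_groupI)
    let ?S = "(\<lambda>e. e \<cdot> dif X n) ` Hom C (ob X (n - 1)) B"
    show "?S \<subseteq> Hom C (ob X n) B" using x assms(2) by auto
    show "Zer C (ob X n) B \<in> ?S"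
      using x assms(2) by (intro image_eqI[of _ _ "Zer C (ob X (n - 1)) B"]) simp_all
    fix y assume y: "y \<in> ?S"
    then obtain e where e: "e \<in> Hom C (ob X (n - 1)) B" "y = e \<cdot> dif X n" by blast
    then show "Zer C (ob X n) B \<ominus> y \<in> ?S"
      using x assms(2) by (intro image_eqI[of _ _ "Zer C (ob X (n - 1)) B \<ominus> e"]) simp_all
    fix z assume "z \<in> ?S"
    then obtain e' where "e' \<in> Hom C (ob X (n - 1)) B" "z = e' \<cdot> dif X n" by blast
    then show "y \<oplus> z \<in> ?S"
      using x assms(2) e by (intro image_eqI[of _ _ "e \<oplus> e'"]) simp_all
  qed (use x assms in simp_all)
  moreover have "coboundaries (hom_complex C X B) n \<subseteq> hom_cocycles C X B n"
    using hom_cocycles_coboundary[OF assms] unfolding coboundaries_hom_complex by blast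
  ultimately show ?thesis
    using H.subgroup_incl[OF _ subgroup_cocycles[OF assms]] unfolding cocycles_hom_complex by blast
qed

lemma comm_group_cohomology:
  assumes "chain_complex C X" "B \<in> Obj C"
  shows "comm_group (cohom X B n)"
  unfolding cohomology_def
  by (rule comm_group.abelian_FactGroup[OF comm_group_cocycles[OF assms] subgroup_coboundaries[OF assms]])

lemma carrier_cohomology:
  "carrier (cohom X B n) = cls X B n ` hom_cocycles C X B n"
  by (auto simp: cohomology_def FactGroup_def RCOSETS_def cohomology_class_def cocycles_hom_complex)

lemma cohomology_class_iff:
  "y \<in> cls X B n c \<longleftrightarrow> (\<exists>e \<in> Hom C (ob X (n - 1)) B. y = e \<cdot> dif X n \<oplus> c)"
  by (auto simp: cohomology_class_def r_coset_def coboundaries_hom_complex cocycles_hom_complex)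

lemma cohomology_class_eqI:
  assumes "chain_complex C X" "B \<in> Obj C" "c' \<in> hom_cocycles C X B n"
    "e \<in> Hom C (ob X (n - 1)) B" "c = e \<cdot> dif X n \<oplus> c'"
  shows "cls X B n c = cls X B n c'"
proof -
  interpret Z: comm_group "cocycles (hom_complex C X B) n" by (rule comm_group_cocycles[OF assms(1,2)])
  have "c \<in> cls X B n c'" unfolding cohomology_class_iff using assms(4,5) by blast
  then show ?thesis
    unfolding cohomology_class_def
    using Z.repr_independence[of c _ c', OF _ _ subgroup_coboundaries[OF assms(1,2)]] assms(3)
    by (simp add: cocycles_hom_complex)
qed

lemma cohomology_class_eqD:
  assumes "chain_complex C X" "B \<in> Obj C" "c \<in> hom_cocycles C X B n"
    "cls X B n c = cls X B n c'"
  obtains e where "e \<in> Hom C (ob X (n - 1)) B" "c = e \<cdot> dif X n \<oplus> c'"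
proof -
  have "c = Zer C (ob X (n - 1)) B \<cdot> dif X n \<oplus> c"
    using hom_cocyclesD[OF assms(3)] chain_complexD[OF assms(1)] assms(2) by simp
  then have "c \<in> cls X B n c"
    unfolding cohomology_class_iff using chain_complexD(4)[OF assms(1)] assms(2)
    by (intro bexI[of _ "Zer C (ob X (n - 1)) B"]) simp_all
  then show thesis using that unfolding assms(4) cohomology_class_iff by blast
qed

lemma cohomology_class_mult:
  assumes "chain_complex C X" "B \<in> Obj C" "c \<in> hom_cocycles C X B n" "c' \<in> hom_cocycles C X B n"
  shows "cls X B n c \<otimes>\<^bsub>cohom X B n\<^esub> cls X B n c'
    = cls X B n (c \<oplus> c')"
proof -
  interpret Z: comm_group "cocycles (hom_complex C X B) n" by (rule comm_group_cocycles[OF assms(1,2)])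
  have "coboundaries (hom_complex C X B) n \<lhd> cocycles (hom_complex C X B) n"
    using subgroup_coboundaries[OF assms(1,2)] Z.normal_iff_subgroup by blast
  from normal.rcos_sum[OF this, of c c'] show ?thesis
    using assms(3,4) by (simp add: cohomology_def FactGroup_def cohomology_class_def cocycles_hom_complex)
qed

lemma cohomology_one:
  assumes "chain_complex C X" "B \<in> Obj C"
  shows "\<one>\<^bsub>cohom X B n\<^esub> = cls X B n (Zer C (ob X n) B)"
proof -
  interpret Z: comm_group "cocycles (hom_complex C X B) n" by (rule comm_group_cocycles[OF assms])
  have "coboundaries (hom_complex C X B) n \<subseteq> carrier (cocycles (hom_complex C X B) n)"
    using subgroup.subset[OF subgroup_coboundaries[OF assms]] .
  from Z.coset_mult_one[OF this] show ?thesis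
    by (simp add: cohomology_def FactGroup_def cohomology_class_def cocycles_hom_complex)
qed

lemma cochain_mapD:
  assumes "cochain_map C X B Y B' \<theta>"
  shows "c \<in> Hom C (ob X n) B \<Longrightarrow> \<theta> n c \<in> Hom C (ob Y n) B'"
    "c \<in> Hom C (ob X n) B \<Longrightarrow> \<theta> (n + 1) (c \<cdot> dif X (n + 1)) = \<theta> n c \<cdot> dif Y (n + 1)"
    "c \<in> Hom C (ob X (n - 1)) B \<Longrightarrow> \<theta> n (c \<cdot> dif X n) = \<theta> (n - 1) c \<cdot> dif Y n"
    "c \<in> Hom C (ob X n) B \<Longrightarrow> c' \<in> Hom C (ob X n) B \<Longrightarrow> \<theta> n (c \<oplus> c') = \<theta> n c \<oplus> \<theta> n c'"
    "c \<in> Hom C (ob X n) B \<Longrightarrow> c' \<in> Hom C (ob X n) B \<Longrightarrow> \<theta> n (c \<ominus> c') = \<theta> n c \<ominus> \<theta> n c'"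
    "ob X n \<in> Obj C \<Longrightarrow> B \<in> Obj C \<Longrightarrow> \<theta> n (Zer C (ob X n) B) = Zer C (ob Y n) B'"
proof -
  show 1: "c \<in> Hom C (ob X n) B \<Longrightarrow> \<theta> n c \<in> Hom C (ob Y n) B'" for c n
    using assms unfolding cochain_map_def by blast
  have 2: "c \<in> Hom C (ob X n) B \<Longrightarrow> \<theta> (n + 1) (c \<cdot> dif X (n + 1)) = \<theta> n c \<cdot> dif Y (n + 1)" for n
    using assms unfolding cochain_map_def by blast
  then show "c \<in> Hom C (ob X n) B \<Longrightarrow> \<theta> (n + 1) (c \<cdot> dif X (n + 1)) = \<theta> n c \<cdot> dif Y (n + 1)" .
  show "c \<in> Hom C (ob X (n - 1)) B \<Longrightarrow> \<theta> n (c \<cdot> dif X n) = \<theta> (n - 1) c \<cdot> dif Y n" using 2[of "n - 1"] by simp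
  show 3: "c \<in> Hom C (ob X n) B \<Longrightarrow> c' \<in> Hom C (ob X n) B \<Longrightarrow> \<theta> n (c \<oplus> c') = \<theta> n c \<oplus> \<theta> n c'" for c c' n
    using assms unfolding cochain_map_def by blast
  show 4: "\<theta> n (c \<ominus> c') = \<theta> n c \<ominus> \<theta> n c'" if c: "c \<in> Hom C (ob X n) B" "c' \<in> Hom C (ob X n) B" for c c'
  proof -
    have s: "c \<ominus> c' \<in> Hom C (ob X n) B" using c by simp
    have "\<theta> n c = \<theta> n ((c \<ominus> c') \<oplus> c')" using c by simp
    also have "\<dots> = \<theta> n (c \<ominus> c') \<oplus> \<theta> n c'" by (rule 3[OF s c(2)])
    finally show ?thesis using 1[OF s] 1[OF c(1)] 1[OF c(2)] by (intro Sub_eqI[symmetric]) simp_all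
  qed
  show "\<theta> n (Zer C (ob X n) B) = Zer C (ob Y n) B'" if "ob X n \<in> Obj C" "B \<in> Obj C"
    using 4[of "Zer C (ob X n) B" "Zer C (ob X n) B"] 1[of "Zer C (ob X n) B" n] that by simp
qed

lemma cochain_map_cocycle:
  assumes "chain_complex C X" "cochain_map C X B Y B' \<theta>" "B \<in> Obj C" "c \<in> hom_cocycles C X B n"
  shows "\<theta> n c \<in> hom_cocycles C Y B' n"
  using cochain_mapD(1,2)[OF assms(2), of c n] cochain_mapD(6)[OF assms(2), of "n + 1"]
    chain_complexD(4)[OF assms(1)] assms(3) hom_cocyclesD[OF assms(4)]
  unfolding hom_cocycles_def by simp

lemma cohomology_map_class:
  assumes "chain_complex C X" "chain_complex C Y" "cochain_map C X B Y B' \<theta>" "B \<in> Obj C" "B' \<in> Obj C"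
    "c \<in> hom_cocycles C X B n"
  shows "cohomology_map (hom_complex C Y B') n (\<theta> n) (cls X B n c) =
    cls Y B' n (\<theta> n c)"
proof -
  have "cls Y B' n (\<theta> n y) = cls Y B' n (\<theta> n c)"
    if "y \<in> cls X B n c" for y
  proof -
    obtain e where e: "e \<in> Hom C (ob X (n - 1)) B" "y = e \<cdot> dif X n \<oplus> c"
      using \<open>y \<in> _\<close> unfolding cohomology_class_iff by blast
    have "\<theta> n y = \<theta> (n - 1) e \<cdot> dif Y n \<oplus> \<theta> n c"
      using e cochain_mapD(3)[OF assms(3) e(1)] cochain_mapD(4)[OF assms(3), of "e \<cdot> dif X n" n c]
        hom_cocyclesD[OF assms(6)] chain_complexD[OF assms(1)] by simp
    then show ?thesis
      using cochain_map_cocycle[OF assms(1,3,4,6)] cochain_mapD(1)[OF assms(3) e(1)]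
      by (intro cohomology_class_eqI[OF assms(2,5)])
  qed
  moreover have "c \<in> cls X B n c"
    unfolding cohomology_class_iff using hom_cocyclesD[OF assms(6)] chain_complexD[OF assms(1)] assms(4)
    by (intro bexI[of _ "Zer C (ob X (n - 1)) B"]) simp_all
  ultimately show ?thesis unfolding cohomology_map_def by blast
qed

end

section \<open>Long exact sequences\<close>

text \<open>Only the middle groups are replaced along isomorphisms. The connecting maps run between
  the outer groups and can be kept unchanged.\<close>

lemma long_exact_transport:
  assumes le: "long_exact X Y Z i p \<delta>"
    and grp: "\<And>n. group (Y n)" "\<And>n. group (Y' n)"
    and \<tau>: "\<And>n. \<tau> n \<in> hom (Y n) (Y' n)" and \<sigma>: "\<And>n. \<sigma> n \<in> hom (Y' n) (Y n)"
    and \<tau>\<sigma>: "\<And>n y. y \<in> carrier (Y' n) \<Longrightarrow> \<tau> n (\<sigma> n y) = y" and \<sigma>\<tau>: "\<And>n y. y \<in> carrier (Y n) \<Longrightarrow> \<sigma> n (\<tau> n y) = y"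
    and h: "\<And>n. i' n \<in> hom (X n) (Y' n)" "\<And>n. p' n \<in> hom (Y' n) (Z n)"
    and i': "\<And>n x. x \<in> carrier (X n) \<Longrightarrow> i' n x = \<tau> n (i n x)"
    and p': "\<And>n y. y \<in> carrier (Y' n) \<Longrightarrow> p' n y = p n (\<sigma> n y)"
  shows "long_exact X Y' Z i' p' \<delta>"
  unfolding long_exact_def
proof (intro allI conjI h)
  fix n
  have l: "i n \<in> hom (X n) (Y n)" "p n \<in> hom (Y n) (Z n)" "\<delta> n \<in> hom (Z n) (X (n + 1))"
    "i n ` carrier (X n) = kernel (Y n) (Z n) (p n)" "p n ` carrier (Y n) = kernel (Z n) (X (n + 1)) (\<delta> n)"
    "\<delta> n ` carrier (Z n) = kernel (X (n + 1)) (Y (n + 1)) (i (n + 1))" for n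
    using le unfolding long_exact_def by blast+
  have c: "\<tau> n y \<in> carrier (Y' n)" if "y \<in> carrier (Y n)" for n y using \<tau> that by (rule hom_in_carrier)
  have c': "\<sigma> n y \<in> carrier (Y n)" if "y \<in> carrier (Y' n)" for n y using \<sigma> that by (rule hom_in_carrier)
  have c'': "i n x \<in> carrier (Y n)" if "x \<in> carrier (X n)" for n x using l(1) that by (rule hom_in_carrier)
  show "\<delta> n \<in> hom (Z n) (X (n + 1))" by (fact l)
  show "i' n ` carrier (X n) = kernel (Y' n) (Z n) (p' n)"
  proof (intro equalityI subsetI)
    fix y assume "y \<in> i' n ` carrier (X n)"
    then obtain x where x: "x \<in> carrier (X n)" "y = \<tau> n (i n x)" using i' by auto
    then have "i n x \<in> kernel (Y n) (Z n) (p n)" using l(4) by blast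
    then show "y \<in> kernel (Y' n) (Z n) (p' n)"
      using x c c'' p' \<sigma>\<tau> by (simp add: kernel_def)
  next
    fix y assume y: "y \<in> kernel (Y' n) (Z n) (p' n)"
    then have "\<sigma> n y \<in> kernel (Y n) (Z n) (p n)"
      using p'[of y n, symmetric] c' by (simp add: kernel_def)
    then obtain x where x: "x \<in> carrier (X n)" "\<sigma> n y = i n x" using l(4) by blast
    then have "y = i' n x" using y i' \<tau>\<sigma>[of y n] by (simp add: kernel_def)
    then show "y \<in> i' n ` carrier (X n)" using x(1) by blast
  qed
  have "p' n ` carrier (Y' n) = p n ` carrier (Y n)"
  proof (intro equalityI subsetI)
    fix z assume "z \<in> p' n ` carrier (Y' n)"
    then show "z \<in> p n ` carrier (Y n)" using p' c' by auto
  next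
    fix z assume "z \<in> p n ` carrier (Y n)"
    then obtain y where "y \<in> carrier (Y n)" "z = p n y" by blast
    then show "z \<in> p' n ` carrier (Y' n)" using p' c \<sigma>\<tau> by (intro image_eqI[of _ _ "\<tau> n y"]) simp_all
  qed
  then show "p' n ` carrier (Y' n) = kernel (Z n) (X (n + 1)) (\<delta> n)" using l(5) by simp
  have "kernel (X m) (Y' m) (i' m) = kernel (X m) (Y m) (i m)" for m
  proof -
    have "i' m x = \<one>\<^bsub>Y' m\<^esub> \<longleftrightarrow> i m x = \<one>\<^bsub>Y m\<^esub>" if "x \<in> carrier (X m)" for x
      using i'[OF that] \<sigma>\<tau>[OF c''[OF that]] hom_one[OF \<tau>[of m] grp] hom_one[OF \<sigma>[of m] grp(2,1)] by metis
    then show ?thesis unfolding kernel_def by blast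
  qed
  then show "\<delta> n ` carrier (Z n) = kernel (X (n + 1)) (Y' (n + 1)) (i' (n + 1))" using l(6) by simp
qed

context abelian_category
begin

lemma dif_dif_Zer:
  assumes "chain_complex C X" "b \<in> Arr C" "Dom C b = ob X (n - 1)"
  shows "(b \<cdot> dif X n) \<cdot> dif X (n + 1) = Zer C (ob X (n + 1)) (Cod C b)"
  using assms(2,3) chain_complexD[OF assms(1)] by simp

lemma cohomology_class_eq_one_iff:
  assumes "chain_complex C X" "B \<in> Obj C" "c \<in> hom_cocycles C X B n"
  shows "cls X B n c = \<one>\<^bsub>cohom X B n\<^esub> \<longleftrightarrow>
    (\<exists>e \<in> Hom C (ob X (n - 1)) B. c = e \<cdot> dif X n)"
proof -
  note x = chain_complexD[OF assms(1)]
  have e: "e \<cdot> dif X n \<oplus> Zer C (ob X n) B = e \<cdot> dif X n" if "e \<in> Hom C (ob X (n - 1)) B" for e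
    using that x by simp
  show ?thesis
  proof
    assume "cls X B n c = \<one>\<^bsub>cohom X B n\<^esub>"
    then show "\<exists>e \<in> Hom C (ob X (n - 1)) B. c = e \<cdot> dif X n"
      using cohomology_class_eqD[OF assms] e unfolding cohomology_one[OF assms(1,2)] by metis
  next
    assume "\<exists>e \<in> Hom C (ob X (n - 1)) B. c = e \<cdot> dif X n"
    then show "cls X B n c = \<one>\<^bsub>cohom X B n\<^esub>"
      using cohomology_class_eqI[OF assms(1,2) Zer_hom_cocycles[OF assms(1,2)]] e
      unfolding cohomology_one[OF assms(1,2)] by metis
  qed
qed

lemma cohomology_map_hom:
  assumes "chain_complex C X" "chain_complex C Y" "cochain_map C X B Y B' \<theta>" "B \<in> Obj C" "B' \<in> Obj C"
  shows "cohomology_map (hom_complex C Y B') n (\<theta> n) \<in> hom (cohom X B n) (cohom Y B' n)"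
proof (rule homI)
  note cls = cohomology_map_class[OF assms] and coc = cochain_map_cocycle[OF assms(1,3,4)]
  fix S assume "S \<in> carrier (cohom X B n)"
  then obtain c where c: "c \<in> hom_cocycles C X B n" "S = cls X B n c"
    unfolding carrier_cohomology by blast
  show "cohomology_map (hom_complex C Y B') n (\<theta> n) S \<in> carrier (cohom Y B' n)"
    using c coc by (simp add: cls carrier_cohomology)
  fix S' assume "S' \<in> carrier (cohom X B n)"
  then obtain c' where c': "c' \<in> hom_cocycles C X B n" "S' = cls X B n c'"
    unfolding carrier_cohomology by blast
  show "cohomology_map (hom_complex C Y B') n (\<theta> n) (S \<otimes>\<^bsub>cohom X B n\<^esub> S') =
    cohomology_map (hom_complex C Y B') n (\<theta> n) S \<otimes>\<^bsub>cohom Y B' n\<^esub> cohomology_map (hom_complex C Y B') n (\<theta> n) S'"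
    using cochain_mapD(4)[OF assms(3) hom_cocyclesD(5)[OF c(1)] hom_cocyclesD(5)[OF c'(1)]]
    by (simp add: c c' cls coc cohomology_class_mult[OF assms(1,4)] cohomology_class_mult[OF assms(2,5)]
        hom_cocycles_Sub[OF assms(1,4)])
qed

text \<open>The assumptions say that the sequences of Hom groups are short exact in each degree.
  With complexes and coefficients both free, the same chase serves fibrations, where the
  coefficients vary, and cofibrations, where the complexes vary.\<close>

lemma long_exact_hom:
  assumes cX: "chain_complex C X1" "chain_complex C X2" "chain_complex C X3"
    and o: "B1 \<in> Obj C" "B2 \<in> Obj C" "B3 \<in> Obj C"
    and i: "cochain_map C X1 B1 X2 B2 i" and p: "cochain_map C X2 B2 X3 B3 p"
    and inj: "\<And>n a. a \<in> Hom C (ob X1 n) B1 \<Longrightarrow> i n a = Zer C (ob X2 n) B2 \<Longrightarrow> a = Zer C (ob X1 n) B1"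
    and pi: "\<And>n a. a \<in> Hom C (ob X1 n) B1 \<Longrightarrow> p n (i n a) = Zer C (ob X3 n) B3"
    and ex: "\<And>n b. b \<in> Hom C (ob X2 n) B2 \<Longrightarrow> p n b = Zer C (ob X3 n) B3 \<Longrightarrow> \<exists>a \<in> Hom C (ob X1 n) B1. i n a = b"
    and surj: "\<And>n c. c \<in> Hom C (ob X3 n) B3 \<Longrightarrow> \<exists>b \<in> Hom C (ob X2 n) B2. p n b = c"
  shows "\<exists>\<delta>. long_exact (cohom X1 B1) (cohom X2 B2) (cohom X3 B3)
      (\<lambda>n. cohomology_map (hom_complex C X2 B2) n (i n)) (\<lambda>n. cohomology_map (hom_complex C X3 B3) n (p n)) \<delta> \<and>
    connecting (hom_complex C X1 B1) (hom_complex C X2 B2) (hom_complex C X3 B3) i p \<delta>"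
proof -
  note x1 = chain_complexD[OF cX(1)] and x2 = chain_complexD[OF cX(2)] and x3 = chain_complexD[OF cX(3)]
  note im = cochain_mapD[OF i] and pm = cochain_mapD[OF p]
  note one1 = cohomology_class_eq_one_iff[OF cX(1) o(1)] and one2 = cohomology_class_eq_one_iff[OF cX(2) o(2)]
    and one3 = cohomology_class_eq_one_iff[OF cX(3) o(3)]
  note icls = cohomology_map_class[OF cX(1,2) i o(1,2)] and pcls = cohomology_map_class[OF cX(2,3) p o(2,3)]
  note icoc = cochain_map_cocycle[OF cX(1) i o(1)] and pcoc = cochain_map_cocycle[OF cX(2) p o(2)]
  let ?cl1 = "cls X1 B1" and ?cl2 = "cls X2 B2"
    and ?cl3 = "cls X3 B3"
  \<comment> \<open>One path of the snake: \<open>c\<close> lifts to \<open>b\<close>, and the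
    coboundary of \<open>b\<close> comes from \<open>a\<close>.\<close>
  define R where "R n c b a \<longleftrightarrow> b \<in> Hom C (ob X2 n) B2 \<and> a \<in> Hom C (ob X1 (n + 1)) B1 \<and> p n b = c \<and>
    i (n + 1) a = b \<cdot> dif X2 (n + 1)" for n c b a
  have inj2: "a = a'" if "a \<in> Hom C (ob X1 n) B1" "a' \<in> Hom C (ob X1 n) B1" "i n a = i n a'" for a a' n
  proof -
    have "i n (a \<ominus> a') = Zer C (ob X2 n) B2" using im(5)[OF that(1,2)] that(3) im(1)[OF that(2)] by simp
    then have "a \<ominus> a' = Zer C (ob X1 n) B1" using that by (intro inj) simp_all
    then show ?thesis using Sub_eq_Zer_iff[of a a'] that by simp
  qed
  have R_ex: "\<exists>b a. R n c b a" if c: "c \<in> hom_cocycles C X3 B3 n" for n c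
  proof -
    obtain b where b: "b \<in> Hom C (ob X2 n) B2" "p n b = c" using surj hom_cocyclesD(5)[OF c] by blast
    have "p (n + 1) (b \<cdot> dif X2 (n + 1)) = Zer C (ob X3 (n + 1)) B3"
      using pm(2)[OF b(1)] b(2) hom_cocyclesD(4)[OF c] by simp
    then obtain a where "a \<in> Hom C (ob X1 (n + 1)) B1" "i (n + 1) a = b \<cdot> dif X2 (n + 1)"
      using ex[of "b \<cdot> dif X2 (n + 1)" "n + 1"] b x2 by auto
    then show ?thesis using b unfolding R_def by blast
  qed
  have cocI: "a \<in> hom_cocycles C X1 B1 n"
    if a: "a \<in> Hom C (ob X1 n) B1" and z: "i n a \<cdot> dif X2 (n + 1) = Zer C (ob X2 (n + 1)) B2" for a n
  proof -
    have "a \<cdot> dif X1 (n + 1) = Zer C (ob X1 (n + 1)) B1"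
      by (rule inj) (use a z im(2)[OF a] x1 in simp_all)
    then show ?thesis using a by (simp add: hom_cocycles_def)
  qed
  have R_coc: "a \<in> hom_cocycles C X1 B1 (n + 1)" if "R n c b a" for n c b a
  proof (rule cocI)
    have r: "b \<in> Arr C" "Dom C b = ob X2 n" "Cod C b = B2" "i (n + 1) a = b \<cdot> dif X2 (n + 1)"
      using that unfolding R_def by simp_all
    show "i (n + 1) a \<cdot> dif X2 (n + 1 + 1) = Zer C (ob X2 (n + 1 + 1)) B2"
      unfolding r(4) using dif_dif_Zer[OF cX(2) r(1), of "n + 1"] r(2,3) by simp
  qed (use that in \<open>simp_all add: R_def\<close>)
  have R_unique: "?cl1 (n + 1) a = ?cl1 (n + 1) a'"
    if c: "c \<in> hom_cocycles C X3 B3 n" "c' \<in> hom_cocycles C X3 B3 n" "?cl3 n c = ?cl3 n c'"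
      and r: "R n c b a" "R n c' b' a'" for n c c' b b' a a'
  proof -
    have b: "b \<in> Arr C" "Dom C b = ob X2 n" "Cod C b = B2" "b \<in> Hom C (ob X2 n) B2" "p n b = c" "i (n + 1) a = b \<cdot> dif X2 (n + 1)"
      and b': "b' \<in> Arr C" "Dom C b' = ob X2 n" "Cod C b' = B2" "b' \<in> Hom C (ob X2 n) B2" "p n b' = c'" "i (n + 1) a' = b' \<cdot> dif X2 (n + 1)"
      and a: "a \<in> Arr C" "Dom C a = ob X1 (n + 1)" "Cod C a = B1" "a \<in> Hom C (ob X1 (n + 1)) B1"
      and a': "a' \<in> Arr C" "Dom C a' = ob X1 (n + 1)" "Cod C a' = B1" "a' \<in> Hom C (ob X1 (n + 1)) B1"
      using r unfolding R_def by simp_all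
    obtain e where e: "e \<in> Hom C (ob X3 (n - 1)) B3" "c = e \<cdot> dif X3 n \<oplus> c'"
      by (rule cohomology_class_eqD[OF cX(3) o(3) c(1) c(3)])
    \<comment> \<open>Adding the coboundary \<open>l \<cdot> dif X2 n\<close> to \<open>b'\<close>
      gives it the same image under \<open>p\<close> as \<open>b\<close>. The difference then comes
      from some \<open>t\<close>, and the coboundary of \<open>t\<close> is
      \<open>a \<ominus> a'\<close>.\<close>
    obtain l where l: "l \<in> Hom C (ob X2 (n - 1)) B2" "p (n - 1) l = e" using surj e by blast
    have ld: "l \<cdot> dif X2 n \<in> Hom C (ob X2 n) B2" "p n (l \<cdot> dif X2 n) = e \<cdot> dif X3 n"
      "(l \<cdot> dif X2 n) \<cdot> dif X2 (n + 1) = Zer C (ob X2 (n + 1)) B2"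
      using l pm(3)[OF l(1)] x2 o by simp_all
    have b'': "l \<cdot> dif X2 n \<oplus> b' \<in> Hom C (ob X2 n) B2" using ld(1) b' by simp
    have "p n (l \<cdot> dif X2 n \<oplus> b') = c" using pm(4)[OF ld(1) b'(4)] ld(2) b'(5) e(2) by simp
    then have "p n (b \<ominus> (l \<cdot> dif X2 n \<oplus> b')) = Zer C (ob X3 n) B3"
      using pm(5)[OF b(4) b''] b(5) hom_cocyclesD[OF c(1)] by simp
    then obtain t where t: "t \<in> Hom C (ob X1 n) B1" "i n t = b \<ominus> (l \<cdot> dif X2 n \<oplus> b')"
      using ex[of "b \<ominus> (l \<cdot> dif X2 n \<oplus> b')" n] b b'' by auto
    have td: "t \<cdot> dif X1 (n + 1) \<in> Hom C (ob X1 (n + 1)) B1" using t x1 by simp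
    have bd: "b' \<cdot> dif X2 (n + 1) \<in> Hom C (ob X2 (n + 1)) B2" using b' x2 by simp
    have "i (n + 1) (t \<cdot> dif X1 (n + 1)) = (b \<ominus> (l \<cdot> dif X2 n \<oplus> b')) \<cdot> dif X2 (n + 1)"
      using im(2)[OF t(1)] t(2) by simp
    also have "\<dots> = b \<cdot> dif X2 (n + 1) \<ominus> ((l \<cdot> dif X2 n) \<cdot> dif X2 (n + 1) \<oplus> b' \<cdot> dif X2 (n + 1))"
      using b b' ld(1) x2 by (simp del: Cmp_assoc')
    also have "\<dots> = i (n + 1) a \<ominus> i (n + 1) a'" unfolding ld(3) b(6) b'(6) using bd by simp
    also have "\<dots> = i (n + 1) (a \<ominus> a')" using im(5)[OF a(4) a'(4)] by simp
    finally have "t \<cdot> dif X1 (n + 1) = a \<ominus> a'" using a a' by (intro inj2[OF td]) simp_all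
    then have "a = t \<cdot> dif X1 (n + 1) \<oplus> a'" using a a' by simp
    then show ?thesis using t(1) by (intro cohomology_class_eqI[OF cX(1) o(1) R_coc[OF r(2)]]) simp_all
  qed
  define \<delta> where "\<delta> n S = (SOME T. \<exists>c \<in> hom_cocycles C X3 B3 n. \<exists>b a. ?cl3 n c = S \<and> R n c b a \<and> T = ?cl1 (n + 1) a)" for n S
  have \<delta>: "\<delta> n (?cl3 n c) = ?cl1 (n + 1) a" if "c \<in> hom_cocycles C X3 B3 n" "R n c b a" for n c b a
    unfolding \<delta>_def
  proof (rule some_equality)
    show "\<exists>d \<in> hom_cocycles C X3 B3 n. \<exists>b' a'. ?cl3 n d = ?cl3 n c \<and> R n d b' a' \<and> ?cl1 (n + 1) a = ?cl1 (n + 1) a'"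
      using that by blast
  qed (use R_unique that in blast)
  have conn: "connecting (hom_complex C X1 B1) (hom_complex C X2 B2) (hom_complex C X3 B3) i p \<delta>"
    unfolding connecting_def cocycles_hom_complex
  proof (intro allI ballI)
    fix n c assume "c \<in> carrier ((hom_group C (ob X3 n) B3)\<lparr>carrier := hom_cocycles C X3 B3 n\<rparr>)"
    then have c: "c \<in> hom_cocycles C X3 B3 n" by simp
    obtain b a where r: "R n c b a" using R_ex[OF c] by blast
    then show "\<exists>b\<in>carrier (grp (hom_complex C X2 B2) n).
      \<exists>a\<in>carrier ((hom_group C (ob X1 (n + 1)) B1)\<lparr>carrier := hom_cocycles C X1 B1 (n + 1)\<rparr>).
      p n b = c \<and> cobd (hom_complex C X2 B2) n b = i (n + 1) a \<and> \<delta> n (?cl3 n c) = ?cl1 (n + 1) a"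
      using R_coc[OF r] \<delta>[OF c r] by (intro bexI[of _ b] bexI[of _ a]) (simp_all add: R_def hom_complex_def)
  qed
  have "long_exact (cohom X1 B1) (cohom X2 B2) (cohom X3 B3)
      (\<lambda>n. cohomology_map (hom_complex C X2 B2) n (i n)) (\<lambda>n. cohomology_map (hom_complex C X3 B3) n (p n)) \<delta>"
    unfolding long_exact_def
  proof (intro allI conjI)
    fix n
    show "cohomology_map (hom_complex C X2 B2) n (i n) \<in> hom (cohom X1 B1 n) (cohom X2 B2 n)"
      by (rule cohomology_map_hom[OF cX(1,2) i o(1,2)])
    show "cohomology_map (hom_complex C X3 B3) n (p n) \<in> hom (cohom X2 B2 n) (cohom X3 B3 n)"
      by (rule cohomology_map_hom[OF cX(2,3) p o(2,3)])
    show "\<delta> n \<in> hom (cohom X3 B3 n) (cohom X1 B1 (n + 1))"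
    proof (rule homI)
      fix S assume "S \<in> carrier (cohom X3 B3 n)"
      then obtain c where c: "c \<in> hom_cocycles C X3 B3 n" "S = ?cl3 n c" unfolding carrier_cohomology by blast
      obtain b a where r: "R n c b a" using R_ex[OF c(1)] by blast
      show "\<delta> n S \<in> carrier (cohom X1 B1 (n + 1))"
        unfolding c(2) \<delta>[OF c(1) r] carrier_cohomology using R_coc[OF r] by blast
      fix S' assume "S' \<in> carrier (cohom X3 B3 n)"
      then obtain c' where c': "c' \<in> hom_cocycles C X3 B3 n" "S' = ?cl3 n c'" unfolding carrier_cohomology by blast
      obtain b' a' where r': "R n c' b' a'" using R_ex[OF c'(1)] by blast
      \<comment> \<open>Paths of the snake can be added, which makes the connecting map a
        homomorphism.\<close>
      have "R n (c \<oplus> c') (b \<oplus> b') (a \<oplus> a')"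
        using r r' pm(4)[of b n b'] im(4)[of a "n + 1" a'] x2 unfolding R_def by simp
      then show "\<delta> n (S \<otimes>\<^bsub>cohom X3 B3 n\<^esub> S') = \<delta> n S \<otimes>\<^bsub>cohom X1 B1 (n + 1)\<^esub> \<delta> n S'"
        unfolding c(2) c'(2) cohomology_class_mult[OF cX(3) o(3) c(1) c'(1)] \<delta>[OF c(1) r] \<delta>[OF c'(1) r']
          cohomology_class_mult[OF cX(1) o(1) R_coc[OF r] R_coc[OF r']]
        by (intro \<delta> hom_cocycles_Sub[OF cX(3) o(3) c(1) c'(1)])
    qed
    show "cohomology_map (hom_complex C X2 B2) n (i n) ` carrier (cohom X1 B1 n) =
      kernel (cohom X2 B2 n) (cohom X3 B3 n) (cohomology_map (hom_complex C X3 B3) n (p n))"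
    proof (intro equalityI subsetI)
      fix S assume "S \<in> cohomology_map (hom_complex C X2 B2) n (i n) ` carrier (cohom X1 B1 n)"
      then obtain a where a: "a \<in> hom_cocycles C X1 B1 n" "S = ?cl2 n (i n a)"
        unfolding carrier_cohomology using icls by auto
      have "cohomology_map (hom_complex C X3 B3) n (p n) S = \<one>\<^bsub>cohom X3 B3 n\<^esub>"
        unfolding a(2) pcls[OF icoc[OF a(1)]] pi[OF hom_cocyclesD(5)[OF a(1)]] cohomology_one[OF cX(3) o(3)] ..
      then show "S \<in> kernel (cohom X2 B2 n) (cohom X3 B3 n) (cohomology_map (hom_complex C X3 B3) n (p n))"
        using icoc[OF a(1)] a(2) by (simp add: kernel_def carrier_cohomology)
    next
      fix S assume "S \<in> kernel (cohom X2 B2 n) (cohom X3 B3 n) (cohomology_map (hom_complex C X3 B3) n (p n))"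
      then obtain b where b: "b \<in> hom_cocycles C X2 B2 n" "S = ?cl2 n b" "?cl3 n (p n b) = \<one>\<^bsub>cohom X3 B3 n\<^esub>"
        unfolding kernel_def carrier_cohomology using pcls by auto
      note bs = hom_cocyclesD[OF b(1)]
      obtain e where e: "e \<in> Hom C (ob X3 (n - 1)) B3" "p n b = e \<cdot> dif X3 n" using one3[OF pcoc[OF b(1)]] b(3) by blast
      obtain l where l: "l \<in> Hom C (ob X2 (n - 1)) B2" "p (n - 1) l = e" using surj e by blast
      have ld: "l \<cdot> dif X2 n \<in> Hom C (ob X2 n) B2" "p n (l \<cdot> dif X2 n) = e \<cdot> dif X3 n"
        using l pm(3)[OF l(1)] x2 by simp_all
      \<comment> \<open>Changing \<open>b\<close> by a coboundary, which keeps its class, moves it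
        into the kernel of \<open>p n\<close>.\<close>
      have "p n (b \<ominus> l \<cdot> dif X2 n) = Zer C (ob X3 n) B3"
        using pm(5)[OF bs(5) ld(1)] ld(2) e x3 by simp
      then obtain a where a: "a \<in> Hom C (ob X1 n) B1" "i n a = b \<ominus> l \<cdot> dif X2 n"
        using ex[of "b \<ominus> l \<cdot> dif X2 n" n] bs ld(1) by auto
      have z: "b \<ominus> l \<cdot> dif X2 n \<in> hom_cocycles C X2 B2 n"
        by (rule hom_cocycles_Sub(2)[OF cX(2) o(2) b(1) hom_cocycles_coboundary[OF cX(2) o(2) l(1)]])
      have ac: "a \<in> hom_cocycles C X1 B1 n" using hom_cocyclesD(4)[OF z] a by (intro cocI) simp_all
      have "b = l \<cdot> dif X2 n \<oplus> i n a"
        unfolding a(2) using bs ld(1) Add_commute[of "b \<ominus> l \<cdot> dif X2 n" "l \<cdot> dif X2 n"] by simp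
      then have "S = ?cl2 n (i n a)" unfolding b(2) using cohomology_class_eqI[OF cX(2) o(2) icoc[OF ac] l(1)] by blast
      then show "S \<in> cohomology_map (hom_complex C X2 B2) n (i n) ` carrier (cohom X1 B1 n)"
        unfolding carrier_cohomology using icls[OF ac] ac by (metis imageI)
    qed
    show "cohomology_map (hom_complex C X3 B3) n (p n) ` carrier (cohom X2 B2 n) =
      kernel (cohom X3 B3 n) (cohom X1 B1 (n + 1)) (\<delta> n)"
    proof (intro equalityI subsetI)
      fix S assume "S \<in> cohomology_map (hom_complex C X3 B3) n (p n) ` carrier (cohom X2 B2 n)"
      then obtain b where b: "b \<in> hom_cocycles C X2 B2 n" "S = ?cl3 n (p n b)"
        unfolding carrier_cohomology using pcls by auto
      \<comment> \<open>A cocycle \<open>b\<close> is a lift of its own image with zero coboundary,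
        so the path ends at zero.\<close>
      have "R n (p n b) b (Zer C (ob X1 (n + 1)) B1)"
        unfolding R_def using hom_cocyclesD[OF b(1)] im(6)[of "n + 1"] x1(4) o(1) by simp
      then have "\<delta> n S = \<one>\<^bsub>cohom X1 B1 (n + 1)\<^esub>"
        unfolding b(2) cohomology_one[OF cX(1) o(1)] by (rule \<delta>[OF pcoc[OF b(1)]])
      then show "S \<in> kernel (cohom X3 B3 n) (cohom X1 B1 (n + 1)) (\<delta> n)"
        using b(2) pcoc[OF b(1)] by (simp add: kernel_def carrier_cohomology)
    next
      fix S assume "S \<in> kernel (cohom X3 B3 n) (cohom X1 B1 (n + 1)) (\<delta> n)"
      then obtain c where c: "c \<in> hom_cocycles C X3 B3 n" "S = ?cl3 n c" "\<delta> n S = \<one>\<^bsub>cohom X1 B1 (n + 1)\<^esub>"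
        unfolding kernel_def carrier_cohomology by auto
      obtain b a where r: "R n c b a" using R_ex[OF c(1)] by blast
      then have b: "b \<in> Arr C" "Dom C b = ob X2 n" "Cod C b = B2" "b \<in> Hom C (ob X2 n) B2" "p n b = c" "i (n + 1) a = b \<cdot> dif X2 (n + 1)"
        unfolding R_def by simp_all
      have "?cl1 (n + 1) a = \<one>\<^bsub>cohom X1 B1 (n + 1)\<^esub>" using c(2,3) \<delta>[OF c(1) r] by simp
      then obtain t where t: "t \<in> Hom C (ob X1 n) B1" "a = t \<cdot> dif X1 (n + 1)"
        using one1[OF R_coc[OF r]] by auto
      have it: "i n t \<in> Hom C (ob X2 n) B2" "i n t \<cdot> dif X2 (n + 1) = b \<cdot> dif X2 (n + 1)"
        using im(1,2)[OF t(1)] b(6) t(2) by simp_all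
      \<comment> \<open>The lift \<open>b\<close> need not be a cocycle. Its coboundary is that of
        \<open>i n t\<close>, and subtracting the latter does not change the image
        \<open>c\<close>.\<close>
      have bi: "b \<ominus> i n t \<in> hom_cocycles C X2 B2 n" unfolding hom_cocycles_def using b it x2 by simp
      have "p n (b \<ominus> i n t) = c \<ominus> Zer C (ob X3 n) B3" using pm(5)[OF b(4) it(1)] pi[OF t(1)] b(5) by simp
      also have "\<dots> = c" using hom_cocyclesD[OF c(1)] x3(4) o(3) by (intro Sub_eqI) simp_all
      finally have "S = ?cl3 n (p n (b \<ominus> i n t))" using c(2) by simp
      then show "S \<in> cohomology_map (hom_complex C X3 B3) n (p n) ` carrier (cohom X2 B2 n)"
        unfolding carrier_cohomology using pcls[OF bi] bi by (metis imageI)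
    qed
    show "\<delta> n ` carrier (cohom X3 B3 n) =
      kernel (cohom X1 B1 (n + 1)) (cohom X2 B2 (n + 1)) (cohomology_map (hom_complex C X2 B2) (n + 1) (i (n + 1)))"
    proof (intro equalityI subsetI)
      fix S assume "S \<in> \<delta> n ` carrier (cohom X3 B3 n)"
      then obtain c where c: "c \<in> hom_cocycles C X3 B3 n" "S = \<delta> n (?cl3 n c)" unfolding carrier_cohomology by auto
      obtain b a where r: "R n c b a" using R_ex[OF c(1)] by blast
      note ac = R_coc[OF r]
      have S: "S = ?cl1 (n + 1) a" unfolding c(2) by (rule \<delta>[OF c(1) r])
      have "?cl2 (n + 1) (i (n + 1) a) = \<one>\<^bsub>cohom X2 B2 (n + 1)\<^esub>"
        unfolding one2[OF icoc[OF ac]] using r unfolding R_def by (intro bexI[of _ b]) simp_all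
      then show "S \<in> kernel (cohom X1 B1 (n + 1)) (cohom X2 B2 (n + 1)) (cohomology_map (hom_complex C X2 B2) (n + 1) (i (n + 1)))"
        using ac unfolding S kernel_def carrier_cohomology by (simp add: icls[OF ac])
    next
      fix S assume "S \<in> kernel (cohom X1 B1 (n + 1)) (cohom X2 B2 (n + 1)) (cohomology_map (hom_complex C X2 B2) (n + 1) (i (n + 1)))"
      then obtain a where a: "a \<in> hom_cocycles C X1 B1 (n + 1)" "S = ?cl1 (n + 1) a"
        "?cl2 (n + 1) (i (n + 1) a) = \<one>\<^bsub>cohom X2 B2 (n + 1)\<^esub>"
        unfolding kernel_def carrier_cohomology using icls by auto
      obtain b where b: "b \<in> Hom C (ob X2 n) B2" "i (n + 1) a = b \<cdot> dif X2 (n + 1)"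
        using one2[OF icoc[OF a(1)]] a(3) by auto
      have c: "p n b \<in> hom_cocycles C X3 B3 n"
        unfolding hom_cocycles_def using pm(1,2)[OF b(1)] b(2) pi[OF hom_cocyclesD(5)[OF a(1)]] by simp
      have "R n (p n b) b a" unfolding R_def using b hom_cocyclesD(5)[OF a(1)] by simp
      then show "S \<in> \<delta> n ` carrier (cohom X3 B3 n)"
        unfolding carrier_cohomology a(2) using \<delta>[OF c] c by (metis imageI)
    qed
  qed
  then show ?thesis using conn by blast
qed

end

section \<open>The functors \<ell>Ext\<close>

lemma cov_functor_opposite: "cov_functor (opposite C) F \<Phi> = con_functor C F \<Phi>"
  unfolding cov_functor_def con_functor_def opposite_simps Hom_opposite by meson

context abelian_category
begin

section \<open>Chain lifts and their action on cohomology\<close>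

lemma chain_lift_Cmp:
  assumes X: "M_resolution C \<Q> \<W> \<R> A X" and Y: "M_resolution C \<Q> \<W> \<R> A' Y" and Z: "M_resolution C \<Q> \<W> \<R> A'' Z"
    and f: "f \<in> Hom C A A'" "chain_lift C X Y f \<phi>" and g: "g \<in> Hom C A' A''" "chain_lift C Y Z g \<psi>"
  shows "chain_lift C X Z (g \<cdot> f) (\<lambda>i. \<psi> i \<cdot> \<phi> i)"
  unfolding chain_lift_def
proof (intro conjI allI)
  note x = M_resolutionD[OF X] and y = M_resolutionD[OF Y] and z = M_resolutionD[OF Z]
  note p = chain_liftD[OF f(2)] and q = chain_liftD[OF g(2)]
  show "\<psi> i \<cdot> \<phi> i \<in> Hom C (ob X i) (ob Z i)" for i using p(1-3) q(1-3) by simp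
  show "dif Z i \<cdot> \<psi> i \<cdot> \<phi> i = (\<psi> (i - 1) \<cdot> \<phi> (i - 1)) \<cdot> dif X i" for i
  proof -
    have "dif Z i \<cdot> \<psi> i \<cdot> \<phi> i = \<psi> (i - 1) \<cdot> dif Y i \<cdot> \<phi> i"
      using Cmp_rewr[OF q(4)[of i], of "\<phi> i"] p(1-3) q(1-3) x(1-3) y(1-3) z(1-3) by simp
    also have "\<dots> = (\<psi> (i - 1) \<cdot> \<phi> (i - 1)) \<cdot> dif X i" unfolding p(4) using p(1-3) q(1-3) x(1-3) by simp
    finally show ?thesis .
  qed
  have "aug Z \<cdot> \<psi> 0 \<cdot> \<phi> 0 = g \<cdot> aug Y \<cdot> \<phi> 0"
    using Cmp_rewr[OF q(5), of "\<phi> 0"] p(1-3) q(1-3) y(7-9) z(7-9) g by simp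
  also have "\<dots> = (g \<cdot> f) \<cdot> aug X" unfolding p(5) using f g x(7-9) by simp
  finally show "aug Z \<cdot> \<psi> 0 \<cdot> \<phi> 0 = (g \<cdot> f) \<cdot> aug X" .
  have "(\<psi> (-1) \<cdot> \<phi> (-1)) \<cdot> coaug X = \<psi> (-1) \<cdot> coaug Y \<cdot> f" using p q(1-3) x(10-12) by simp
  also have "\<dots> = coaug Z \<cdot> g \<cdot> f"
    using Cmp_rewr[OF q(6), of f] f g q(1-3) y(10-12) z(10-12) by simp
  finally show "(\<psi> (-1) \<cdot> \<phi> (-1)) \<cdot> coaug X = coaug Z \<cdot> g \<cdot> f" .
qed

lemma chain_lift_Ide:
  assumes "M_resolution C \<Q> \<W> \<R> A X" shows "chain_lift C X X (Ide C A) (\<lambda>i. Ide C (ob X i))"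
  using M_resolutionD[OF assms] unfolding chain_lift_def by simp

lemma chain_lift_Add:
  assumes X: "M_resolution C \<Q> \<W> \<R> A X" and Y: "M_resolution C \<Q> \<W> \<R> A' Y"
    and f: "f \<in> Hom C A A'" "chain_lift C X Y f \<phi>" and g: "g \<in> Hom C A A'" "chain_lift C X Y g \<psi>"
  shows "chain_lift C X Y (f \<oplus> g) (\<lambda>i. \<phi> i \<oplus> \<psi> i)" "chain_lift C X Y (f \<ominus> g) (\<lambda>i. \<phi> i \<ominus> \<psi> i)"
  using chain_liftD[OF f(2)] chain_liftD[OF g(2)] M_resolutionD(1-3,7-12)[OF X] M_resolutionD(1-3,7-12)[OF Y] f(1) g(1)
  unfolding chain_lift_def by simp_all

lemma chain_lift_cochain_map:
  assumes "chain_complex C X" "chain_complex C Y" "chain_lift C X Y f \<phi>"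
  shows "cochain_map C Y B X B (\<lambda>n c. c \<cdot> \<phi> n)"
  unfolding cochain_map_def
proof (intro conjI allI ballI)
  note x = chain_complexD[OF assms(1)] and y = chain_complexD[OF assms(2)] and p = chain_liftD[OF assms(3)]
  fix n c assume c: "c \<in> Hom C (ob Y n) B"
  show "c \<cdot> \<phi> n \<in> Hom C (ob X n) B" using c p(1-3) by simp
  show "(c \<cdot> dif Y (n + 1)) \<cdot> \<phi> (n + 1) = (c \<cdot> \<phi> n) \<cdot> dif X (n + 1)"
    using c p(1-3) p(4)[of "n + 1"] x(1-3) y(1-3) by simp
  show "(c \<oplus> c') \<cdot> \<phi> n = c \<cdot> \<phi> n \<oplus> c' \<cdot> \<phi> n" if "c' \<in> Hom C (ob Y n) B" for c'
    using c that p(1-3) by simp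
qed

lemma postcompose_cochain_map:
  assumes "chain_complex C X" "g \<in> Hom C B B'"
  shows "cochain_map C X B X B' (\<lambda>n c. g \<cdot> c)"
  using chain_complexD[OF assms(1)] assms(2) unfolding cochain_map_def by simp

lemma chain_lift_cocycle:
  assumes "chain_complex C X" "chain_complex C Y" "chain_lift C X Y f \<phi>" "B \<in> Obj C" "c \<in> hom_cocycles C Y B n"
  shows "c \<cdot> \<phi> n \<in> hom_cocycles C X B n"
  using cochain_map_cocycle[OF assms(2) chain_lift_cochain_map[OF assms(1-3)] assms(4,5)] .

lemma chain_lift_class:
  assumes "chain_complex C X" "chain_complex C Y" "chain_lift C X Y f \<phi>" "B \<in> Obj C" "c \<in> hom_cocycles C Y B n"
  shows "cohomology_map (hom_complex C X B) n (\<lambda>c. c \<cdot> \<phi> n) (cls Y B n c) =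
    cls X B n (c \<cdot> \<phi> n)"
  using cohomology_map_class[OF assms(2,1) chain_lift_cochain_map[OF assms(1-3)] assms(4,4,5)] .

text \<open>The difference of the lifts is a homotopy expression in \<open>s\<close>. Composed with
  a cocycle \<open>c\<close>, the part through \<open>dif Y (n + 1)\<close> dies, and the coboundary
  of \<open>c \<cdot> s (n - 1)\<close> remains.\<close>

lemma chain_lift_class_unique:
  assumes m: "abelian_model C \<Q> \<W> \<R>" and X: "M_resolution C \<Q> \<W> \<R> A X" and Y: "M_resolution C \<Q> \<W> \<R> A' Y"
    and f: "f \<in> Hom C A A'" and l: "chain_lift C X Y f \<phi>" "chain_lift C X Y f \<psi>"
    and B: "B \<in> Obj C" and c: "c \<in> hom_cocycles C Y B n"
  shows "cls X B n (c \<cdot> \<phi> n) = cls X B n (c \<cdot> \<psi> n)"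
proof -
  note x = M_resolutionD[OF X] and y = M_resolutionD[OF Y] and p = chain_liftD[OF l(1)] and q = chain_liftD[OF l(2)]
  note cs = hom_cocyclesD[OF c] and cX = chain_complex_M_resolution[OF X] and cY = chain_complex_M_resolution[OF Y]
  have "chain_lift C X Y (Zer C A A') (\<lambda>i. \<phi> i \<ominus> \<psi> i)"
    using chain_lift_Add(2)[OF X Y f l(1) f l(2)] f by simp
  from chain_lift_Zer_homotopy[OF m X Y this] obtain s where
    s: "\<And>i. s i \<in> Hom C (ob X i) (ob Y (i + 1))" "\<And>i. \<phi> i \<ominus> \<psi> i = dif Y (i + 1) \<cdot> s i \<oplus> s (i - 1) \<cdot> dif X i"
    by blast
  have s1: "s i \<in> Arr C" "Dom C (s i) = ob X i" "Cod C (s i) = ob Y (i + 1)" for i using s(1)[of i] by simp_all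
  have cd: "c \<cdot> dif Y (n + 1) \<cdot> s n = Zer C (ob X n) B"
    using Cmp_rewr[OF cs(4), of "s n"] s1 cs(1-3) y(1-3,5) B by simp
  have "c \<cdot> \<phi> n = c \<cdot> (\<phi> n \<ominus> \<psi> n) \<oplus> c \<cdot> \<psi> n" using p(1-3) q(1-3) cs(1-3) by simp
  also have "c \<cdot> (\<phi> n \<ominus> \<psi> n) = c \<cdot> (dif Y (n + 1) \<cdot> s n \<oplus> s (n - 1) \<cdot> dif X n)" unfolding s(2) ..
  also have "\<dots> = (c \<cdot> s (n - 1)) \<cdot> dif X n"
    using cd s1 cs(1-3) x(1-3) y(1-3) by simp
  finally have e: "c \<cdot> \<phi> n = (c \<cdot> s (n - 1)) \<cdot> dif X n \<oplus> c \<cdot> \<psi> n" .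
  show ?thesis
    by (rule cohomology_class_eqI[OF cX B chain_lift_cocycle[OF cX cY l(2) B c] _ e]) (use s1 cs(1-3) in simp)
qed

section \<open>Descent to the stable category\<close>

lemma homotopicD:
  assumes "homotopic C \<Z> f g"
  obtains u v Z where "Z \<in> \<Z>" "f \<in> Arr C" "g \<in> Arr C" "Dom C g = Dom C f" "Cod C g = Cod C f"
    "u \<in> Hom C (Dom C f) Z" "v \<in> Hom C Z (Cod C f)" "g = v \<cdot> u \<oplus> f"
proof -
  have f: "f \<in> Arr C" "g \<in> Arr C" "Dom C g = Dom C f" "Cod C g = Cod C f" and "factors_through C \<Z> (g \<ominus> f)"
    using assms by (simp_all add: homotopic_def)
  then obtain Z u v where z: "Z \<in> \<Z>" "u \<in> Hom C (Dom C f) Z" "v \<in> Hom C Z (Cod C f)" "g \<ominus> f = v \<cdot> u"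
    unfolding factors_through_def by auto
  have "g = v \<cdot> u \<oplus> f" using z(4)[symmetric] f by simp
  then show thesis using that f z by blast
qed

text \<open>Reflexivity factors a zero morphism through an object of the class, which is why an
  inhabitant is carried along in the next lemmas. The zero object, which lies in the core, will
  supply it.\<close>

lemma homotopic_refl:
  assumes "Z \<in> \<Z>" "Z \<in> Obj C" "f \<in> Arr C" shows "homotopic C \<Z> f f"
proof -
  have "Zer C (Dom C f) Z \<in> Hom C (Dom C f) Z" "Zer C Z (Cod C f) \<in> Hom C Z (Cod C f)"
    "f \<ominus> f = Zer C Z (Cod C f) \<cdot> Zer C (Dom C f) Z" "Dom C (f \<ominus> f) = Dom C f" "Cod C (f \<ominus> f) = Cod C f"
    using assms(2,3) by simp_all
  then have "factors_through C \<Z> (f \<ominus> f)" unfolding factors_through_def using assms(1) by metis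
  then show ?thesis using assms(3) by (simp add: homotopic_def)
qed

lemma stable_class_rep:
  assumes "Z \<in> \<Z>" "Z \<in> Obj C" "f \<in> Arr C"
  shows "homotopic C \<Z> f (SOME g. g \<in> stable_class C \<Z> f)"
proof -
  have "f \<in> stable_class C \<Z> f" unfolding stable_class_def using homotopic_refl[OF assms] by simp
  then have "(SOME g. g \<in> stable_class C \<Z> f) \<in> stable_class C \<Z> f" by (rule someI)
  then show ?thesis by (simp add: stable_class_def)
qed

lemma stable_rep_Hom:
  assumes Z: "Z \<in> \<Z>" "Z \<in> Obj C" and T: "T \<in> Hom (stable_category C \<Z>) A B"
  shows "(SOME f. f \<in> T) \<in> Hom C A B"
proof -
  obtain f where f: "f \<in> Arr C" "T = stable_class C \<Z> f" using T by (auto simp: Hom_def stable_category_def)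
  have "(SOME f. f \<in> T) \<in> Arr C" using stable_class_rep[OF Z f(1)] f(2) by (simp add: homotopic_def)
  then show ?thesis using T by (simp add: Hom_def stable_category_def)
qed

text \<open>The stable category computes on representatives, so the induced functor applies
  \<open>\<Phi>\<close> to a chosen one. By \<open>h\<close> the value is that at any given
  representative, and every functor law follows from the law for \<open>\<Phi>\<close>.\<close>

lemma cov_factors_stableI:
  assumes Z: "Z \<in> \<Z>" "Z \<in> Obj C" and F: "cov_functor C F \<Phi>"
    and h: "\<And>f g x. homotopic C \<Z> f g \<Longrightarrow> x \<in> carrier (F (Dom C f)) \<Longrightarrow> \<Phi> f x = \<Phi> g x"
  shows "cov_factors_stable C \<Z> F \<Phi>"
  unfolding cov_factors_stable_def
proof (intro exI[of _ "\<lambda>T. \<Phi> (SOME f. f \<in> T)"] conjI ballI)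
  have rep: "\<Phi> (SOME g. g \<in> stable_class C \<Z> f) x = \<Phi> f x" if "f \<in> Arr C" "x \<in> carrier (F (Dom C f))" for f x
    using h[OF stable_class_rep[OF Z that(1)] that(2)] by simp
  then show "\<Phi> (SOME g. g \<in> stable_class C \<Z> f) x = \<Phi> f x" if "f \<in> Arr C" "x \<in> carrier (F (Dom C f))" for f x
    using that .
  note rH = stable_rep_Hom[OF Z]
  have st: "Obj (stable_category C \<Z>) = Obj C" "Ide (stable_category C \<Z>) A = stable_class C \<Z> (Ide C A)"
    "Cmp (stable_category C \<Z>) T S = stable_class C \<Z> ((SOME g. g \<in> T) \<cdot> (SOME f. f \<in> S))"
    "Add (stable_category C \<Z>) T S = stable_class C \<Z> ((SOME g. g \<in> T) \<oplus> (SOME f. f \<in> S))" for A T S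
    by (simp_all add: stable_category_def)
  have F1: "A \<in> Obj C \<Longrightarrow> comm_group (F A)" "A \<in> Obj C \<Longrightarrow> x \<in> carrier (F A) \<Longrightarrow> \<Phi> (Ide C A) x = x"
    "f \<in> Hom C A B \<Longrightarrow> \<Phi> f \<in> hom (F A) (F B)"
    "f \<in> Hom C A B \<Longrightarrow> g \<in> Hom C B D \<Longrightarrow> x \<in> carrier (F A) \<Longrightarrow> \<Phi> (g \<cdot> f) x = \<Phi> g (\<Phi> f x)"
    "f \<in> Hom C A B \<Longrightarrow> g' \<in> Hom C A B \<Longrightarrow> x \<in> carrier (F A) \<Longrightarrow> \<Phi> (f \<oplus> g') x = \<Phi> f x \<otimes>\<^bsub>F B\<^esub> \<Phi> g' x"
    for A B D f g g' x
    using F Hom_Obj[of f A B] Hom_Obj[of g B D] unfolding cov_functor_def by blast+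
  show "cov_functor (stable_category C \<Z>) F (\<lambda>T. \<Phi> (SOME f. f \<in> T))"
    unfolding cov_functor_def st
  proof (intro conjI ballI)
    fix A x assume "A \<in> Obj C" "x \<in> carrier (F A)"
    then show "\<Phi> (SOME f. f \<in> stable_class C \<Z> (Ide C A)) x = x" using rep[of "Ide C A" x] F1(2) by simp
  next
    fix A B T assume "T \<in> Hom (stable_category C \<Z>) A B"
    then show "\<Phi> (SOME f. f \<in> T) \<in> hom (F A) (F B)" using rH F1(3) by blast
  next
    fix A B D S T x assume "S \<in> Hom (stable_category C \<Z>) A B" "T \<in> Hom (stable_category C \<Z>) B D" and x: "x \<in> carrier (F A)"
    note S = rH[OF this(1)] and T = rH[OF this(2)]
    show "\<Phi> (SOME f. f \<in> stable_class C \<Z> ((SOME g. g \<in> T) \<cdot> (SOME f. f \<in> S))) x = \<Phi> (SOME f. f \<in> T) (\<Phi> (SOME f. f \<in> S) x)"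
      using rep[of "(SOME g. g \<in> T) \<cdot> (SOME f. f \<in> S)" x] F1(4)[OF S T x] S T x by simp
  next
    fix A B S T x assume "S \<in> Hom (stable_category C \<Z>) A B" "T \<in> Hom (stable_category C \<Z>) A B" and x: "x \<in> carrier (F A)"
    note S = rH[OF this(1)] and T = rH[OF this(2)]
    show "\<Phi> (SOME f. f \<in> stable_class C \<Z> ((SOME g. g \<in> S) \<oplus> (SOME f. f \<in> T))) x =
      \<Phi> (SOME f. f \<in> S) x \<otimes>\<^bsub>F B\<^esub> \<Phi> (SOME f. f \<in> T) x"
      using rep[of "(SOME g. g \<in> S) \<oplus> (SOME f. f \<in> T)" x] F1(5)[OF S T x] S T x by simp
  qed (fact F1(1))
qed

lemma homotopic_opposite [simp]: "homotopic (opposite C) \<Z> f g = homotopic C \<Z> f g"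
  unfolding homotopic_def factors_through_def by auto

lemma stable_category_opposite: "stable_category (opposite C) \<Z> = opposite (stable_category C \<Z>)"
  by (simp add: stable_category_def stable_class_def) (simp add: opposite_def)

lemma con_factors_stableI:
  assumes Z: "Z \<in> \<Z>" "Z \<in> Obj C" and F: "con_functor C F \<Phi>"
    and h: "\<And>f g x. homotopic C \<Z> f g \<Longrightarrow> x \<in> carrier (F (Cod C f)) \<Longrightarrow> \<Phi> f x = \<Phi> g x"
  shows "con_factors_stable C \<Z> F \<Phi>"
proof -
  have "cov_factors_stable (opposite C) \<Z> F \<Phi>"
    using Z F h by (intro abelian_category.cov_factors_stableI[OF abelian_opposite]) (simp_all add: cov_functor_opposite)
  then show ?thesis
    unfolding cov_factors_stable_def con_factors_stable_def stable_category_opposite cov_functor_opposite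
    by (simp add: stable_class_def)
qed

end

section \<open>The functors for a fixed but arbitrary choice of resolutions\<close>

locale model_resolutions = abelian_category +
  fixes \<Q> \<W> \<R> :: "'a set" and Res :: "'a \<Rightarrow> ('a, 'b) resolution"
  assumes model: "abelian_model C \<Q> \<W> \<R>"
    and choice: "resolution_choice C \<Q> \<W> \<R> Res"
begin

lemma Res: "A \<in> Obj C \<Longrightarrow> M_resolution C \<Q> \<W> \<R> A (Res A)"
  using choice by (simp add: resolution_choice_def)

lemma cRes: "A \<in> Obj C \<Longrightarrow> chain_complex C (Res A)"
  using chain_complex_M_resolution[OF Res] .

lemma comm_group_lExt: "A \<in> Obj C \<Longrightarrow> B \<in> Obj C \<Longrightarrow> comm_group (lExt C Res n A B)"
  unfolding lExt_def by (rule comm_group_cohomology[OF cRes])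

lemma lExt_cases:
  assumes "x \<in> carrier (lExt C Res n A B)"
  obtains c where "c \<in> hom_cocycles C (Res A) B n" "x = cls (Res A) B n c"
  using assms unfolding lExt_def carrier_cohomology by blast

lemma lExt_cov_class:
  assumes "A \<in> Obj C" "g \<in> Hom C B B'" "c \<in> hom_cocycles C (Res A) B n"
  shows "lExt_cov C Res n A g (cls (Res A) B n c) =
    cls (Res A) B' n (g \<cdot> c)"
  using cohomology_map_class[OF cRes[OF assms(1)] cRes[OF assms(1)] postcompose_cochain_map[OF cRes[OF assms(1)] assms(2)] _ _ assms(3)]
    Hom_Obj[OF assms(2)] assms(2) by (simp add: lExt_cov_def)

lemma cocycle_cov:
  assumes "A \<in> Obj C" "g \<in> Hom C B B'" "c \<in> hom_cocycles C (Res A) B n"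
  shows "g \<cdot> c \<in> hom_cocycles C (Res A) B' n"
  using cochain_map_cocycle[OF cRes[OF assms(1)] postcompose_cochain_map[OF cRes[OF assms(1)] assms(2)]]
    Hom_Obj[OF assms(2)] assms(3) by blast

lemma lExt_cov_hom:
  assumes "A \<in> Obj C" "g \<in> Hom C B B'"
  shows "lExt_cov C Res n A g \<in> hom (lExt C Res n A B) (lExt C Res n A B')"
  using cohomology_map_hom[OF cRes[OF assms(1)] cRes[OF assms(1)] postcompose_cochain_map[OF cRes[OF assms(1)] assms(2)], of n]
    Hom_Obj[OF assms(2)] assms(2) by (simp add: lExt_cov_def lExt_def)

lemma ex_lift:
  assumes "f \<in> Hom C A A'" obtains \<phi> where "chain_lift C (Res A) (Res A') f \<phi>"
  using ex_chain_lift[OF model Res Res assms] Hom_Obj[OF assms] by blast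

text \<open>The lift selected in the definition may be exchanged for any other. Functoriality can
  then be checked on composites and sums of lifts, which are not the selected ones.\<close>

lemma lExt_con_class:
  assumes f: "f \<in> Hom C A A'" and l: "chain_lift C (Res A) (Res A') f \<phi>" and B: "B \<in> Obj C"
    and c: "c \<in> hom_cocycles C (Res A') B n"
  shows "lExt_con C Res n f B (cls (Res A') B n c) =
    cls (Res A) B n (c \<cdot> \<phi> n)"
proof -
  define \<psi> where "\<psi> = (SOME \<psi>. chain_lift C (Res A) (Res A') f \<psi>)"
  have \<psi>: "chain_lift C (Res A) (Res A') f \<psi>" unfolding \<psi>_def using l by (metis someI)
  have o: "A \<in> Obj C" "A' \<in> Obj C" using Hom_Obj[OF f] by auto
  have "lExt_con C Res n f B (cls (Res A') B n c) =
    cohomology_map (hom_complex C (Res A) B) n (\<lambda>c. c \<cdot> \<psi> n) (cls (Res A') B n c)"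
    using f by (simp add: lExt_con_def \<psi>_def)
  also have "\<dots> = cls (Res A) B n (c \<cdot> \<psi> n)"
    by (rule chain_lift_class[OF cRes[OF o(1)] cRes[OF o(2)] \<psi> B c])
  also have "\<dots> = cls (Res A) B n (c \<cdot> \<phi> n)"
    by (rule chain_lift_class_unique[OF model Res[OF o(1)] Res[OF o(2)] f \<psi> l B c])
  finally show ?thesis .
qed

lemma lExt_con_hom:
  assumes f: "f \<in> Hom C A A'" and B: "B \<in> Obj C"
  shows "lExt_con C Res n f B \<in> hom (lExt C Res n A' B) (lExt C Res n A B)"
proof -
  define \<psi> where "\<psi> = (SOME \<psi>. chain_lift C (Res A) (Res A') f \<psi>)"
  obtain \<phi> where "chain_lift C (Res A) (Res A') f \<phi>" by (rule ex_lift[OF f])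
  then have \<psi>: "chain_lift C (Res A) (Res A') f \<psi>" unfolding \<psi>_def by (metis someI)
  have o: "A \<in> Obj C" "A' \<in> Obj C" using Hom_Obj[OF f] by auto
  have "lExt_con C Res n f B = cohomology_map (hom_complex C (Res A) B) n (\<lambda>c. c \<cdot> \<psi> n)"
    using f by (simp add: lExt_con_def \<psi>_def)
  then show ?thesis
    unfolding lExt_def
    using cohomology_map_hom[OF cRes[OF o(2)] cRes[OF o(1)] chain_lift_cochain_map[OF cRes[OF o(1)] cRes[OF o(2)] \<psi>] B B, of n]
    by simp
qed

lemma cov_functor_lExt:
  assumes A: "A \<in> Obj C"
  shows "cov_functor C (\<lambda>B. lExt C Res n A B) (\<lambda>g. lExt_cov C Res n A g)"
  unfolding cov_functor_def
proof (intro conjI ballI)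
  fix B assume B: "B \<in> Obj C"
  show "comm_group (lExt C Res n A B)" by (rule comm_group_lExt[OF A B])
  fix x assume "x \<in> carrier (lExt C Res n A B)"
  then obtain c where c: "c \<in> hom_cocycles C (Res A) B n" "x = cls (Res A) B n c"
    by (rule lExt_cases)
  show "lExt_cov C Res n A (Ide C B) x = x"
    unfolding c(2) lExt_cov_class[OF A Ide_Hom[OF B] c(1)] using hom_cocyclesD[OF c(1)] by simp
next
  fix B B' f assume "f \<in> Hom C B B'"
  then show "lExt_cov C Res n A f \<in> hom (lExt C Res n A B) (lExt C Res n A B')" by (rule lExt_cov_hom[OF A])
next
  fix B B' D f g x assume f: "f \<in> Hom C B B'" and g: "g \<in> Hom C B' D" and "x \<in> carrier (lExt C Res n A B)"
  then obtain c where c: "c \<in> hom_cocycles C (Res A) B n" "x = cls (Res A) B n c"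
    using lExt_cases by blast
  show "lExt_cov C Res n A (g \<cdot> f) x = lExt_cov C Res n A g (lExt_cov C Res n A f x)"
    unfolding c(2) lExt_cov_class[OF A f c(1)] lExt_cov_class[OF A Cmp_Hom[OF f g] c(1)]
      lExt_cov_class[OF A g cocycle_cov[OF A f c(1)]]
    using f g hom_cocyclesD[OF c(1)] by simp
next
  fix B B' f g x assume o: "B \<in> Obj C" "B' \<in> Obj C" and f: "f \<in> Hom C B B'" and g: "g \<in> Hom C B B'"
    and "x \<in> carrier (lExt C Res n A B)"
  then obtain c where c: "c \<in> hom_cocycles C (Res A) B n" "x = cls (Res A) B n c"
    using lExt_cases by blast
  have fg: "f \<oplus> g \<in> Hom C B B'" using f g by simp
  have "lExt_cov C Res n A f x \<otimes>\<^bsub>lExt C Res n A B'\<^esub> lExt_cov C Res n A g x =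
    cls (Res A) B' n (f \<cdot> c \<oplus> g \<cdot> c)"
    unfolding c(2) lExt_cov_class[OF A f c(1)] lExt_cov_class[OF A g c(1)] lExt_def
    by (rule cohomology_class_mult[OF cRes[OF A] o(2) cocycle_cov[OF A f c(1)] cocycle_cov[OF A g c(1)]])
  then show "lExt_cov C Res n A (f \<oplus> g) x = lExt_cov C Res n A f x \<otimes>\<^bsub>lExt C Res n A B'\<^esub> lExt_cov C Res n A g x"
    unfolding c(2) lExt_cov_class[OF A fg c(1)] using f g hom_cocyclesD[OF c(1)] by simp
qed

lemma cocycle_con:
  assumes f: "f \<in> Hom C A A'" and l: "chain_lift C (Res A) (Res A') f \<phi>" and B: "B \<in> Obj C"
    and c: "c \<in> hom_cocycles C (Res A') B n"
  shows "c \<cdot> \<phi> n \<in> hom_cocycles C (Res A) B n"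
  using chain_lift_cocycle[OF cRes cRes l B c] Hom_Obj[OF f] by blast

lemma con_functor_lExt:
  assumes B: "B \<in> Obj C"
  shows "con_functor C (\<lambda>A. lExt C Res n A B) (\<lambda>f. lExt_con C Res n f B)"
  unfolding con_functor_def
proof (intro conjI ballI)
  fix A assume A: "A \<in> Obj C"
  show "comm_group (lExt C Res n A B)" by (rule comm_group_lExt[OF A B])
  fix x assume "x \<in> carrier (lExt C Res n A B)"
  then obtain c where c: "c \<in> hom_cocycles C (Res A) B n" "x = cls (Res A) B n c"
    by (rule lExt_cases)
  show "lExt_con C Res n (Ide C A) B x = x"
    unfolding c(2) lExt_con_class[OF Ide_Hom[OF A] chain_lift_Ide[OF Res[OF A]] B c(1)]
    using hom_cocyclesD[OF c(1)] by simp
next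
  fix A A' f assume "f \<in> Hom C A A'"
  then show "lExt_con C Res n f B \<in> hom (lExt C Res n A' B) (lExt C Res n A B)" by (rule lExt_con_hom[OF _ B])
next
  fix A A' D f g x assume o: "A \<in> Obj C" "A' \<in> Obj C" "D \<in> Obj C" and f: "f \<in> Hom C A A'" and g: "g \<in> Hom C A' D"
    and "x \<in> carrier (lExt C Res n D B)"
  then obtain c where c: "c \<in> hom_cocycles C (Res D) B n" "x = cls (Res D) B n c"
    using lExt_cases by blast
  obtain \<phi> where \<phi>: "chain_lift C (Res A) (Res A') f \<phi>" by (rule ex_lift[OF f])
  obtain \<psi> where \<psi>: "chain_lift C (Res A') (Res D) g \<psi>" by (rule ex_lift[OF g])
  show "lExt_con C Res n (g \<cdot> f) B x = lExt_con C Res n f B (lExt_con C Res n g B x)"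
    unfolding c(2) lExt_con_class[OF g \<psi> B c(1)] lExt_con_class[OF f \<phi> B cocycle_con[OF g \<psi> B c(1)]]
      lExt_con_class[OF Cmp_Hom[OF f g] chain_lift_Cmp[OF Res[OF o(1)] Res[OF o(2)] Res[OF o(3)] f \<phi> g \<psi>] B c(1)]
    using hom_cocyclesD[OF c(1)] chain_liftD(1-3)[OF \<phi>] chain_liftD(1-3)[OF \<psi>] by simp
next
  fix A A' f g x assume o: "A \<in> Obj C" "A' \<in> Obj C" and f: "f \<in> Hom C A A'" and g: "g \<in> Hom C A A'"
    and "x \<in> carrier (lExt C Res n A' B)"
  then obtain c where c: "c \<in> hom_cocycles C (Res A') B n" "x = cls (Res A') B n c"
    using lExt_cases by blast
  obtain \<phi> where \<phi>: "chain_lift C (Res A) (Res A') f \<phi>" by (rule ex_lift[OF f])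
  obtain \<psi> where \<psi>: "chain_lift C (Res A) (Res A') g \<psi>" by (rule ex_lift[OF g])
  have fg: "f \<oplus> g \<in> Hom C A A'" using f g by simp
  have "lExt_con C Res n f B x \<otimes>\<^bsub>lExt C Res n A B\<^esub> lExt_con C Res n g B x =
    cls (Res A) B n (c \<cdot> \<phi> n \<oplus> c \<cdot> \<psi> n)"
    unfolding c(2) lExt_con_class[OF f \<phi> B c(1)] lExt_con_class[OF g \<psi> B c(1)] lExt_def
    by (rule cohomology_class_mult[OF cRes[OF o(1)] B cocycle_con[OF f \<phi> B c(1)] cocycle_con[OF g \<psi> B c(1)]])
  then show "lExt_con C Res n (f \<oplus> g) B x = lExt_con C Res n f B x \<otimes>\<^bsub>lExt C Res n A B\<^esub> lExt_con C Res n g B x"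
    unfolding c(2) lExt_con_class[OF fg chain_lift_Add(1)[OF Res[OF o(1)] Res[OF o(2)] f \<phi> g \<psi>] B c(1)]
    using hom_cocyclesD[OF c(1)] chain_liftD(1-3)[OF \<phi>] chain_liftD(1-3)[OF \<psi>] by simp
qed

lemma lExt_con_cov_commute:
  assumes f: "f \<in> Arr C" and g: "g \<in> Arr C" and "x \<in> carrier (lExt C Res n (Cod C f) (Dom C g))"
  shows "lExt_con C Res n f (Cod C g) (lExt_cov C Res n (Cod C f) g x) =
    lExt_cov C Res n (Dom C f) g (lExt_con C Res n f (Dom C g) x)"
proof -
  obtain c where c: "c \<in> hom_cocycles C (Res (Cod C f)) (Dom C g) n"
    "x = cls (Res (Cod C f)) (Dom C g) n c"
    by (rule lExt_cases[OF assms(3)])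
  have h: "f \<in> Hom C (Dom C f) (Cod C f)" "g \<in> Hom C (Dom C g) (Cod C g)" using f g by simp_all
  have o: "Dom C f \<in> Obj C" "Cod C f \<in> Obj C" "Dom C g \<in> Obj C" "Cod C g \<in> Obj C" using f g by simp_all
  obtain \<phi> where \<phi>: "chain_lift C (Res (Dom C f)) (Res (Cod C f)) f \<phi>" by (rule ex_lift[OF h(1)])
  show ?thesis
    unfolding c(2) lExt_cov_class[OF o(2) h(2) c(1)] lExt_con_class[OF h(1) \<phi> o(3) c(1)]
      lExt_con_class[OF h(1) \<phi> o(4) cocycle_cov[OF o(2) h(2) c(1)]]
      lExt_cov_class[OF o(1) h(2) cocycle_con[OF h(1) \<phi> o(3) c(1)]]
    using hom_cocyclesD[OF c(1)] chain_liftD(1-3)[OF \<phi>] g by simp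
qed

lemma cotorsion_pairs: "hered_cotorsion C \<Q> (\<W> \<inter> \<R>)" "hered_cotorsion C (\<Q> \<inter> \<W>) \<R>"
  using model by (simp_all add: abelian_model_def)

lemma cofibrant_Obj: "A \<in> \<Q> \<Longrightarrow> A \<in> Obj C"
  using hered_cotorsionD(1)[OF cotorsion_pairs(1)] .

text \<open>The cocycle \<open>u \<cdot> c\<close> has values in a trivially fibrant object, so it
  is a coboundary on the resolution of a cofibrant object; composing with \<open>v\<close> keeps it
  one.\<close>

lemma lExt_cov_left_homotopic:
  assumes A: "A \<in> \<Q>" and h: "homotopic C (\<W> \<inter> \<R>) f g" and x: "x \<in> carrier (lExt C Res n A (Dom C f))"
  shows "lExt_cov C Res n A f x = lExt_cov C Res n A g x"
proof -
  note o = cofibrant_Obj[OF A]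
  obtain u v Z where Z: "Z \<in> \<W> \<inter> \<R>" and f: "f \<in> Arr C" "g \<in> Arr C" "Dom C g = Dom C f" "Cod C g = Cod C f"
    and u: "u \<in> Hom C (Dom C f) Z" and v: "v \<in> Hom C Z (Cod C f)" and g: "g = v \<cdot> u \<oplus> f"
    by (rule homotopicD[OF h])
  obtain c where c: "c \<in> hom_cocycles C (Res A) (Dom C f) n" "x = cls (Res A) (Dom C f) n c"
    by (rule lExt_cases[OF x])
  note cs = hom_cocyclesD[OF c(1)] and x = M_resolutionD[OF Res[OF o]]
  have uc: "u \<cdot> c \<in> hom_cocycles C (Res A) Z n" by (rule cocycle_cov[OF o u c(1)])
  obtain e where e: "e \<in> Hom C (ob (Res A) (n - 1)) Z" "e \<cdot> dif (Res A) n = u \<cdot> c"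
    using M_resolution_extend[OF model Res[OF o] A Z hom_cocyclesD(5,4)[OF uc]] by blast
  have "g \<cdot> c = v \<cdot> u \<cdot> c \<oplus> f \<cdot> c" unfolding g using u v f cs by simp
  also have "v \<cdot> u \<cdot> c = (v \<cdot> e) \<cdot> dif (Res A) n" using e v x(1-3) by simp
  finally have "g \<cdot> c = (v \<cdot> e) \<cdot> dif (Res A) n \<oplus> f \<cdot> c" .
  moreover have h: "f \<in> Hom C (Dom C f) (Cod C f)" "g \<in> Hom C (Dom C f) (Cod C f)" using f by simp_all
  moreover have "v \<cdot> e \<in> Hom C (ob (Res A) (n - 1)) (Cod C f)" using v e by simp
  ultimately have "cls (Res A) (Cod C f) n (g \<cdot> c) = cls (Res A) (Cod C f) n (f \<cdot> c)"
    using cohomology_class_eqI[OF cRes[OF o] _ cocycle_cov[OF o h(1) c(1)]] f(1) by (metis Cod_Obj)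
  then show ?thesis unfolding c(2) lExt_cov_class[OF o h(1) c(1)] lExt_cov_class[OF o h(2) c(1)] ..
qed

text \<open>The difference of the two morphisms is lifted through \<open>Res Z\<close>. As
  \<open>Z\<close> is in the core, the cocycle \<open>c \<cdot> \<nu> n\<close> on
  \<open>Res Z\<close> is a coboundary for every \<open>B\<close>, and pulling it back along
  \<open>\<mu>\<close> preserves this.\<close>

lemma lExt_con_homotopic:
  assumes B: "B \<in> Obj C" and h: "homotopic C (\<Q> \<inter> \<W> \<inter> \<R>) f g" and x: "x \<in> carrier (lExt C Res n (Cod C f) B)"
  shows "lExt_con C Res n f B x = lExt_con C Res n g B x"
proof -
  obtain u v Z where Z: "Z \<in> \<Q> \<inter> \<W> \<inter> \<R>" and f: "f \<in> Arr C" "g \<in> Arr C" "Dom C g = Dom C f" "Cod C g = Cod C f"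
    and u: "u \<in> Hom C (Dom C f) Z" and v: "v \<in> Hom C Z (Cod C f)" and g: "g = v \<cdot> u \<oplus> f"
    by (rule homotopicD[OF h])
  let ?X = "Res (Dom C f)" and ?Y = "Res (Cod C f)"
  obtain c where c: "c \<in> hom_cocycles C ?Y B n" "x = cls ?Y B n c"
    by (rule lExt_cases[OF x])
  have o: "Dom C f \<in> Obj C" "Cod C f \<in> Obj C" "Z \<in> Obj C" using f Hom_Obj[OF u] by simp_all
  have h: "f \<in> Hom C (Dom C f) (Cod C f)" "g \<in> Hom C (Dom C f) (Cod C f)" "v \<cdot> u \<in> Hom C (Dom C f) (Cod C f)"
    using f u v by simp_all
  obtain \<phi> where \<phi>: "chain_lift C ?X ?Y f \<phi>" by (rule ex_lift[OF h(1)])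
  obtain \<mu> where \<mu>: "chain_lift C ?X (Res Z) u \<mu>" by (rule ex_lift[OF u])
  obtain \<nu> where \<nu>: "chain_lift C (Res Z) ?Y v \<nu>" by (rule ex_lift[OF v])
  have gl: "chain_lift C ?X ?Y g (\<lambda>i. \<nu> i \<cdot> \<mu> i \<oplus> \<phi> i)"
    unfolding g
    by (rule chain_lift_Add(1)[OF Res[OF o(1)] Res[OF o(2)] h(3) chain_lift_Cmp[OF Res[OF o(1)] Res[OF o(3)] Res[OF o(2)] u \<mu> v \<nu>] h(1) \<phi>])
  note cs = hom_cocyclesD[OF c(1)] and t = chain_liftD(1-3)[OF \<phi>] chain_liftD(1-3)[OF \<mu>] chain_liftD(1-3)[OF \<nu>]
  note xd = M_resolutionD(1-3)[OF Res[OF o(1)]] and zd = M_resolutionD(1-3)[OF Res[OF o(3)]]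
  have cn: "c \<cdot> \<nu> n \<in> hom_cocycles C (Res Z) B n" by (rule cocycle_con[OF v \<nu> B c(1)])
  obtain e where e: "e \<in> Hom C (ob (Res Z) (n - 1)) B" "e \<cdot> dif (Res Z) n = c \<cdot> \<nu> n"
    using M_resolution_core_extend[OF model Res[OF o(3)] Z hom_cocyclesD(5,4)[OF cn]] by blast
  have "c \<cdot> \<nu> n \<cdot> \<mu> n = (e \<cdot> dif (Res Z) n) \<cdot> \<mu> n" unfolding e(2) using cs t by simp
  also have "\<dots> = (e \<cdot> \<mu> (n - 1)) \<cdot> dif ?X n" using e(1) t xd zd chain_liftD(4)[OF \<mu>, of n] by simp
  finally have "c \<cdot> (\<nu> n \<cdot> \<mu> n \<oplus> \<phi> n) = (e \<cdot> \<mu> (n - 1)) \<cdot> dif ?X n \<oplus> c \<cdot> \<phi> n" using cs t by simp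
  moreover have "e \<cdot> \<mu> (n - 1) \<in> Hom C (ob ?X (n - 1)) B" using e(1) t by simp
  ultimately have "cls ?X B n (c \<cdot> (\<nu> n \<cdot> \<mu> n \<oplus> \<phi> n)) = cls ?X B n (c \<cdot> \<phi> n)"
    using cohomology_class_eqI[OF cRes[OF o(1)] B cocycle_con[OF h(1) \<phi> B c(1)]] by blast
  then show ?thesis unfolding c(2) lExt_con_class[OF h(1) \<phi> B c(1)] lExt_con_class[OF h(2) gl B c(1)] ..
qed

lemma ex_core: "\<exists>Z. Z \<in> \<Q> \<inter> \<W> \<inter> \<R> \<and> Z \<in> Obj C"
proof -
  obtain Z where "zero_object C Z" using ex_zero_object by blast
  then show ?thesis
    using hered_cotorsion_left_zero[OF cotorsion_pairs(1)] hered_cotorsion_right_zero[OF cotorsion_pairs(1)] zero_objectD(1)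
    by blast
qed

lemma lExt_fibration_long_exact:
  assumes A: "A \<in> \<Q>" and g: "fibration C \<R> g" and k: "is_kernel C k g"
  shows "\<exists>\<delta>. long_exact
      (\<lambda>n. lExt C Res n A (Dom C k)) (\<lambda>n. lExt C Res n A (Dom C g)) (\<lambda>n. lExt C Res n A (Cod C g))
      (\<lambda>n. lExt_cov C Res n A k) (\<lambda>n. lExt_cov C Res n A g) \<delta> \<and>
    connecting
      (hom_complex C (Res A) (Dom C k)) (hom_complex C (Res A) (Dom C g)) (hom_complex C (Res A) (Cod C g))
      (\<lambda>n c. k \<cdot> c) (\<lambda>n c. g \<cdot> c) \<delta>"
proof -
  note o = cofibrant_Obj[OF A] and ks = is_kernelD[OF k]
  have kR: "Dom C k \<in> \<R>"
    using g hered_cotorsion_kernel[OF cotorsion_pairs(2) _ k] unfolding fibration_def by blast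
  have se: "short_exact C k g" using g k short_exact_kernelI unfolding fibration_def by blast
  have h: "k \<in> Hom C (Dom C k) (Dom C g)" "g \<in> Hom C (Dom C g) (Cod C g)" using ks by simp_all
  have bo: "Dom C k \<in> Obj C" "Dom C g \<in> Obj C" "Cod C g \<in> Obj C" using ks by simp_all
  have cov: "(\<lambda>n. lExt_cov C Res n A k) = (\<lambda>n. cohomology_map (hom_complex C (Res A) (Dom C g)) n (\<lambda>c. k \<cdot> c))"
    "(\<lambda>n. lExt_cov C Res n A g) = (\<lambda>n. cohomology_map (hom_complex C (Res A) (Cod C g)) n (\<lambda>c. g \<cdot> c))"
    using ks by (simp_all add: lExt_cov_def)
  show ?thesis
    unfolding cov lExt_def
  proof (rule long_exact_hom[OF cRes[OF o] cRes[OF o] cRes[OF o] bo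
        postcompose_cochain_map[OF cRes[OF o] h(1)] postcompose_cochain_map[OF cRes[OF o] h(2)]])
    fix n a assume a: "a \<in> Hom C (ob (Res A) n) (Dom C k)"
    show "g \<cdot> k \<cdot> a = Zer C (ob (Res A) n) (Cod C g)" using Cmp_rewr[OF ks(4), of a] a ks by simp
    assume "k \<cdot> a = Zer C (ob (Res A) n) (Dom C g)"
    then show "a = Zer C (ob (Res A) n) (Dom C k)" using monicD[OF is_kernel_monic[OF k], of a] a ks by simp
  next
    fix n b assume "b \<in> Hom C (ob (Res A) n) (Dom C g)" "g \<cdot> b = Zer C (ob (Res A) n) (Cod C g)"
    then show "\<exists>a\<in>Hom C (ob (Res A) n) (Dom C k). k \<cdot> a = b" using is_kernel_factor[OF k, of b] by (metis Hom_iff)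
  next
    fix n c assume c: "c \<in> Hom C (ob (Res A) n) (Cod C g)"
    \<comment> \<open>Cofibrancy of \<open>A\<close> makes even the terms in negative degrees
      trivially cofibrant, hence orthogonal to the fibrant kernel.\<close>
    have "Ext1_split C (ob (Res A) n) (Dom C k)"
      by (rule hered_cotorsionD(3)[OF cotorsion_pairs(2) M_resolution_ob_left[OF model Res[OF o] A] kR])
    from lift_short_exact[OF this se _ c] show "\<exists>b\<in>Hom C (ob (Res A) n) (Dom C g). g \<cdot> b = c" by blast
  qed
qed

text \<open>The horseshoe keeps the chosen resolutions of \<open>Dom C f\<close> and
  \<open>Cod C c\<close> and builds \<open>V\<close> between them without reference to
  \<open>B\<close>. The sequence obtained from \<open>V\<close> is then moved to the chosen
  resolution of \<open>Cod C f\<close>, with the same connecting map.\<close>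

lemma lExt_cofibration_long_exact:
  assumes f: "cofibration C \<Q> f" and c: "is_cokernel C c f"
  shows "\<exists>V \<alpha> \<beta>. M_resolution C \<Q> \<W> \<R> (Cod C f) V \<and>
    chain_lift C (Res (Dom C f)) V f \<alpha> \<and> chain_lift C V (Res (Cod C c)) c \<beta> \<and>
    (\<forall>n. short_exact C (\<alpha> n) (\<beta> n)) \<and>
    (\<forall>B\<in>\<R>. \<exists>\<delta>.
      long_exact
        (\<lambda>n. lExt C Res n (Cod C c) B) (\<lambda>n. lExt C Res n (Cod C f) B) (\<lambda>n. lExt C Res n (Dom C f) B)
        (\<lambda>n. lExt_con C Res n c B) (\<lambda>n. lExt_con C Res n f B) \<delta> \<and>
      connecting
        (hom_complex C (Res (Cod C c)) B) (hom_complex C V B) (hom_complex C (Res (Dom C f)) B)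
        (\<lambda>n b. b \<cdot> \<beta> n) (\<lambda>n b. b \<cdot> \<alpha> n) \<delta>)"
proof -
  note cs = is_cokernelD[OF c]
  have cQ: "Cod C c \<in> \<Q>"
    using f hered_cotorsion_cokernel[OF cotorsion_pairs(1) _ c] unfolding cofibration_def by blast
  have se: "short_exact C f c" using f c short_exact_cokernelI unfolding cofibration_def by blast
  have h: "f \<in> Hom C (Dom C f) (Cod C f)" "c \<in> Hom C (Cod C f) (Cod C c)" using cs by simp_all
  have o: "Dom C f \<in> Obj C" "Cod C f \<in> Obj C" "Cod C c \<in> Obj C" using cs by simp_all
  let ?X = "Res (Dom C f)" and ?Y = "Res (Cod C c)" and ?W = "Res (Cod C f)"
  obtain V \<alpha> \<beta> where V: "M_resolution C \<Q> \<W> \<R> (Cod C f) V" and \<alpha>: "chain_lift C ?X V f \<alpha>" and \<beta>: "chain_lift C V ?Y c \<beta>"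
    and \<alpha>\<beta>: "\<And>n. short_exact C (\<alpha> n) (\<beta> n)"
    using M_resolution_horseshoe[OF model Res[OF o(1)] Res[OF o(3)] se refl refl] by blast
  note cV = chain_complex_M_resolution[OF V] and cX = cRes[OF o(1)] and cY = cRes[OF o(3)] and cW = cRes[OF o(2)]
  note a = chain_liftD[OF \<alpha>] and b = chain_liftD[OF \<beta>] and I = Ide_Hom[OF o(2)]
  have II: "Ide C (Cod C f) \<cdot> Ide C (Cod C f) = Ide C (Cod C f)" using o by simp
  obtain l where l: "chain_lift C V ?W (Ide C (Cod C f)) l" using ex_chain_lift[OF model V Res[OF o(2)] I] by blast
  obtain m where m: "chain_lift C ?W V (Ide C (Cod C f)) m" using ex_chain_lift[OF model Res[OF o(2)] V I] by blast
  note ls = chain_liftD[OF l] and ms = chain_liftD[OF m]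
  \<comment> \<open>The comparison maps compose to lifts of identities, hence act as identities on
    cohomology. The composites with \<open>\<beta>\<close> and \<open>\<alpha>\<close> lift
    \<open>c\<close> and \<open>f\<close> between chosen resolutions, so they compute
    \<open>lExt_con\<close>.\<close>
  have lm: "chain_lift C ?W ?W (Ide C (Cod C f)) (\<lambda>i. l i \<cdot> m i)"
    using chain_lift_Cmp[OF Res[OF o(2)] V Res[OF o(2)] I m I l] II by simp
  have ml: "chain_lift C V V (Ide C (Cod C f)) (\<lambda>i. m i \<cdot> l i)"
    using chain_lift_Cmp[OF V Res[OF o(2)] V I l I m] II by simp
  have bm: "chain_lift C ?W ?Y c (\<lambda>i. \<beta> i \<cdot> m i)"
    using chain_lift_Cmp[OF Res[OF o(2)] V Res[OF o(3)] I m h(2) \<beta>] cs by simp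
  have la: "chain_lift C ?X ?W f (\<lambda>i. l i \<cdot> \<alpha> i)"
    using chain_lift_Cmp[OF Res[OF o(1)] V Res[OF o(2)] h(1) \<alpha> I l] cs by simp
  have "\<exists>\<delta>. long_exact
        (\<lambda>n. lExt C Res n (Cod C c) B) (\<lambda>n. lExt C Res n (Cod C f) B) (\<lambda>n. lExt C Res n (Dom C f) B)
        (\<lambda>n. lExt_con C Res n c B) (\<lambda>n. lExt_con C Res n f B) \<delta> \<and>
      connecting (hom_complex C ?Y B) (hom_complex C V B) (hom_complex C ?X B) (\<lambda>n b. b \<cdot> \<beta> n) (\<lambda>n b. b \<cdot> \<alpha> n) \<delta>"
    if BR: "B \<in> \<R>" for B
  proof -
    have B: "B \<in> Obj C" by (rule hered_cotorsionD(2)[OF cotorsion_pairs(2) BR])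
    have "\<exists>\<delta>. long_exact (cohom ?Y B) (cohom V B) (cohom ?X B)
        (\<lambda>n. cohomology_map (hom_complex C V B) n (\<lambda>b. b \<cdot> \<beta> n)) (\<lambda>n. cohomology_map (hom_complex C ?X B) n (\<lambda>b. b \<cdot> \<alpha> n)) \<delta> \<and>
      connecting (hom_complex C ?Y B) (hom_complex C V B) (hom_complex C ?X B) (\<lambda>n b. b \<cdot> \<beta> n) (\<lambda>n b. b \<cdot> \<alpha> n) \<delta>"
    proof (rule long_exact_hom[OF cY cV cX B B B chain_lift_cochain_map[OF cV cY \<beta>] chain_lift_cochain_map[OF cX cV \<alpha>]])
      fix n u assume u: "u \<in> Hom C (ob ?Y n) B"
      note s = short_exactD[OF \<alpha>\<beta>[of n]]
      show "(u \<cdot> \<beta> n) \<cdot> \<alpha> n = Zer C (ob ?X n) B" using u s(4) a(1-3) b(1-3) B chain_complexD(4)[OF cX] by simp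
      assume "u \<cdot> \<beta> n = Zer C (ob V n) B"
      then show "u = Zer C (ob ?Y n) B" using epicD[OF s(6), of u] u b(1-3) by simp
    next
      fix n u assume "u \<in> Hom C (ob V n) B" "u \<cdot> \<alpha> n = Zer C (ob ?X n) B"
      then show "\<exists>a\<in>Hom C (ob ?Y n) B. a \<cdot> \<beta> n = u"
        using is_cokernel_factor[OF short_exactD(8)[OF \<alpha>\<beta>[of n]], of u] a(1-3) b(1-3) by (metis Hom_iff)
    next
      fix n u assume u: "u \<in> Hom C (ob ?X n) B"
      \<comment> \<open>The terms resolving the cofibrant cokernel are trivially cofibrant, so Hom
        into the fibrant \<open>B\<close> stays exact on the row.\<close>
      have "Ext1_split C (Cod C (\<beta> n)) B"
        unfolding b(3)
        by (rule hered_cotorsionD(3)[OF cotorsion_pairs(2) M_resolution_ob_left[OF model Res[OF o(3)] cQ] BR])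
      from extend_short_exact[OF this \<alpha>\<beta>[of n] refl] u show "\<exists>w\<in>Hom C (ob V n) B. w \<cdot> \<alpha> n = u"
        unfolding a(2,3) by blast
    qed
    then obtain \<delta> where le: "long_exact (cohom ?Y B) (cohom V B) (cohom ?X B)
        (\<lambda>n. cohomology_map (hom_complex C V B) n (\<lambda>b. b \<cdot> \<beta> n)) (\<lambda>n. cohomology_map (hom_complex C ?X B) n (\<lambda>b. b \<cdot> \<alpha> n)) \<delta>"
      and con: "connecting (hom_complex C ?Y B) (hom_complex C V B) (hom_complex C ?X B) (\<lambda>n b. b \<cdot> \<beta> n) (\<lambda>n b. b \<cdot> \<alpha> n) \<delta>"
      by blast
    define \<tau> where "\<tau> n = cohomology_map (hom_complex C ?W B) n (\<lambda>c. c \<cdot> m n)" for n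
    define \<sigma> where "\<sigma> n = cohomology_map (hom_complex C V B) n (\<lambda>c. c \<cdot> l n)" for n
    note \<tau>c = chain_lift_class[OF cW cV m B, folded \<tau>_def] and \<tau>z = chain_lift_cocycle[OF cW cV m B]
    note \<sigma>c = chain_lift_class[OF cV cW l B, folded \<sigma>_def] and \<sigma>z = chain_lift_cocycle[OF cV cW l B]
    have "long_exact (cohom ?Y B) (cohom ?W B) (cohom ?X B)
        (\<lambda>n. lExt_con C Res n c B) (\<lambda>n. lExt_con C Res n f B) \<delta>"
    proof (rule long_exact_transport[OF le, where \<tau> = \<tau> and \<sigma> = \<sigma>])
      fix n
      show "group (cohom V B n)" "group (cohom ?W B n)"
        using comm_group_cohomology[OF cV B] comm_group_cohomology[OF cW B] by (simp_all add: comm_group_def)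
      show "\<tau> n \<in> hom (cohom V B n) (cohom ?W B n)"
        unfolding \<tau>_def by (rule cohomology_map_hom[OF cV cW chain_lift_cochain_map[OF cW cV m] B B])
      show "\<sigma> n \<in> hom (cohom ?W B n) (cohom V B n)"
        unfolding \<sigma>_def by (rule cohomology_map_hom[OF cW cV chain_lift_cochain_map[OF cV cW l] B B])
      show "lExt_con C Res n c B \<in> hom (cohom ?Y B n) (cohom ?W B n)"
        using lExt_con_hom[OF h(2) B, of n] unfolding lExt_def .
      show "lExt_con C Res n f B \<in> hom (cohom ?W B n) (cohom ?X B n)"
        using lExt_con_hom[OF h(1) B, of n] unfolding lExt_def .
      fix y assume "y \<in> carrier (cohom ?W B n)"
      then obtain z where z: "z \<in> hom_cocycles C ?W B n" "y = cls ?W B n z"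
        unfolding carrier_cohomology by blast
      note zs = hom_cocyclesD[OF z(1)]
      have "\<tau> n (\<sigma> n y) = cls ?W B n (z \<cdot> l n \<cdot> m n)"
        unfolding z(2) \<sigma>c[OF z(1)] \<tau>c[OF \<sigma>z[OF z(1)]] using zs ls(1-3) ms(1-3) by simp
      also have "\<dots> = cls ?W B n (z \<cdot> Ide C (ob ?W n))"
        by (rule chain_lift_class_unique[OF model Res[OF o(2)] Res[OF o(2)] I lm chain_lift_Ide[OF Res[OF o(2)]] B z(1)])
      finally show "\<tau> n (\<sigma> n y) = y" unfolding z(2) using zs by simp
      show "lExt_con C Res n f B y = cohomology_map (hom_complex C ?X B) n (\<lambda>b. b \<cdot> \<alpha> n) (\<sigma> n y)"
        unfolding z(2) lExt_con_class[OF h(1) la B z(1)] \<sigma>c[OF z(1)] chain_lift_class[OF cX cV \<alpha> B \<sigma>z[OF z(1)]]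
        using zs ls(1-3) a(1-3) by simp
    next
      fix n y assume "y \<in> carrier (cohom V B n)"
      then obtain z where z: "z \<in> hom_cocycles C V B n" "y = cls V B n z"
        unfolding carrier_cohomology by blast
      note zs = hom_cocyclesD[OF z(1)]
      have "\<sigma> n (\<tau> n y) = cls V B n (z \<cdot> m n \<cdot> l n)"
        unfolding z(2) \<tau>c[OF z(1)] \<sigma>c[OF \<tau>z[OF z(1)]] using zs ls(1-3) ms(1-3) by simp
      also have "\<dots> = cls V B n (z \<cdot> Ide C (ob V n))"
        by (rule chain_lift_class_unique[OF model V V I ml chain_lift_Ide[OF V] B z(1)])
      finally show "\<sigma> n (\<tau> n y) = y" unfolding z(2) using zs by simp
    next
      fix n y assume "y \<in> carrier (cohom ?Y B n)"
      then obtain z where z: "z \<in> hom_cocycles C ?Y B n" "y = cls ?Y B n z"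
        unfolding carrier_cohomology by blast
      show "lExt_con C Res n c B y = \<tau> n (cohomology_map (hom_complex C V B) n (\<lambda>b. b \<cdot> \<beta> n) y)"
        unfolding z(2) lExt_con_class[OF h(2) bm B z(1)] chain_lift_class[OF cV cY \<beta> B z(1)]
          \<tau>c[OF chain_lift_cocycle[OF cV cY \<beta> B z(1)]]
        using hom_cocyclesD[OF z(1)] ms(1-3) b(1-3) by simp
    qed
    then show ?thesis unfolding lExt_def using con by blast
  qed
  then show ?thesis using V \<alpha> \<beta> \<alpha>\<beta> by blast
qed

end

text \<open>Existence of a choice of resolutions is asserted as well, so that the quantification
  over choices is not empty. The clause \<open>connecting\<close> ties the boundary map to the snake
  construction; exactness alone would not even determine its sign.\<close>

theorem theorem4p7:
  fixes C :: "('o, 'm) lincat"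
    and \<Q> \<W> \<R> :: "'o set"
  assumes "abelian_category C"
    and "hereditary_abelian_model C \<Q> \<W> \<R>"
  shows "(\<exists>Res. resolution_choice C \<Q> \<W> \<R> Res) \<and>
    (\<forall>Res. resolution_choice C \<Q> \<W> \<R> Res \<longrightarrow>
      (\<forall>n. \<forall>A\<in>Obj C. cov_functor C (\<lambda>B. lExt C Res n A B) (\<lambda>g. lExt_cov C Res n A g)) \<and>
      (\<forall>n. \<forall>B\<in>Obj C. con_functor C (\<lambda>A. lExt C Res n A B) (\<lambda>f. lExt_con C Res n f B)) \<and>
      (\<forall>n. \<forall>f\<in>Arr C. \<forall>g\<in>Arr C. \<forall>x\<in>carrier (lExt C Res n (Cod C f) (Dom C g)).
         lExt_con C Res n f (Cod C g) (lExt_cov C Res n (Cod C f) g x) =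
         lExt_cov C Res n (Dom C f) g (lExt_con C Res n f (Dom C g) x)) \<and>
      (\<forall>A\<in>\<Q>.
        (\<forall>g k. fibration C \<R> g \<and> is_kernel C k g \<longrightarrow>
          (\<exists>\<delta>.
            long_exact
              (\<lambda>n. lExt C Res n A (Dom C k)) (\<lambda>n. lExt C Res n A (Dom C g))
              (\<lambda>n. lExt C Res n A (Cod C g))
              (\<lambda>n. lExt_cov C Res n A k) (\<lambda>n. lExt_cov C Res n A g) \<delta> \<and>
            connecting
              (hom_complex C (Res A) (Dom C k)) (hom_complex C (Res A) (Dom C g))
              (hom_complex C (Res A) (Cod C g))
              (\<lambda>n c. k \<cdot>\<^bsub>C\<^esub> c) (\<lambda>n c. g \<cdot>\<^bsub>C\<^esub> c) \<delta>)) \<and>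
        (\<forall>n. \<forall>f g. homotopic C (\<W> \<inter> \<R>) f g \<longrightarrow>
          (\<forall>x\<in>carrier (lExt C Res n A (Dom C f)).
             lExt_cov C Res n A f x = lExt_cov C Res n A g x)) \<and>
        (\<forall>n. cov_factors_stable C (\<Q> \<inter> \<W> \<inter> \<R>)
               (\<lambda>B. lExt C Res n A B) (\<lambda>g. lExt_cov C Res n A g))) \<and>
      (\<forall>f c. cofibration C \<Q> f \<and> is_cokernel C c f \<longrightarrow>
        (\<exists>V \<alpha> \<beta>.
          M_resolution C \<Q> \<W> \<R> (Cod C f) V \<and>
          chain_lift C (Res (Dom C f)) V f \<alpha> \<and>
          chain_lift C V (Res (Cod C c)) c \<beta> \<and>
          (\<forall>n. short_exact C (\<alpha> n) (\<beta> n)) \<and>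
          (\<forall>B\<in>\<R>. \<exists>\<delta>.
            long_exact
              (\<lambda>n. lExt C Res n (Cod C c) B) (\<lambda>n. lExt C Res n (Cod C f) B)
              (\<lambda>n. lExt C Res n (Dom C f) B)
              (\<lambda>n. lExt_con C Res n c B) (\<lambda>n. lExt_con C Res n f B) \<delta> \<and>
            connecting
              (hom_complex C (Res (Cod C c)) B) (hom_complex C V B)
              (hom_complex C (Res (Dom C f)) B)
              (\<lambda>n b. b \<cdot>\<^bsub>C\<^esub> \<beta> n) (\<lambda>n b. b \<cdot>\<^bsub>C\<^esub> \<alpha> n) \<delta>))) \<and>
      (\<forall>n. \<forall>B\<in>Obj C. con_factors_stable C (\<Q> \<inter> \<W> \<inter> \<R>)
             (\<lambda>A. lExt C Res n A B) (\<lambda>f. lExt_con C Res n f B)))"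
proof -
  interpret abelian_category C by fact
  have model: "abelian_model C \<Q> \<W> \<R>" using abelian_modelI assms(2) .
  have ex: "\<exists>Res. resolution_choice C \<Q> \<W> \<R> Res"
    unfolding resolution_choice_def using ex_M_resolution[OF model] by metis
  {
    fix Res assume res: "resolution_choice C \<Q> \<W> \<R> Res"
    interpret model_resolutions C \<Q> \<W> \<R> Res by unfold_locales (fact model res)+
    obtain Z where Z: "Z \<in> \<Q> \<inter> \<W> \<inter> \<R>" "Z \<in> Obj C" using ex_core by blast
    have "cov_factors_stable C (\<Q> \<inter> \<W> \<inter> \<R>) (\<lambda>B. lExt C Res n A B) (\<lambda>g. lExt_cov C Res n A g)"
      if "A \<in> \<Q>" for n A
    proof (rule cov_factors_stableI[OF Z cov_functor_lExt[OF cofibrant_Obj[OF that]]])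
      fix f g x assume "homotopic C (\<Q> \<inter> \<W> \<inter> \<R>) f g" "x \<in> carrier (lExt C Res n A (Dom C f))"
      \<comment> \<open>The core is contained in the trivially fibrant objects, so homotopic
        morphisms are left homotopic.\<close>
      moreover from this(1) have "homotopic C (\<W> \<inter> \<R>) f g"
        unfolding homotopic_def factors_through_def by blast
      ultimately show "lExt_cov C Res n A f x = lExt_cov C Res n A g x"
        using lExt_cov_left_homotopic[OF that] by blast
    qed
    moreover have "con_factors_stable C (\<Q> \<inter> \<W> \<inter> \<R>) (\<lambda>A. lExt C Res n A B) (\<lambda>f. lExt_con C Res n f B)"
      if "B \<in> Obj C" for n B
      by (rule con_factors_stableI[OF Z con_functor_lExt[OF that]]) (rule lExt_con_homotopic[OF that])
    note facts = cov_functor_lExt con_functor_lExt lExt_con_cov_commute lExt_fibration_long_exact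
      lExt_cov_left_homotopic calculation lExt_cofibration_long_exact this }
  note results = this
  show ?thesis
    by (intro conjI allI impI ballI ex; (elim conjE)?) (rule results; assumption)+
qed

end
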